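(* Let $\theta \in (0,1)$ be irrational, $\mu \in \mathbb{R}\setminus[0,4]$, and let $h:\mathbb{R}\to\mathbb{R}$ be even, smooth and exponentially decaying. Let $H_r(b)$, $b\in\mathbb{R}$, be the reduced incommensurate coupled chain operators on $\ell^2(\mathbb{Z})$ (defined in the context). Consider the graph $\mathbb{Z}$ endowed with the group of graph automorphisms $\mathcal{S} = (S_x)_{x\in\mathbb{Z}}$, $S_x n := n - x$. For each $x\in\mathbb{Z}$ let $$T_x b := b + x \mod (1-\theta), \qquad (U_x\psi)_n := \psi_{n-x}, \quad n\in\mathbb{Z},$$ for $b\in[0,1-\theta)$ and $\psi\in\ell^2(\mathbb{Z})$. Then $(T_x)_{x\in\mathbb{Z}}$ is a group of measure-preserving transformations representing $\mathcal{S}$ whose action on the probability space $([0,1-\theta),\mathcal{A},\mathbb{P})$, where $\mathcal{A}$ is the Borel $\sigma$-algebra and $\mathbb{P}$ is normalized Lebesgue measure, is ergodic; $(U_x)_{x\in\mathbb{Z}}$ is a group of unitary operators on $\ell^2(\mathbb{Z})$; and $$H_r(T_x b) = U_x H_r(b) U_x^\dagger \qquad \text{for all } x\in\mathbb{Z},\ b\in[0,1-\theta).$$ Thus $b\mapsto H_r(b)$, $b\in[0,1-\theta)$, is an ergodic operator (in the sense defined in the context).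
   Context: **Operator.** The discrete Laplacian is $(\Delta\psi)_n := \psi_{n+1}-2\psi_n+\psi_{n-1}$ on $\ell^2(\mathbb{Z})$; the spectrum of $-\Delta$ is $[0,4]$, so $-\Delta-\mu$ is invertible for $\mu\notin[0,4]$, and $(-\Delta-\mu)^{-1}_{nn'}$ denotes the matrix elements of its inverse. Exponentially decaying means $|h(\eta)|\le Ce^{-c|\eta|}$ for some $C,c>0$. For $b\in\mathbb{R}$, the reduced incommensurate coupled chain operator is the self-adjoint operator on $\ell^2(\mathbb{Z})$ $$(H_r(b)\psi)_n := -(\Delta\psi)_n - \sum_{n'\in\mathbb{Z}} h(n-(1-\theta)n'-b)\sum_{n''\in\mathbb{Z}}(-\Delta-\mu)^{-1}_{n'n''}\sum_{n'''\in\mathbb{Z}} h((1-\theta)n''+b-n''')\psi_{n'''}.$$ **Ergodic operators.** A self-adjoint random operator is a map $\omega\mapsto H(\omega)$ from a probability space $(\Omega,\mathcal{A},\mathbb{P})$ to self-adjoint operators on a common separable Hilbert space $\mathcal{H}$ that is weakly measurable: for every bounded measurable $f$ on $\mathbb{R}$ and all $\varphi,\psi\in\mathcal{H}$, $\omega\mapsto\langle\varphi,f(H(\omega))\psi\rangle$ is measurable. The action of a group of measure-preserving transformations $(T_x)_{x\in I}$ on $(\Omega,\mathcal{A},\mathbb{P})$ is ergodic if every $A\in\mathcal{A}$ with $T_x^{-1}A=A$ for all $x\in I$ has probability $0$ or $1$. An ergodic operator is a random operator $H(\omega)$ such that: (1) it acts on $\ell^2(\mathbb{G})$, where the graph $\mathbb{G}$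 is endowed with a group of graph automorphisms $\mathcal{S}=(S_x)_{x\in I}$ that is vertex-transitive (any vertex can be mapped to any other); (2) $\mathcal{S}$ can be represented by a group of measure-preserving transformations $(T_x)_{x\in I}$ acting ergodically on $(\Omega,\mathcal{A},\mathbb{P})$, and for every $x\in I$, $\omega\in\Omega$, $H(T_x\omega)=U_{x,\omega}H(\omega)U_{x,\omega}^\dagger$ with a unitary $U_{x,\omega}$ of the form $(U_{x,\omega}\psi)(\xi)=\psi(S_x\xi)e^{i\phi_{x,\omega}(\xi)}$ for all $\psi\in\ell^2(\mathbb{G})$, with some real-valued phase $\phi_{x,\omega}(\xi)$. Here $\mathbb{Z}$ is the graph with edges between nearest neighbors. *)

theory Defs
  imports "HOL-Probability.Probability" "HOL-Library.Real_Mod"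
begin

section \<open>Operators on the Hilbert space of square-summable functions\<close>

text \<open>
  The Hilbert space over a vertex type is represented by a carrier set of functions.
  An operator is a total function whose behaviour matters only on this carrier.
\<close>

definition ell2 :: "('v \<Rightarrow> complex) set" where
  "ell2 = {\<psi>. (\<lambda>x. (cmod (\<psi> x))\<^sup>2) summable_on UNIV}"

text \<open>The inner product is antilinear in its first argument.\<close>

definition ip :: "('v \<Rightarrow> complex) \<Rightarrow> ('v \<Rightarrow> complex) \<Rightarrow> complex" where
  "ip \<phi> \<psi> = (\<Sum>\<^sub>\<infinity>x. cnj (\<phi> x) * \<psi> x)"

definition ell2_norm :: "('v \<Rightarrow> complex) \<Rightarrow> real" where
  "ell2_norm \<psi> = sqrt (\<Sum>\<^sub>\<infinity>x. (cmod (\<psi> x))\<^sup>2)"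

definition ket :: "'v \<Rightarrow> 'v \<Rightarrow> complex" where
  "ket x = (\<lambda>y. if y = x then 1 else 0)"

type_synonym 'v operator = "('v \<Rightarrow> complex) \<Rightarrow> ('v \<Rightarrow> complex)"

definition bounded_operator :: "'v operator \<Rightarrow> bool" where
  "bounded_operator A \<longleftrightarrow>
     (\<forall>\<psi>\<in>ell2. A \<psi> \<in> ell2) \<and>
     (\<forall>\<phi>\<in>ell2. \<forall>\<psi>\<in>ell2. A (\<lambda>x. \<phi> x + \<psi> x) = (\<lambda>x. A \<phi> x + A \<psi> x)) \<and>
     (\<forall>a. \<forall>\<psi>\<in>ell2. A (\<lambda>x. a * \<psi> x) = (\<lambda>x. a * A \<psi> x)) \<and>
     (\<exists>C. \<forall>\<psi>\<in>ell2. ell2_norm (A \<psi>) \<le> C * ell2_norm \<psi>)"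

definition self_adjoint :: "'v operator \<Rightarrow> bool" where
  "self_adjoint A \<longleftrightarrow>
     bounded_operator A \<and> (\<forall>\<phi>\<in>ell2. \<forall>\<psi>\<in>ell2. ip \<phi> (A \<psi>) = ip (A \<phi>) \<psi>)"

definition adjoint_operator :: "'v operator \<Rightarrow> 'v operator" where
  "adjoint_operator A \<phi> = (THE \<eta>. \<eta> \<in> ell2 \<and> (\<forall>\<psi>\<in>ell2. ip \<eta> \<psi> = ip \<phi> (A \<psi>)))"

definition unitary_operator :: "'v operator \<Rightarrow> bool" where
  "unitary_operator U \<longleftrightarrow>
     bounded_operator U \<and> bij_betw U ell2 ell2 \<and>
     (\<forall>\<phi>\<in>ell2. \<forall>\<psi>\<in>ell2. ip (U \<phi>) (U \<psi>) = ip \<phi> \<psi>)"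

definition matrix_element :: "'v operator \<Rightarrow> 'v \<Rightarrow> 'v \<Rightarrow> complex" where
  "matrix_element A x y = ip (ket x) (A (ket y))"


section \<open>Borel functional calculus\<close>

definition projection_valued_measure :: "(real set \<Rightarrow> 'v operator) \<Rightarrow> bool" where
  "projection_valued_measure E \<longleftrightarrow>
     (\<forall>B\<in>sets borel. self_adjoint (E B)) \<and>
     (\<forall>\<psi>\<in>ell2. E {} \<psi> = (\<lambda>_. 0) \<and> E UNIV \<psi> = \<psi>) \<and>
     (\<forall>B\<in>sets borel. \<forall>C\<in>sets borel. \<forall>\<psi>\<in>ell2. E (B \<inter> C) \<psi> = E B (E C \<psi>)) \<and>
     (\<forall>B :: nat \<Rightarrow> real set. range B \<subseteq> sets borel \<longrightarrow> disjoint_family B \<longrightarrow>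
        (\<forall>\<phi>\<in>ell2. \<forall>\<psi>\<in>ell2. (\<lambda>i. ip \<phi> (E (B i) \<psi>)) sums ip \<phi> (E (\<Union>i. B i) \<psi>)))"

definition scalar_spectral_measure ::
    "(real set \<Rightarrow> 'v operator) \<Rightarrow> ('v \<Rightarrow> complex) \<Rightarrow> real measure" where
  "scalar_spectral_measure E \<psi> =
     measure_of UNIV (sets borel) (\<lambda>B. ennreal (Re (ip \<psi> (E B \<psi>))))"

text \<open>
  The spectral measure of a bounded self-adjoint operator is the compactly supported
  projection-valued measure whose first moment is that operator.  It is determined only
  on Borel sets and on square-summable vectors, whence the use of SOME here and in
  the definition of the functional calculus.
\<close>

definition is_spectral_measure :: "'v operator \<Rightarrow> (real set \<Rightarrow> 'v operator) \<Rightarrow> bool" where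
  "is_spectral_measure H E \<longleftrightarrow>
     projection_valued_measure E \<and>
     (\<exists>R. \<forall>\<psi>\<in>ell2. E {-R..R} \<psi> = \<psi>) \<and>
     (\<forall>\<psi>\<in>ell2. ip \<psi> (H \<psi>) = of_real (\<integral>t. t \<partial>scalar_spectral_measure E \<psi>))"

definition spectral_measure :: "'v operator \<Rightarrow> real set \<Rightarrow> 'v operator" where
  "spectral_measure H = (SOME E. is_spectral_measure H E)"

text \<open>By polarization, the diagonal condition determines the operator on the carrier.\<close>

definition functional_calculus :: "(real \<Rightarrow> complex) \<Rightarrow> 'v operator \<Rightarrow> 'v operator" where
  "functional_calculus f H =
     (SOME A. bounded_operator A \<and>
        (\<forall>\<psi>\<in>ell2. ip \<psi> (A \<psi>) = (\<integral>t. f t \<partial>scalar_spectral_measure (spectral_measure H) \<psi>)))"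


section \<open>Ergodic operators\<close>

definition random_operator :: "'w measure \<Rightarrow> ('w \<Rightarrow> 'v::countable operator) \<Rightarrow> bool" where
  "random_operator M H \<longleftrightarrow>
     prob_space M \<and>
     (\<forall>\<omega>\<in>space M. self_adjoint (H \<omega>)) \<and>
     (\<forall>f\<in>borel_measurable borel. bounded (range f) \<longrightarrow>
        (\<forall>\<phi>\<in>ell2. \<forall>\<psi>\<in>ell2.
           (\<lambda>\<omega>. ip \<phi> (functional_calculus f (H \<omega>) \<psi>)) \<in> borel_measurable M))"

text \<open>
  A group of transformations of a set, indexed by an (additively written, not necessarily
  commutative) group; bijectivity on the set follows from the existence of inverses.
\<close>

definition transformation_group :: "'a set \<Rightarrow> ('i::group_add \<Rightarrow> 'a \<Rightarrow> 'a) \<Rightarrow> bool" where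
  "transformation_group X F \<longleftrightarrow>
     (\<forall>x. \<forall>a\<in>X. F x a \<in> X) \<and>
     (\<forall>a\<in>X. F 0 a = a) \<and>
     (\<forall>x y. \<forall>a\<in>X. F (x + y) a = F x (F y a))"

definition measure_preserving_group :: "'w measure \<Rightarrow> ('i::group_add \<Rightarrow> 'w \<Rightarrow> 'w) \<Rightarrow> bool" where
  "measure_preserving_group M T \<longleftrightarrow>
     transformation_group (space M) T \<and>
     (\<forall>x. T x \<in> measurable M M \<and> distr M M (T x) = M)"

definition ergodic_action :: "'w measure \<Rightarrow> ('i \<Rightarrow> 'w \<Rightarrow> 'w) \<Rightarrow> bool" where
  "ergodic_action M T \<longleftrightarrow>
     (\<forall>A\<in>sets M. (\<forall>x. T x -` A \<inter> space M = A) \<longrightarrow> measure M A = 0 \<or> measure M A = 1)"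

text \<open>
  Both families are homomorphic images of the same index group, so what remains is that
  the assignment of T x to S x is well defined.
\<close>

definition represents ::
    "'w measure \<Rightarrow> ('i::group_add \<Rightarrow> 'w \<Rightarrow> 'w) \<Rightarrow> ('i \<Rightarrow> 'v \<Rightarrow> 'v) \<Rightarrow> bool" where
  "represents M T S \<longleftrightarrow>
     transformation_group UNIV S \<and> transformation_group (space M) T \<and>
     (\<forall>x y. S x = S y \<longrightarrow> (\<forall>\<omega>\<in>space M. T x \<omega> = T y \<omega>))"

definition simple_graph :: "('v \<Rightarrow> 'v \<Rightarrow> bool) \<Rightarrow> bool" where
  "simple_graph adj \<longleftrightarrow> symp adj \<and> irreflp adj"

definition automorphism_group ::
    "('v \<Rightarrow> 'v \<Rightarrow> bool) \<Rightarrow> ('i::group_add \<Rightarrow> 'v \<Rightarrow> 'v) \<Rightarrow> bool" where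
  "automorphism_group adj S \<longleftrightarrow>
     transformation_group UNIV S \<and> (\<forall>x u v. adj (S x u) (S x v) \<longleftrightarrow> adj u v)"

definition vertex_transitive :: "('i \<Rightarrow> 'v \<Rightarrow> 'v) \<Rightarrow> bool" where
  "vertex_transitive S \<longleftrightarrow> (\<forall>u v. \<exists>x. S x u = v)"

definition ergodic_operator ::
    "('v::countable \<Rightarrow> 'v \<Rightarrow> bool) \<Rightarrow> ('i::group_add \<Rightarrow> 'v \<Rightarrow> 'v) \<Rightarrow>
     'w measure \<Rightarrow> ('i \<Rightarrow> 'w \<Rightarrow> 'w) \<Rightarrow> ('w \<Rightarrow> 'v operator) \<Rightarrow> bool" where
  "ergodic_operator adj S M T H \<longleftrightarrow>
     random_operator M H \<and>
     simple_graph adj \<and> automorphism_group adj S \<and> vertex_transitive S \<and>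
     measure_preserving_group M T \<and> ergodic_action M T \<and> represents M T S \<and>
     (\<exists>phase :: 'i \<Rightarrow> 'w \<Rightarrow> 'v \<Rightarrow> real. \<forall>x. \<forall>\<omega>\<in>space M.
        let U = (\<lambda>\<psi> \<xi>. \<psi> (S x \<xi>) * cis (phase x \<omega> \<xi>)) in
          unitary_operator U \<and>
          (\<forall>\<psi>\<in>ell2. H (T x \<omega>) \<psi> = U (H \<omega> (adjoint_operator U \<psi>))))"


section \<open>The reduced incommensurate coupled chain\<close>

definition smooth_function :: "(real \<Rightarrow> real) \<Rightarrow> bool" where
  "smooth_function h \<longleftrightarrow> (\<forall>k x. (deriv ^^ k) h differentiable (at x))"

definition exponentially_decaying :: "(real \<Rightarrow> real) \<Rightarrow> bool" where
  "exponentially_decaying h \<longleftrightarrow>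
     (\<exists>C>0. \<exists>c>0. \<forall>\<eta>. \<bar>h \<eta>\<bar> \<le> C * exp (- c * \<bar>\<eta>\<bar>))"

definition laplacian :: "int operator" where
  "laplacian \<psi> = (\<lambda>n. \<psi> (n + 1) - 2 * \<psi> n + \<psi> (n - 1))"

definition resolvent :: "real \<Rightarrow> int operator" where
  "resolvent \<mu> = inv_into ell2 (\<lambda>\<psi> n. - laplacian \<psi> n - of_real \<mu> * \<psi> n)"

definition H_r :: "real \<Rightarrow> real \<Rightarrow> (real \<Rightarrow> real) \<Rightarrow> real \<Rightarrow> int operator" where
  "H_r \<theta> \<mu> h b \<psi> = (\<lambda>n. - laplacian \<psi> n -
     (\<Sum>\<^sub>\<infinity>n'. of_real (h (of_int n - (1 - \<theta>) * of_int n' - b)) *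
       (\<Sum>\<^sub>\<infinity>n''. matrix_element (resolvent \<mu>) n' n'' *
         (\<Sum>\<^sub>\<infinity>n'''. of_real (h ((1 - \<theta>) * of_int n'' + b - of_int n''')) * \<psi> n'''))))"

definition int_adjacent :: "int \<Rightarrow> int \<Rightarrow> bool" where
  "int_adjacent m n \<longleftrightarrow> \<bar>m - n\<bar> = 1"

definition int_shift :: "int \<Rightarrow> int \<Rightarrow> int" where
  "int_shift x n = n - x"

definition moire_space :: "real \<Rightarrow> real measure" where
  "moire_space \<theta> = uniform_measure (restrict_space lborel {0..<1 - \<theta>}) {0..<1 - \<theta>}"

definition moire_shift :: "real \<Rightarrow> int \<Rightarrow> real \<Rightarrow> real" where
  "moire_shift \<theta> x b = (b + of_int x) rmod (1 - \<theta>)"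

definition translation :: "int \<Rightarrow> int operator" where
  "translation x \<psi> = (\<lambda>n. \<psi> (n - x))"

end

theory Submission
  imports Defs "HOL-Real_Asymp.Real_Asymp" "HOL-Analysis.Kronecker_Approximation_Theorem"
begin

text \<open>
  Covariance is a reindexing of the sums, because the resolvent of the Laplacian is convolution
  with an explicit Green function: replacing \<open>b\<close> by \<open>b + x - k (1 - \<theta>)\<close> shifts the outer
  indices by \<open>x\<close> and the inner ones by \<open>k\<close>.  For ergodicity, an invariant set extends to a set
  invariant under the dense group generated by 1 and \<open>1 - \<theta>\<close>; the measure of its
  intersection with an interval is then a fixed multiple of the length, so its density is 0 or 1.

  Weak measurability of \<open>f (H b)\<close> rests on the spectral theorem.  If \<open>0 \<le> K \<le> 1\<close>, then
  \<open>\<langle>\<psi>, K\<^sup>i (1 - K)\<^sup>j \<psi>\<rangle> \<ge> 0\<close>, so the moments \<open>\<langle>\<psi>, K\<^sup>j \<psi>\<rangle>\<close> are those of a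
  measure on \<open>[0, 1]\<close> (Hausdorff), and polarization of these measures gives the functional
  calculus.  Every identity, as well as measurability in \<open>b\<close>, extends from powers to bounded
  Borel functions by a monotone class argument.
\<close>


section \<open>Square-summable functions and bounded operators\<close>

text \<open>\<open>spectral_measure\<close> and \<open>functional_calculus\<close> are
  \<open>SOME\<close> choices, made anew for every \<open>b\<close>, so it is not enough to
  construct one spectral measure: every admissible choice must be shown to give the same inner
  products before measurability in \<open>b\<close> can be proved. This is why uniqueness is
  established for an arbitrary projection-valued measure with the right mean: multiplicativity on
  intersections upgrades the first moment to all moments, and moments determine everything.

  The second requirement is uniformity in \<open>b\<close>. The Schur test bounds all operators by
  one constant, so a single affine substitution carries every spectrum into \<open>{0..1}\<close>
  and one transported test function serves all \<open>b\<close>.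

  Powers and indicators must lie in one class of test functions; therefore boundedness is demanded
  on a compact set only, never on the whole line.

  The condition on \<open>\<mu>\<close> enters through the equation z + 1/z = 2 -
  \<open>\<mu>\<close>: for \<open>\<mu>\<close> outside [0,4] it has a real root with |z| < 1, and
  the powers of this root form the decaying Green function.\<close>

definition nsq :: "('v \<Rightarrow> complex) \<Rightarrow> real" where
  "nsq \<psi> = (\<Sum>\<^sub>\<infinity>x. (cmod (\<psi> x))\<^sup>2)"

lemma ell2_norm_eq: "ell2_norm \<psi> = sqrt (nsq \<psi>)"
  by (simp add: ell2_norm_def nsq_def)

lemma nsq_nonneg [simp]: "nsq \<psi> \<ge> 0"
  unfolding nsq_def by (rule infsum_nonneg) simp

lemma has_sum_nsq: "\<psi> \<in> ell2 \<Longrightarrow> ((\<lambda>x. (cmod (\<psi> x))\<^sup>2) has_sum nsq \<psi>) UNIV"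
  unfolding nsq_def ell2_def by simp

lemma sum_le_nsq: "\<psi> \<in> ell2 \<Longrightarrow> finite F \<Longrightarrow> (\<Sum>x\<in>F. (cmod (\<psi> x))\<^sup>2) \<le> nsq \<psi>"
  unfolding nsq_def ell2_def by (intro finite_sum_le_infsum) auto

lemma cmod_le_nsq: "\<psi> \<in> ell2 \<Longrightarrow> (cmod (\<psi> x))\<^sup>2 \<le> nsq \<psi>"
  using sum_le_nsq[of \<psi> "{x}"] by simp

lemma ell2I_bounded:
  assumes "\<And>F. finite F \<Longrightarrow> (\<Sum>x\<in>F. (cmod (\<psi> x))\<^sup>2) \<le> C"
  shows "\<psi> \<in> ell2" "nsq \<psi> \<le> C"
proof -
  show *: "\<psi> \<in> ell2"
    unfolding ell2_def mem_Collect_eq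
    by (rule nonneg_bdd_above_summable_on) (auto intro!: bdd_aboveI2 assms)
  show "nsq \<psi> \<le> C"
    unfolding nsq_def
    by (rule infsum_le_finite_sums) (use * assms in \<open>auto simp: ell2_def\<close>)
qed

lemma cmod_add_sq_le: "(cmod (a + b))\<^sup>2 \<le> 2 * (cmod a)\<^sup>2 + 2 * (cmod b)\<^sup>2"
proof -
  have "(cmod (a + b))\<^sup>2 \<le> (cmod a + cmod b)\<^sup>2"
    by (intro power_mono norm_triangle_ineq) auto
  also have "\<dots> \<le> 2 * (cmod a)\<^sup>2 + 2 * (cmod b)\<^sup>2"
    using sum_squares_bound[of "cmod a" "cmod b"] by (simp add: power2_sum)
  finally show ?thesis .
qed

lemma ell2_zero [simp]: "(\<lambda>_. 0) \<in> ell2"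
  by (simp add: ell2_def)

lemma nsq_zero [simp]: "nsq (\<lambda>_. 0) = 0"
  by (simp add: nsq_def)

lemma
  assumes "\<phi> \<in> ell2" "\<psi> \<in> ell2"
  shows ell2_add: "(\<lambda>x. \<phi> x + \<psi> x) \<in> ell2"
    and nsq_add_le: "nsq (\<lambda>x. \<phi> x + \<psi> x) \<le> 2 * nsq \<phi> + 2 * nsq \<psi>"
proof -
  have "(\<Sum>x\<in>F. (cmod (\<phi> x + \<psi> x))\<^sup>2) \<le> 2 * nsq \<phi> + 2 * nsq \<psi>" if "finite F" for F
  proof -
    have "(\<Sum>x\<in>F. (cmod (\<phi> x + \<psi> x))\<^sup>2) \<le> (\<Sum>x\<in>F. 2 * (cmod (\<phi> x))\<^sup>2 + 2 * (cmod (\<psi> x))\<^sup>2)"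
      by (intro sum_mono cmod_add_sq_le)
    also have "\<dots> = 2 * (\<Sum>x\<in>F. (cmod (\<phi> x))\<^sup>2) + 2 * (\<Sum>x\<in>F. (cmod (\<psi> x))\<^sup>2)"
      by (simp add: sum.distrib sum_distrib_left)
    also have "\<dots> \<le> 2 * nsq \<phi> + 2 * nsq \<psi>"
      using assms sum_le_nsq that by (intro add_mono mult_left_mono) auto
    finally show ?thesis .
  qed
  from ell2I_bounded[OF this] show "(\<lambda>x. \<phi> x + \<psi> x) \<in> ell2"
    "nsq (\<lambda>x. \<phi> x + \<psi> x) \<le> 2 * nsq \<phi> + 2 * nsq \<psi>"
    by blast+
qed

lemma nsq_scale: "nsq (\<lambda>x. a * \<psi> x) = (cmod a)\<^sup>2 * nsq \<psi>"
  unfolding nsq_def by (simp add: norm_mult power_mult_distrib infsum_cmult_right')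

lemma ell2_scale: "\<psi> \<in> ell2 \<Longrightarrow> (\<lambda>x. a * \<psi> x) \<in> ell2"
  unfolding ell2_def mem_Collect_eq norm_mult power_mult_distrib
  by (rule summable_on_cmult_right)

lemma ell2_uminus: "\<psi> \<in> ell2 \<Longrightarrow> (\<lambda>x. - \<psi> x) \<in> ell2"
  unfolding ell2_def by simp

lemma ell2_diff: "\<phi> \<in> ell2 \<Longrightarrow> \<psi> \<in> ell2 \<Longrightarrow> (\<lambda>x. \<phi> x - \<psi> x) \<in> ell2"
  using ell2_add[OF _ ell2_uminus, of \<phi> \<psi>] by simp

lemma nsq_uminus: "nsq (\<lambda>x. - \<psi> x) = nsq \<psi>"
  by (simp add: nsq_def)

lemma nsq_diff_le:
  "\<phi> \<in> ell2 \<Longrightarrow> \<psi> \<in> ell2 \<Longrightarrow> nsq (\<lambda>x. \<phi> x - \<psi> x) \<le> 2 * nsq \<phi> + 2 * nsq \<psi>"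
  using nsq_add_le[OF _ ell2_uminus, of \<phi> \<psi>] by (simp add: nsq_uminus)

lemmas ell2_closed = ell2_add ell2_scale ell2_uminus ell2_diff

lemma finite_support_ell2: "finite F \<Longrightarrow> (\<And>x. x \<notin> F \<Longrightarrow> \<psi> x = 0) \<Longrightarrow> \<psi> \<in> ell2"
  unfolding ell2_def mem_Collect_eq
  by (rule finite_nonzero_values_imp_summable_on, rule finite_subset[of _ F]) auto

lemma ket_ell2 [simp]: "ket x \<in> ell2"
  by (rule finite_support_ell2[of "{x}"]) (auto simp: ket_def)

lemma nsq_finite_support:
  "finite F \<Longrightarrow> (\<And>x. x \<notin> F \<Longrightarrow> \<psi> x = 0) \<Longrightarrow> nsq \<psi> = (\<Sum>x\<in>F. (cmod (\<psi> x))\<^sup>2)"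
  unfolding nsq_def by (subst infsum_cong_neutral[where T=F and g="\<lambda>x. (cmod (\<psi> x))\<^sup>2"]) auto

lemma cmod_mult_le: "cmod (cnj a * b) \<le> ((cmod a)\<^sup>2 + (cmod b)\<^sup>2) / 2"
  using sum_squares_bound[of "cmod a" "cmod b"] by (simp add: norm_mult)

lemma
  assumes "\<phi> \<in> ell2" "\<psi> \<in> ell2"
  shows ip_abs_summable: "(\<lambda>x. norm (cnj (\<phi> x) * \<psi> x)) summable_on UNIV"
    and cmod_ip_le: "cmod (ip \<phi> \<psi>) \<le> (nsq \<phi> + nsq \<psi>) / 2"
proof -
  have s: "((\<lambda>x. ((cmod (\<phi> x))\<^sup>2 + (cmod (\<psi> x))\<^sup>2) / 2) has_sum (nsq \<phi> + nsq \<psi>) / 2) UNIV"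
    by (intro has_sum_divide_const has_sum_add has_sum_nsq assms)
  show 1: "(\<lambda>x. norm (cnj (\<phi> x) * \<psi> x)) summable_on UNIV"
    by (rule summable_on_comparison_test[OF has_sum_imp_summable[OF s]])
      (use cmod_mult_le in auto)
  show "cmod (ip \<phi> \<psi>) \<le> (nsq \<phi> + nsq \<psi>) / 2"
    unfolding ip_def
    by (rule norm_infsum_le[OF has_sum_infsum[OF abs_summable_summable[OF 1]] s])
      (use cmod_mult_le in auto)
qed

lemma ip_has_sum: "\<phi> \<in> ell2 \<Longrightarrow> \<psi> \<in> ell2 \<Longrightarrow> ((\<lambda>x. cnj (\<phi> x) * \<psi> x) has_sum ip \<phi> \<psi>) UNIV"
  unfolding ip_def by (rule has_sum_infsum[OF abs_summable_summable[OF ip_abs_summable]])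

lemma ip_add_right:
  assumes "\<phi> \<in> ell2" "\<psi> \<in> ell2" "\<zeta> \<in> ell2"
  shows "ip \<phi> (\<lambda>x. \<psi> x + \<zeta> x) = ip \<phi> \<psi> + ip \<phi> \<zeta>"
proof -
  have "((\<lambda>x. cnj (\<phi> x) * \<psi> x + cnj (\<phi> x) * \<zeta> x) has_sum (ip \<phi> \<psi> + ip \<phi> \<zeta>)) UNIV"
    by (intro has_sum_add ip_has_sum assms)
  then show ?thesis
    unfolding ip_def[of \<phi> "\<lambda>x. \<psi> x + \<zeta> x"] distrib_left by (rule infsumI)
qed

lemma ip_scale_right: "ip \<phi> (\<lambda>x. a * \<psi> x) = a * ip \<phi> \<psi>"
  unfolding ip_def infsum_cmult_right'[symmetric] by (intro infsum_cong) simp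

lemma cnj_ip: "cnj (ip \<phi> \<psi>) = ip \<psi> \<phi>"
  unfolding ip_def infsum_cnj[symmetric] by (intro infsum_cong) simp

lemma ip_add_left:
  assumes "\<phi> \<in> ell2" "\<psi> \<in> ell2" "\<zeta> \<in> ell2"
  shows "ip (\<lambda>x. \<phi> x + \<psi> x) \<zeta> = ip \<phi> \<zeta> + ip \<psi> \<zeta>"
  using arg_cong[OF ip_add_right[OF assms(3,1,2)], of cnj] by (simp add: cnj_ip)

lemma ip_scale_left: "ip (\<lambda>x. a * \<phi> x) \<psi> = cnj a * ip \<phi> \<psi>"
  using arg_cong[OF ip_scale_right[of \<psi> a \<phi>], of cnj] by (simp add: cnj_ip)

lemma ip_uminus_right: "ip \<phi> (\<lambda>x. - \<psi> x) = - ip \<phi> \<psi>"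
  using ip_scale_right[of \<phi> "-1" \<psi>] by simp

lemma ip_uminus_left: "ip (\<lambda>x. - \<phi> x) \<psi> = - ip \<phi> \<psi>"
  using ip_scale_left[of "-1" \<phi> \<psi>] by simp

lemma ip_diff_right:
  "\<phi> \<in> ell2 \<Longrightarrow> \<psi> \<in> ell2 \<Longrightarrow> \<zeta> \<in> ell2 \<Longrightarrow> ip \<phi> (\<lambda>x. \<psi> x - \<zeta> x) = ip \<phi> \<psi> - ip \<phi> \<zeta>"
  using ip_add_right[OF _ _ ell2_uminus, of \<phi> \<psi> \<zeta>] by (simp add: ip_uminus_right)

lemma ip_diff_left:
  "\<phi> \<in> ell2 \<Longrightarrow> \<psi> \<in> ell2 \<Longrightarrow> \<zeta> \<in> ell2 \<Longrightarrow> ip (\<lambda>x. \<phi> x - \<psi> x) \<zeta> = ip \<phi> \<zeta> - ip \<psi> \<zeta>"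
  using ip_add_left[OF _ ell2_uminus, of \<phi> \<psi> \<zeta>] by (simp add: ip_uminus_left)

lemma ip_zero_right [simp]: "ip \<phi> (\<lambda>_. 0) = 0"
  by (simp add: ip_def)

lemma ip_zero_left [simp]: "ip (\<lambda>_. 0) \<phi> = 0"
  by (simp add: ip_def)

lemma ip_ket_left [simp]: "ip (ket x) \<psi> = \<psi> x"
proof -
  have "ip (ket x) \<psi> = (\<Sum>\<^sub>\<infinity>y\<in>{x}. cnj (ket x y) * \<psi> y)"
    unfolding ip_def by (rule infsum_cong_neutral) (auto simp: ket_def)
  then show ?thesis by (simp add: ket_def)
qed

lemma ip_self:
  assumes "\<psi> \<in> ell2" shows "ip \<psi> \<psi> = of_real (nsq \<psi>)"
proof -
  have "((\<lambda>x. complex_of_real ((cmod (\<psi> x))\<^sup>2)) has_sum of_real (nsq \<psi>)) UNIV"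
    by (rule has_sum_of_real[OF has_sum_nsq[OF assms]])
  moreover have "(\<lambda>x. complex_of_real ((cmod (\<psi> x))\<^sup>2)) = (\<lambda>x. cnj (\<psi> x) * \<psi> x)"
    by (rule ext) (simp add: complex_norm_square mult.commute del: of_real_power)
  ultimately show ?thesis unfolding ip_def by (simp add: infsumI)
qed

text \<open>Pairing with \<open>ket x\<close> reads off the coordinate at \<open>x\<close>, so weak
  equality is equality of functions.\<close>

lemma ell2_eqI: 
  assumes "\<And>\<phi>. \<phi> \<in> ell2 \<Longrightarrow> ip \<phi> \<psi> = ip \<phi> \<zeta>" shows "\<psi> = \<zeta>"
proof
  fix x show "\<psi> x = \<zeta> x" using assms[of "ket x"] by simp
qed

lemma nsq_eqD: "\<psi> \<in> ell2 \<Longrightarrow> nsq \<psi> = 0 \<Longrightarrow> \<psi> = (\<lambda>_. 0)"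
  using cmod_le_nsq[of \<psi>] by fastforce

text \<open>Discharges the definite description: a second candidate has, after conjugation, the same
  inner products with every vector, so \<open>ell2_eqI\<close> identifies the two.\<close>

lemma adjoint_operator_eqI:
  assumes "\<eta> \<in> ell2" "\<And>\<psi>. \<psi> \<in> ell2 \<Longrightarrow> ip \<eta> \<psi> = ip \<phi> (A \<psi>)"
  shows "adjoint_operator A \<phi> = \<eta>"
  unfolding adjoint_operator_def
proof (rule the_equality)
  fix \<eta>' assume "\<eta>' \<in> ell2 \<and> (\<forall>\<psi>\<in>ell2. ip \<eta>' \<psi> = ip \<phi> (A \<psi>))"
  then have "ip \<psi> \<eta>' = ip \<psi> \<eta>" if "\<psi> \<in> ell2" for \<psi>
    using that assms(2) by (metis cnj_ip)
  then show "\<eta>' = \<eta>" by (rule ell2_eqI)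
qed (use assms in auto)

section \<open>Bounded operators and bounded sesquilinear forms\<close>

lemma bounded_operatorI:
  assumes "\<And>\<psi>. \<psi> \<in> ell2 \<Longrightarrow> A \<psi> \<in> ell2"
    and "\<And>\<phi> \<psi>. \<phi> \<in> ell2 \<Longrightarrow> \<psi> \<in> ell2 \<Longrightarrow> A (\<lambda>x. \<phi> x + \<psi> x) = (\<lambda>x. A \<phi> x + A \<psi> x)"
    and "\<And>a \<psi>. \<psi> \<in> ell2 \<Longrightarrow> A (\<lambda>x. a * \<psi> x) = (\<lambda>x. a * A \<psi> x)"
    and "\<And>\<psi>. \<psi> \<in> ell2 \<Longrightarrow> nsq (A \<psi>) \<le> C * nsq \<psi>"
  shows "bounded_operator A"
proof -
  have "ell2_norm (A \<psi>) \<le> sqrt C * ell2_norm \<psi>" if "\<psi> \<in> ell2" for \<psi>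
    using real_sqrt_le_mono[OF assms(4)[OF that]] by (simp add: ell2_norm_eq real_sqrt_mult)
  then show ?thesis
    unfolding bounded_operator_def using assms(1-3) by blast
qed

lemma bounded_operatorD:
  assumes "bounded_operator A"
  shows "\<And>\<psi>. \<psi> \<in> ell2 \<Longrightarrow> A \<psi> \<in> ell2"
    and "\<And>\<phi> \<psi>. \<phi> \<in> ell2 \<Longrightarrow> \<psi> \<in> ell2 \<Longrightarrow> A (\<lambda>x. \<phi> x + \<psi> x) = (\<lambda>x. A \<phi> x + A \<psi> x)"
    and "\<And>a \<psi>. \<psi> \<in> ell2 \<Longrightarrow> A (\<lambda>x. a * \<psi> x) = (\<lambda>x. a * A \<psi> x)"
  using assms unfolding bounded_operator_def by blast+

lemma nsq_le_of_norm_le: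
  assumes "ell2_norm \<phi> \<le> C * ell2_norm \<psi>" shows "nsq \<phi> \<le> C\<^sup>2 * nsq \<psi>"
proof -
  have "(ell2_norm \<phi>)\<^sup>2 \<le> (C * ell2_norm \<psi>)\<^sup>2"
    using assms by (intro power_mono) (auto simp: ell2_norm_eq)
  then show ?thesis by (simp add: ell2_norm_eq power_mult_distrib)
qed

lemma bounded_operator_nsq:
  assumes "bounded_operator A"
  obtains C where "C \<ge> 0" "\<And>\<psi>. \<psi> \<in> ell2 \<Longrightarrow> nsq (A \<psi>) \<le> C * nsq \<psi>"
  using assms nsq_le_of_norm_le unfolding bounded_operator_def by (metis zero_le_power2)

lemma self_adjointD:
  assumes "self_adjoint A"
  shows "bounded_operator A"
    and "\<And>\<phi> \<psi>. \<phi> \<in> ell2 \<Longrightarrow> \<psi> \<in> ell2 \<Longrightarrow> ip \<phi> (A \<psi>) = ip (A \<phi>) \<psi>"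
  using assms unfolding self_adjoint_def by blast+

lemma bounded_operator_compose:
  assumes "bounded_operator A" "bounded_operator B"
  shows "bounded_operator (\<lambda>\<psi>. A (B \<psi>))"
proof -
  obtain C where C: "C \<ge> 0" "\<And>\<psi>. \<psi> \<in> ell2 \<Longrightarrow> nsq (A \<psi>) \<le> C * nsq \<psi>"
    using bounded_operator_nsq[OF assms(1)] by auto
  obtain D where D: "D \<ge> 0" "\<And>\<psi>. \<psi> \<in> ell2 \<Longrightarrow> nsq (B \<psi>) \<le> D * nsq \<psi>"
    using bounded_operator_nsq[OF assms(2)] by auto
  have "nsq (A (B \<psi>)) \<le> C * D * nsq \<psi>" if "\<psi> \<in> ell2" for \<psi>
    using C(2)[OF bounded_operatorD(1)[OF assms(2) that]] mult_left_mono[OF D(2)[OF that] C(1)]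
    by simp
  then show ?thesis
    using assms by (intro bounded_operatorI[where C="C*D"]) (simp_all add: bounded_operatorD)
qed

lemma bounded_operator_add:
  assumes "bounded_operator A" "bounded_operator B"
  shows "bounded_operator (\<lambda>\<psi> x. A \<psi> x + B \<psi> x)"
proof -
  obtain C where C: "C \<ge> 0" "\<And>\<psi>. \<psi> \<in> ell2 \<Longrightarrow> nsq (A \<psi>) \<le> C * nsq \<psi>"
    using bounded_operator_nsq[OF assms(1)] by auto
  obtain D where D: "D \<ge> 0" "\<And>\<psi>. \<psi> \<in> ell2 \<Longrightarrow> nsq (B \<psi>) \<le> D * nsq \<psi>"
    using bounded_operator_nsq[OF assms(2)] by auto
  have "nsq (\<lambda>x. A \<psi> x + B \<psi> x) \<le> (2 * C + 2 * D) * nsq \<psi>" if "\<psi> \<in> ell2" for \<psi>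
    using nsq_add_le[of "A \<psi>" "B \<psi>"] C(2)[OF that] D(2)[OF that] bounded_operatorD(1) assms that
    by (fastforce simp: algebra_simps)
  then show ?thesis
    using assms by (intro bounded_operatorI[where C="2*C+2*D"])
      (simp_all add: bounded_operatorD algebra_simps ell2_add)
qed

lemma bounded_operator_scale:
  assumes "bounded_operator A"
  shows "bounded_operator (\<lambda>\<psi> x. a * A \<psi> x)"
proof -
  obtain C where C: "C \<ge> 0" "\<And>\<psi>. \<psi> \<in> ell2 \<Longrightarrow> nsq (A \<psi>) \<le> C * nsq \<psi>"
    using bounded_operator_nsq[OF assms(1)] by auto
  have "nsq (\<lambda>x. a * A \<psi> x) \<le> ((cmod a)\<^sup>2 * C) * nsq \<psi>" if "\<psi> \<in> ell2" for \<psi>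
    using mult_left_mono[OF C(2)[OF that], of "(cmod a)\<^sup>2"] by (simp add: nsq_scale)
  then show ?thesis
    using assms by (intro bounded_operatorI[where C="(cmod a)\<^sup>2 * C"])
      (simp_all add: bounded_operatorD algebra_simps ell2_scale)
qed

lemma bounded_operator_ident: "bounded_operator (\<lambda>\<psi>. \<psi>)"
  by (rule bounded_operatorI[where C=1]) auto

lemma bounded_operator_diff:
  "bounded_operator A \<Longrightarrow> bounded_operator B \<Longrightarrow> bounded_operator (\<lambda>\<psi> x. A \<psi> x - B \<psi> x)"
  using bounded_operator_add[OF _ bounded_operator_scale, of A B "-1"] by simp

lemma bounded_operator_funpow:
  "bounded_operator A \<Longrightarrow> bounded_operator (A ^^ n)"
  by (induction n)
    (simp_all add: bounded_operator_ident[folded id_def] bounded_operator_compose[folded comp_def])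

text \<open>A form represented by an operator forces its coordinates to be
  \<open>S (ket x) \<psi>\<close>, so the operator is written down and the work lies in
  square-summability and in recovering \<open>S\<close> off finitely supported vectors. The bound is
  additive because this is what polarization and the Schur test deliver; rescaling the first
  argument turns it into an operator bound.\<close>

lemma sesquilinear_operator:
  fixes S :: "('v \<Rightarrow> complex) \<Rightarrow> ('v \<Rightarrow> complex) \<Rightarrow> complex"
  assumes add_left: "\<And>\<phi> \<psi> \<zeta>. \<phi> \<in> ell2 \<Longrightarrow> \<psi> \<in> ell2 \<Longrightarrow> \<zeta> \<in> ell2 \<Longrightarrow>
      S (\<lambda>x. \<phi> x + \<psi> x) \<zeta> = S \<phi> \<zeta> + S \<psi> \<zeta>"
    and add_right: "\<And>\<phi> \<psi> \<zeta>. \<phi> \<in> ell2 \<Longrightarrow> \<psi> \<in> ell2 \<Longrightarrow> \<zeta> \<in> ell2 \<Longrightarrow>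
      S \<phi> (\<lambda>x. \<psi> x + \<zeta> x) = S \<phi> \<psi> + S \<phi> \<zeta>"
    and scale_left: "\<And>a \<phi> \<psi>. \<phi> \<in> ell2 \<Longrightarrow> \<psi> \<in> ell2 \<Longrightarrow> S (\<lambda>x. a * \<phi> x) \<psi> = cnj a * S \<phi> \<psi>"
    and scale_right: "\<And>a \<phi> \<psi>. \<phi> \<in> ell2 \<Longrightarrow> \<psi> \<in> ell2 \<Longrightarrow> S \<phi> (\<lambda>x. a * \<psi> x) = a * S \<phi> \<psi>"
    and bound: "\<And>\<phi> \<psi>. \<phi> \<in> ell2 \<Longrightarrow> \<psi> \<in> ell2 \<Longrightarrow> cmod (S \<phi> \<psi>) \<le> K * (nsq \<phi> + nsq \<psi>)"
  defines "A \<equiv> \<lambda>\<psi> x. S (ket x) \<psi>"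
  shows "bounded_operator A"
    and "\<And>\<phi> \<psi>. \<phi> \<in> ell2 \<Longrightarrow> \<psi> \<in> ell2 \<Longrightarrow> ip \<phi> (A \<psi>) = S \<phi> \<psi>"
    and "\<And>\<psi>. \<psi> \<in> ell2 \<Longrightarrow> nsq (A \<psi>) \<le> 4 * K\<^sup>2 * nsq \<psi>"
proof -
  \<comment> \<open>Truncation to a finite set: there \<open>S\<close> is a finite combination of
    its values on \<open>ket x\<close>.\<close>
  define cut where "cut F \<phi> = (\<lambda>x. if x \<in> F then \<phi> x else (0::complex))" for F :: "'v set" and \<phi>
  have cut_ell2: "cut F \<phi> \<in> ell2" if "finite F" for F :: "'v set" and \<phi>
    using that by (rule finite_support_ell2) (simp add: cut_def)
  have S_cut: "S (cut F \<phi>) \<psi> = (\<Sum>x\<in>F. cnj (\<phi> x) * A \<psi> x)"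
    if "finite F" "\<psi> \<in> ell2" for F \<phi> \<psi>
    using that
  proof (induction F rule: finite_induct)
    case empty
    have "cut {} \<phi> = (\<lambda>x. 0 * ket undefined x)" by (auto simp: cut_def)
    then show ?case using scale_left[of "ket undefined" \<psi> 0] empty by simp
  next
    case (insert y F)
    have "cut (insert y F) \<phi> = (\<lambda>x. (\<phi> y * ket y x) + cut F \<phi> x)"
      using insert.hyps by (auto simp: cut_def ket_def)
    then show ?case
      using insert by (simp add: add_left scale_left ell2_scale cut_ell2 A_def)
  qed
  have sq: "nsq (cut F \<phi>) = (\<Sum>x\<in>F. (cmod (\<phi> x))\<^sup>2)" if "finite F" for F \<phi>
    using nsq_finite_support[OF that, of "cut F \<phi>"] by (simp add: cut_def)
  \<comment> \<open>A ket has norm 1, so \<open>bound\<close> at any ket reads 0 <= 2K.\<close>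
  have "0 \<le> K * (nsq (ket undefined :: 'v \<Rightarrow> complex) + nsq (ket undefined :: 'v \<Rightarrow> complex))"
    by (rule order_trans[OF norm_ge_zero bound]) simp_all
  then have K: "K \<ge> 0"
    using nsq_finite_support[of "{undefined}" "ket undefined :: 'v \<Rightarrow> complex"]
    by (simp add: ket_def)
  have fin: "(\<Sum>x\<in>F. (cmod (A \<psi> x))\<^sup>2) \<le> 4 * K\<^sup>2 * nsq \<psi>" (is "?a \<le> _")
    if "finite F" "\<psi> \<in> ell2" for F \<psi>
  proof -
    \<comment> \<open>The form is tested on \<open>t\<close> times the truncated image itself, where
      it takes the value \<open>t * ?a\<close>.\<close>
    have t: "t * ?a \<le> K * (t\<^sup>2 * ?a + nsq \<psi>)" if "t > 0" for t :: real
    proof -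
      have "S (\<lambda>x. of_real t * cut F (A \<psi>) x) \<psi> = of_real t * of_real ?a"
        using \<open>finite F\<close> \<open>\<psi> \<in> ell2\<close>
        by (simp add: scale_left cut_ell2 S_cut complex_norm_square mult.commute del: of_real_power)
      also have "cmod \<dots> = t * ?a"
        using that by (simp add: norm_mult sum_nonneg del: of_real_sum of_real_power flip: of_real_mult)
      finally have "t * ?a \<le> K * (nsq (\<lambda>x. of_real t * cut F (A \<psi>) x) + nsq \<psi>)"
        using bound[of "\<lambda>x. of_real t * cut F (A \<psi>) x" \<psi>] cut_ell2 ell2_scale \<open>finite F\<close> \<open>\<psi> \<in> ell2\<close>
        by auto
      then show ?thesis using \<open>finite F\<close> by (simp add: nsq_scale sq)
    qed
    show ?thesis
    proof (cases "K = 0")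
      case True
      then show ?thesis using t[of 1] by simp
    next
      case False
      then have "K > 0" using K by simp
      \<comment> \<open>The choice t = 1/(2K) maximizes t - K t^2 and is the source of the constant
        4 K^2.\<close>
      then have "?a / (2*K) \<le> ?a / (4 * K) + K * nsq \<psi>"
        using t[of "1 / (2*K)"] by (simp add: field_simps power2_eq_square)
      then show ?thesis using \<open>K > 0\<close> by (simp add: field_simps power2_eq_square)
    qed
  qed
  have A_ell2: "A \<psi> \<in> ell2" and A_nsq: "nsq (A \<psi>) \<le> 4 * K\<^sup>2 * nsq \<psi>" if "\<psi> \<in> ell2" for \<psi>
    using ell2I_bounded[OF fin[OF _ that]] by auto
  then show "\<And>\<psi>. \<psi> \<in> ell2 \<Longrightarrow> nsq (A \<psi>) \<le> 4 * K\<^sup>2 * nsq \<psi>" by simp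
  show "bounded_operator A"
    by (rule bounded_operatorI[OF A_ell2 _ _ A_nsq]) (simp_all add: A_def add_right scale_right)
  fix \<phi> \<psi> :: "'v \<Rightarrow> complex" assume *: "\<phi> \<in> ell2" "\<psi> \<in> ell2"
  \<comment> \<open>\<open>g\<close> is the defect of the representation and vanishes on
    truncations, so \<open>g \<phi>\<close> is its value on a tail \<open>\<zeta>\<close> of squared
    norm at most 1/t^2. Scaled by \<open>t\<close>, the tail lies in the unit ball, where
    \<open>c\<close> bounds \<open>g\<close>; hence \<open>t * cmod (g \<phi>) \<le> c\<close> for
    every \<open>t\<close>.\<close>
  define g where "g \<zeta> = S \<zeta> \<psi> - ip \<zeta> (A \<psi>)" for \<zeta>
  define c where "c = (K + 1) * (1 + nsq \<psi> + nsq (A \<psi>))"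
  have "cmod (g \<phi>) \<le> c / t" if t: "t > 0" for t
  proof -
    obtain F where F: "finite F" "dist (\<Sum>x\<in>F. (cmod (\<phi> x))\<^sup>2) (nsq \<phi>) \<le> 1/t\<^sup>2"
      using has_sum_finite_approximation[OF has_sum_nsq[OF *(1)], of "1/t\<^sup>2"] t by auto
    define \<zeta> where "\<zeta> = (\<lambda>x. \<phi> x - cut F \<phi> x)"
    have \<zeta>: "\<zeta> \<in> ell2" unfolding \<zeta>_def using * F cut_ell2 by (intro ell2_diff) auto
    have "((\<lambda>x. (cmod (\<phi> x))\<^sup>2 - (cmod (cut F \<phi> x))\<^sup>2) has_sum (nsq \<phi> - nsq (cut F \<phi>))) UNIV"
      using has_sum_add[OF has_sum_nsq[OF *(1)] has_sum_uminusI[OF has_sum_nsq[OF cut_ell2[OF F(1), of \<phi>]]]]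
      by simp
    moreover have "(\<lambda>x. (cmod (\<phi> x))\<^sup>2 - (cmod (cut F \<phi> x))\<^sup>2) = (\<lambda>x. (cmod (\<zeta> x))\<^sup>2)"
      by (auto simp: \<zeta>_def cut_def)
    ultimately have "nsq \<zeta> = nsq \<phi> - nsq (cut F \<phi>)"
      unfolding nsq_def[of \<zeta>] by (intro infsumI) simp
    then have "nsq \<zeta> = nsq \<phi> - (\<Sum>x\<in>F. (cmod (\<phi> x))\<^sup>2)"
      using sq[OF F(1), of \<phi>] by simp
    then have nsq\<zeta>: "nsq \<zeta> \<le> 1/t\<^sup>2" using F by (auto simp: dist_real_def)
    have [simp]: "cut F \<phi> \<in> ell2" using F cut_ell2 by auto
    have "ip (cut F \<phi>) (A \<psi>) = (\<Sum>x\<in>F. cnj (\<phi> x) * A \<psi> x)"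
      unfolding ip_def using F(1)
      by (subst infsum_cong_neutral[where T=F and g="\<lambda>x. cnj (\<phi> x) * A \<psi> x"]) (auto simp: cut_def)
    then have "S (cut F \<phi>) \<psi> = ip (cut F \<phi>) (A \<psi>)"
      using S_cut F * by simp
    moreover have "S \<phi> \<psi> = S \<zeta> \<psi> + S (cut F \<phi>) \<psi>" "ip \<phi> (A \<psi>) = ip \<zeta> (A \<psi>) + ip (cut F \<phi>) (A \<psi>)"
      using add_left[of \<zeta> "cut F \<phi>" \<psi>] ip_add_left[of \<zeta> "cut F \<phi>" "A \<psi>"] \<zeta> * A_ell2
      by (simp_all add: \<zeta>_def)
    ultimately have "g \<phi> = g \<zeta>" by (simp add: g_def)
    moreover have "g (\<lambda>x. of_real t * \<zeta> x) = of_real t * g \<zeta>"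
      using \<zeta> * by (simp add: g_def scale_left ip_scale_left right_diff_distrib)
    moreover have "cmod (g (\<lambda>x. of_real t * \<zeta> x)) \<le> c"
    proof -
      let ?\<eta> = "\<lambda>x. of_real t * \<zeta> x"
      have \<eta>: "?\<eta> \<in> ell2" "nsq ?\<eta> \<le> 1"
        using \<zeta> mult_left_mono[OF nsq\<zeta>, of "t\<^sup>2"] t by (simp_all add: ell2_scale nsq_scale)
      have "cmod (g ?\<eta>) \<le> K * (nsq ?\<eta> + nsq \<psi>) + (nsq ?\<eta> + nsq (A \<psi>)) / 2"
        unfolding g_def
        by (intro order_trans[OF norm_triangle_ineq4] add_mono bound cmod_ip_le \<eta> A_ell2 *)
      also have "\<dots> \<le> K * (1 + nsq \<psi>) + (1 + nsq (A \<psi>)) / 2"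
        using \<eta> K by (intro add_mono mult_left_mono) auto
      also have "\<dots> \<le> K * (1 + nsq \<psi> + nsq (A \<psi>)) + (1 + nsq \<psi> + nsq (A \<psi>))"
      proof (rule add_mono)
        show "K * (1 + nsq \<psi>) \<le> K * (1 + nsq \<psi> + nsq (A \<psi>))"
          using K by (intro mult_left_mono) auto
        show "(1 + nsq (A \<psi>)) / 2 \<le> 1 + nsq \<psi> + nsq (A \<psi>)"
          using nsq_nonneg[of \<psi>] nsq_nonneg[of "A \<psi>"] by (auto simp: field_simps)
      qed
      also have "\<dots> = c"
        unfolding c_def by (simp add: ring_distribs)
      finally show ?thesis .
    qed
    ultimately have "t * cmod (g \<phi>) \<le> c" using t by (simp add: norm_mult)
    then show ?thesis using t by (simp add: pos_le_divide_eq mult.commute)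
  qed
  then have le: "t * cmod (g \<phi>) \<le> c" if "t > 0" for t
    using that by (simp add: pos_le_divide_eq mult.commute)
  have "cmod (g \<phi>) = 0"
  proof (rule ccontr)
    assume "cmod (g \<phi>) \<noteq> 0"
    then have "cmod (g \<phi>) > 0" by simp
    then obtain n :: nat where n: "real n * cmod (g \<phi>) > c"
      using reals_Archimedean3 by blast
    have "c \<ge> 0" using K by (simp add: c_def)
    then have "n > 0" using n by (intro Nat.gr0I) auto
    then show False using n le[of "real n"] by simp
  qed
  then show "ip \<phi> (A \<psi>) = S \<phi> \<psi>" by (simp add: g_def)
qed

section \<open>The Hausdorff moment problem\<close>

text \<open>Pascal's rule under a sum, in the shape needed to iterate the recursion
  \<open>a i j = a (Suc i) j + a i (Suc j)\<close>.\<close>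

lemma choose_Suc_sum:
  fixes f :: "nat \<Rightarrow> real"
  shows "(\<Sum>m\<le>Suc N. (Suc N choose m) * f m) =
    (\<Sum>m\<le>N. (N choose m) * f m) + (\<Sum>m\<le>N. (N choose m) * f (Suc m))"
proof -
  have "(\<Sum>m\<le>Suc N. (Suc N choose m) * f m) =
    f 0 + (\<Sum>m\<le>N. (N choose Suc m) * f (Suc m)) + (\<Sum>m\<le>N. (N choose m) * f (Suc m))"
    by (simp add: sum.atMost_Suc_shift ring_distribs sum.distrib del: sum.atMost_Suc)
  also have "f 0 + (\<Sum>m\<le>N. (N choose Suc m) * f (Suc m)) = (\<Sum>m\<le>Suc N. (N choose m) * f m)"
    by (simp only: sum.atMost_Suc_shift) simp
  also have "\<dots> = (\<Sum>m\<le>N. (N choose m) * f m)"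
    by simp
  finally show ?thesis .
qed

text \<open>The ratio is the product of (k - i)/(n - i) over i < j, and each factor differs from k/n
  by at most i/(n - i). Since the factor k/n and the partial products lie in [0,1], the errors only
  add up; the induction closes because j + j^2 <= (j + 1)^2 and the denominator shrinks.\<close>

lemma choose_ratio_approx:
  assumes "j < n" "k \<le> n"
  shows "\<bar>real (k choose j) / real (n choose j) - (real k / real n) ^ j\<bar> \<le> (real j)\<^sup>2 / (real n - real j)"
  using assms(1)
proof (induction j)
  case 0
  then show ?case by simp
next
  case (Suc j)
  define q where "q i = real (k choose i) / real (n choose i)" for i
  define y where "y = real k / real n"
  define x where "x = (real k - real j) / (real n - real j)"
  have nj: "real n - real j > 0" and n: "real n > 0" using Suc.prems by auto
  have y: "0 \<le> y" "y \<le> 1" using assms n by (auto simp: y_def)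
  \<comment> \<open>Absorption identity over the reals. For m < j both binomials vanish, which
    covers \<open>k\<close> below \<open>j\<close>, where the factor \<open>x\<close> is
    negative.\<close>
  have abs: "real (Suc j) * (m choose Suc j) = (real m - real j) * (m choose j)" for m :: nat
  proof (cases "j \<le> m")
    case True
    then have "Suc j * (m choose Suc j) = (m - j) * (m choose j)"
      by (metis binomial_absorb_comp binomial_absorption mult.commute)
    then show ?thesis using True by (metis of_nat_diff of_nat_mult)
  qed (auto simp: binomial_eq_0)
  have "q (Suc j) = (real (Suc j) * (k choose Suc j)) / (real (Suc j) * (n choose Suc j))"
    unfolding q_def by simp
  also have "\<dots> = q j * x"
    unfolding abs q_def x_def by (simp add: mult.commute)
  finally have q_Suc: "q (Suc j) = q j * x" .
  have q: "0 \<le> q j" "q j \<le> 1"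
    using Suc.prems assms(2) binomial_mono[of k n j]
    by (auto simp: q_def divide_le_eq_1 binomial_right_mono)
  have "x - y = - (real j * (real n - real k) / (real n * (real n - real j)))"
    using nj n unfolding x_def y_def by (simp add: field_simps)
  also have "\<bar>\<dots>\<bar> = real j * (real n - real k) / (real n * (real n - real j))"
    using nj n assms(2) by (simp add: abs_mult)
  also have "\<dots> \<le> real j * real n / (real n * (real n - real j))"
    using nj n by (intro divide_right_mono mult_left_mono) auto
  also have "\<dots> = real j / (real n - real j)" using n by simp
  finally have xy: "\<bar>x - y\<bar> \<le> real j / (real n - real j)" .
  have "q (Suc j) - y ^ Suc j = q j * (x - y) + (q j - y ^ j) * y"
    by (simp add: q_Suc algebra_simps)
  also have "\<bar>\<dots>\<bar> \<le> \<bar>q j * (x - y)\<bar> + \<bar>(q j - y ^ j) * y\<bar>"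
    by (rule abs_triangle_ineq)
  also have "\<dots> = q j * \<bar>x - y\<bar> + \<bar>q j - y ^ j\<bar> * y"
    using q y by (simp add: abs_mult)
  also have "\<dots> \<le> 1 * (real j / (real n - real j)) + ((real j)\<^sup>2 / (real n - real j)) * 1"
    using Suc.prems q y xy Suc.IH
    by (intro add_mono mult_mono) (simp_all add: q_def y_def)
  also have "\<dots> = (real j + (real j)\<^sup>2) / (real n - real j)"
    by (simp add: add_divide_distrib)
  also have "\<dots> \<le> (real (Suc j))\<^sup>2 / (real n - real (Suc j))"
    using Suc.prems by (intro frac_le) (auto simp: power2_eq_square algebra_simps)
  finally show ?case by (simp add: q_def y_def)
qed

text \<open>
  The Bernstein weights \<open>(n choose k) * a k (n - k)\<close> at the points \<open>k / n\<close> reproduce binomial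
  moments exactly, that is, \<open>(k choose j) / (n choose j)\<close> integrates to \<open>a j 0\<close>; hence the ordinary
  moments converge, and a weak limit solves the moment problem.
\<close>

lemma real_distribution_of_moments:
  fixes a :: "nat \<Rightarrow> nat \<Rightarrow> real"
  assumes nonneg: "\<And>i j. 0 \<le> a i j"
    and rec: "\<And>i j. a i j = a (Suc i) j + a i (Suc j)"
    and a00: "a 0 0 = 1"
  obtains M where "real_distribution M" "AE x in M. x \<in> {0..1}" "\<And>j. (\<integral>x. x ^ j \<partial>M) = a j 0"
proof -
  \<comment> \<open>The recursion unfolded \<open>N\<close> times: the binomial coefficient counts
    the orders in which \<open>m\<close> of the steps raise the first index.\<close>
  have sum_a: "(\<Sum>m\<le>N. (N choose m) * a (i + m) (l + (N - m))) = a i l" for N i l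
  proof (induction N arbitrary: i l)
    case (Suc N)
    have "(\<Sum>m\<le>Suc N. (Suc N choose m) * a (i + m) (l + (Suc N - m))) =
      (\<Sum>m\<le>N. (N choose m) * a (i + m) (Suc l + (N - m))) +
      (\<Sum>m\<le>N. (N choose m) * a (Suc i + m) (l + (N - m)))"
      unfolding choose_Suc_sum by (intro arg_cong2[of _ _ _ _ "(+)"] sum.cong) (auto simp: Suc_diff_le)
    then show ?case unfolding Suc using rec[of i l] by simp
  qed auto
  define w where "w n k = (n choose k) * a k (n - k)" for n k :: nat
  have w_nonneg: "0 \<le> w n k" and w_0: "n < k \<Longrightarrow> w n k = 0" for n k
    using nonneg by (auto simp: w_def)
  have w_sum: "(\<Sum>k\<le>n. w n k) = 1" for n
    using sum_a[of n 0 0] a00 by (simp add: w_def)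
  define p where "p n = embed_pmf (w n)" for n
  have nn: "(\<integral>\<^sup>+k. ennreal (w n k) \<partial>count_space UNIV) = 1" for n
  proof -
    have "(\<integral>\<^sup>+k. ennreal (w n k) \<partial>count_space UNIV) = (\<Sum>k\<le>n. ennreal (w n k))"
      by (rule nn_integral_count_space') (use w_0 not_le in auto)
    then show ?thesis using w_sum w_nonneg by simp
  qed
  have pmf_p: "pmf (p n) k = w n k" for n k
    unfolding p_def by (rule pmf_embed_pmf) (use w_nonneg nn in auto)
  define M where "M n = distr (measure_pmf (p n)) borel (\<lambda>k. real k / real n)" for n
  have rd: "real_distribution (M n)" for n
    unfolding M_def by (rule prob_space.real_distribution_distr) (auto intro: prob_space_measure_pmf)
  have int_M: "(\<integral>x. f x \<partial>M n) = (\<Sum>k\<le>n. w n k * f (real k / real n))"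
    if "f \<in> borel_measurable borel" for f :: "real \<Rightarrow> real" and n
  proof -
    have "(\<integral>x. f x \<partial>M n) = (\<integral>k. f (real k / real n) \<partial>measure_pmf (p n))"
      unfolding M_def using that by (subst integral_distr) auto
    also have "\<dots> = (\<Sum>k\<le>n. pmf (p n) k *\<^sub>R f (real k / real n))"
      by (rule integral_measure_pmf) (use w_0 not_le in \<open>auto simp: set_pmf_iff pmf_p\<close>)
    finally show ?thesis by (simp add: pmf_p)
  qed
  have w_choose: "(\<Sum>k\<le>n. w n k * (k choose j)) = (n choose j) * a j 0" if "j \<le> n" for j n
  proof -
    have "(\<Sum>k\<le>n. w n k * (k choose j)) = (\<Sum>k=j..n. w n k * (k choose j))"
      by (rule sum.mono_neutral_right) auto
    \<comment> \<open>Choosing \<open>k\<close> of \<open>n\<close> and then \<open>j\<close> of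
      \<open>k\<close> is choosing \<open>j\<close> first; what is left is \<open>sum_a\<close>
      started at the index pair \<open>j\<close>, \<open>0\<close>.\<close>
    also have "\<dots> = (\<Sum>k=j..n. (n choose j) * (((n - j) choose (k - j)) * a k (n - k)))"
      by (rule sum.cong) (auto simp: w_def choose_mult mult.assoc mult.left_commute simp flip: of_nat_mult)
    also have "\<dots> = (\<Sum>m\<le>n - j. (n choose j) * (((n - j) choose m) * a (j + m) (0 + (n - j - m))))"
      by (rule sum.reindex_bij_witness[of _ "\<lambda>m. j + m" "\<lambda>k. k - j"]) (use that in auto)
    also have "\<dots> = (n choose j) * a j 0"
      unfolding sum_distrib_left[symmetric] sum_a ..
    finally show ?thesis .
  qed
  \<comment> \<open>Clamping to [0,1] makes powers bounded continuous test functions for weak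
    convergence and does not alter the grid points.\<close>
  define c where "c x = max 0 (min 1 x)" for x :: real
  have c_cont: "continuous_on UNIV c" unfolding c_def by (intro continuous_intros)
  have [measurable]: "c \<in> borel_measurable borel" 
    using c_cont by (rule borel_measurable_continuous_onI)
  have c_le: "0 \<le> c x" "c x \<le> 1" for x by (auto simp: c_def)
  have c_grid: "c (real k / real n) = real k / real n" if "k \<le> n" for k n
    using that by (cases "n = 0") (auto simp: c_def)
  have lim: "(\<lambda>n. \<integral>x. c x ^ j \<partial>M n) \<longlonglongrightarrow> a j 0" for j
  proof (rule Lim_transform_bound[where g="\<lambda>n. (real j)\<^sup>2 / (real n - real j)", THEN LIM_zero_cancel])
    show "\<forall>\<^sub>F n in sequentially. norm ((\<integral>x. c x ^ j \<partial>M n) - a j 0) \<le> norm ((real j)\<^sup>2 / (real n - real j))"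
      using eventually_gt_at_top[of j]
    proof eventually_elim
      case (elim n)
      have "(\<integral>x. c x ^ j \<partial>M n) = (\<Sum>k\<le>n. w n k * (real k / real n) ^ j)"
        by (subst int_M) (auto simp: c_grid)
      moreover have "a j 0 = (\<Sum>k\<le>n. w n k * (real (k choose j) / real (n choose j)))"
        using w_choose[of j n] elim by (simp add: sum_divide_distrib[symmetric])
      ultimately have "\<bar>(\<integral>x. c x ^ j \<partial>M n) - a j 0\<bar> =
        \<bar>\<Sum>k\<le>n. w n k * ((real k / real n) ^ j - real (k choose j) / real (n choose j))\<bar>"
        by (simp add: sum_subtractf right_diff_distrib)
      also have "\<dots> \<le> (\<Sum>k\<le>n. w n k * ((real j)\<^sup>2 / (real n - real j)))"
        by (rule order_trans[OF sum_abs], rule sum_mono)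
          (use choose_ratio_approx[OF elim] w_nonneg in
            \<open>auto simp: abs_mult abs_minus_commute simp del: times_divide_eq_right intro!: mult_left_mono\<close>)
      also have "\<dots> = (real j)\<^sup>2 / (real n - real j)"
        unfolding sum_distrib_right[symmetric] w_sum by simp
      finally show ?case using elim by simp
    qed
    show "(\<lambda>n. (real j)\<^sup>2 / (real n - real j)) \<longlonglongrightarrow> 0"
      by real_asymp
  qed
  have "tight M"
    unfolding tight_def
  proof (intro conjI allI impI rd)
    \<comment> \<open>The interval is open on the left, so it starts below 0 in order to contain the
      grid point 0; for \<open>n = 0\<close> division by zero puts all mass there.\<close>
    have "measure (M n) {-1<..1} = 1" for n
    proof -
    have "measure (M n) {-1<..1} = (\<integral>x. indicator {-1<..1} x \<partial>M n)"
      by (simp add: M_def)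
    also have "\<dots> = (\<Sum>k\<le>n. w n k * indicator {-1<..1} (real k / real n))"
      by (rule int_M) auto
    also have "\<dots> = (\<Sum>k\<le>n. w n k)"
      by (rule sum.cong) (auto simp: indicator_def divide_le_eq field_simps)
    finally show ?thesis using w_sum by simp
    qed
    moreover fix \<epsilon> :: real assume "\<epsilon> > 0"
    ultimately show "\<exists>a b. a < b \<and> (\<forall>n. 1 - \<epsilon> < measure (M n) {a<..b})"
      by (rule_tac x="-1" in exI, rule_tac x=1 in exI) auto
  qed
  \<comment> \<open>A subsequence is enough, because the limits of the moments are already known
    along the whole sequence.\<close>
  then obtain r N where r: "strict_mono r" and N: "real_distribution N"
    and wc: "weak_conv_m (M \<circ> id \<circ> r) N"
    using tight_imp_convergent_subsubsequence[of M id] by (auto simp: strict_mono_id)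
  interpret N: real_distribution N by fact
  have conv: "(\<lambda>n. \<integral>x. f x \<partial>M (r n)) \<longlonglongrightarrow> (\<integral>x. f x \<partial>N)"
    if "continuous_on UNIV f" "\<And>x. \<bar>f x\<bar> \<le> 1" for f :: "real \<Rightarrow> real"
  proof -
    have "isCont f x" for x using that(1) by (simp add: continuous_on_eq_continuous_at)
    then show ?thesis
      using weak_conv_imp_bdd_ae_continuous_conv[of "\<lambda>n. M (r n)" N f 1] wc rd N that
      by (auto simp: comp_def borel_measurable_continuous_onI)
  qed
  have moment: "(\<integral>x. c x ^ j \<partial>N) = a j 0" for j
  proof (rule LIMSEQ_unique)
    show "(\<lambda>n. \<integral>x. c x ^ j \<partial>M (r n)) \<longlonglongrightarrow> (\<integral>x. c x ^ j \<partial>N)"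
      by (rule conv) (use c_cont c_le in \<open>auto intro!: continuous_intros power_le_one\<close>)
    show "(\<lambda>n. \<integral>x. c x ^ j \<partial>M (r n)) \<longlonglongrightarrow> a j 0"
      using LIMSEQ_subseq_LIMSEQ[OF lim r] by (simp add: comp_def)
  qed
  \<comment> \<open>A bounded continuous function whose zero set is exactly [0,1]. Its mean vanishes
    under every \<open>M n\<close>, hence under the limit, which confines the limit to
    [0,1].\<close>
  define g where "g x = min 1 \<bar>x - c x\<bar>" for x
  have g_cont: "continuous_on UNIV g" unfolding g_def by (intro continuous_intros c_cont)
  have [measurable]: "g \<in> borel_measurable borel" 
    using g_cont by (rule borel_measurable_continuous_onI)
  have "(\<integral>x. g x \<partial>M n) = 0" for n
    by (subst int_M) (auto simp: g_def c_grid)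
  then have "(\<integral>x. g x \<partial>N) = 0"
    using conv[OF g_cont] LIMSEQ_unique[OF tendsto_const] by (force simp: g_def)
  moreover have "integrable N g"
    by (rule N.integrable_const_bound[of _ 1]) (auto simp: g_def)
  ultimately have "AE x in N. g x = 0"
    by (subst (asm) integral_nonneg_eq_0_iff_AE) (auto simp: g_def)
  then have AE01: "AE x in N. x \<in> {0..1}"
    by eventually_elim (auto simp: g_def c_def split: if_splits)
  have "(\<integral>x. x ^ j \<partial>N) = a j 0" for j
    unfolding moment[symmetric]
    by (rule integral_cong_AE) (use AE01 in \<open>auto simp: c_def\<close>)
  then show ?thesis using that N AE01 by blast
qed

section \<open>Bounded Borel functions\<close>

text \<open>Measurable on the line but bounded only on \<open>I\<close>: polynomials and indicators
  then belong to the same class.\<close>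

definition bdd_borel :: "real set \<Rightarrow> (real \<Rightarrow> complex) \<Rightarrow> bool" where
  "bdd_borel I f \<longleftrightarrow> f \<in> borel_measurable borel \<and> bounded (f ` I)"

lemma bdd_borel_iff: "bdd_borel I f \<longleftrightarrow> f \<in> borel_measurable borel \<and> (\<exists>B. \<forall>x\<in>I. cmod (f x) \<le> B)"
  by (auto simp: bdd_borel_def bounded_iff)

lemma bdd_borelD: "bdd_borel I f \<Longrightarrow> f \<in> borel_measurable borel"
  by (simp add: bdd_borel_def)

lemma bdd_borel_cmod:
  assumes "bdd_borel I f" obtains B where "B \<ge> 0" "\<And>x. x \<in> I \<Longrightarrow> cmod (f x) \<le> B"
proof -
  obtain B where "\<And>x. x \<in> I \<Longrightarrow> cmod (f x) \<le> B" using assms by (auto simp: bdd_borel_iff)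
  then show ?thesis using that[of "max B 0"] by (simp add: max.coboundedI1)
qed

lemma bdd_borelI: "f \<in> borel_measurable borel \<Longrightarrow> (\<And>x. x \<in> I \<Longrightarrow> cmod (f x) \<le> B) \<Longrightarrow> bdd_borel I f"
  by (auto simp: bdd_borel_iff)

lemma bdd_borel_add: "bdd_borel I f \<Longrightarrow> bdd_borel I g \<Longrightarrow> bdd_borel I (\<lambda>x. f x + g x)"
  by (auto simp: bdd_borel_iff intro!: norm_triangle_le add_mono) (meson add_mono norm_triangle_le)

lemma bdd_borel_mult: "bdd_borel I f \<Longrightarrow> bdd_borel I g \<Longrightarrow> bdd_borel I (\<lambda>x. f x * g x)"
  unfolding bdd_borel_iff norm_mult
  by (intro conjI borel_measurable_times; clarsimp) (meson mult_mono norm_ge_zero order_trans)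

lemma bdd_borel_const [simp]: "bdd_borel I (\<lambda>_. c)"
  by (rule bdd_borelI[of _ _ "cmod c"]) auto

lemma bdd_borel_of_real_comp:
  assumes "continuous_on UNIV g" "compact I"
  shows "bdd_borel I (\<lambda>x. complex_of_real (g x))"
proof -
  have "bounded ((\<lambda>x. complex_of_real (g x)) ` I)"
    using assms
    by (intro compact_imp_bounded compact_continuous_image continuous_intros)
      (auto intro: continuous_on_subset)
  then show ?thesis
    using assms by (auto simp: bdd_borel_def intro!: borel_measurable_continuous_onI continuous_intros)
qed

lemma bdd_borel_power: "compact I \<Longrightarrow> bdd_borel I (\<lambda>x. complex_of_real x ^ k)"
  using bdd_borel_of_real_comp[of "\<lambda>x. x ^ k" I] by (simp add: continuous_on_power)

lemma bdd_borel_indicator: "A \<in> sets borel \<Longrightarrow> bdd_borel I (indicator A)"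
  by (rule bdd_borelI[of _ _ 1]) (auto simp: indicator_def)

lemma bdd_borel_sum: "(\<And>k. k \<in> K \<Longrightarrow> bdd_borel I (f k)) \<Longrightarrow> bdd_borel I (\<lambda>x. \<Sum>k\<in>K. f k x)"
  by (induction K rule: infinite_finite_induct) (auto intro: bdd_borel_add)

text \<open>A functional monotone class. Since \<open>lim\<close> asks for boundedness and
  convergence only on \<open>I\<close>, values outside \<open>I\<close> cannot influence
  membership.\<close>

locale bdd_borel_class =
  fixes I :: "real set" and P :: "(real \<Rightarrow> complex) \<Rightarrow> bool"
  assumes compact: "compact I"
    and add: "\<And>f g. bdd_borel I f \<Longrightarrow> bdd_borel I g \<Longrightarrow> P f \<Longrightarrow> P g \<Longrightarrow> P (\<lambda>x. f x + g x)"
    and scale: "\<And>c f. bdd_borel I f \<Longrightarrow> P f \<Longrightarrow> P (\<lambda>x. c * f x)"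
    and lim: "\<And>F f B. (\<And>n. F n \<in> borel_measurable borel) \<Longrightarrow> f \<in> borel_measurable borel \<Longrightarrow>
      (\<And>n x. x \<in> I \<Longrightarrow> cmod (F n x) \<le> B) \<Longrightarrow> (\<And>x. x \<in> I \<Longrightarrow> (\<lambda>n. F n x) \<longlonglongrightarrow> f x) \<Longrightarrow>
      (\<And>n. P (F n)) \<Longrightarrow> P f"
begin

text \<open>A constant sequence converges on \<open>I\<close> to every Borel function that agrees
  with it there.\<close>

lemma cong:
  assumes "bdd_borel I f" "g \<in> borel_measurable borel" "\<And>x. x \<in> I \<Longrightarrow> f x = g x" "P f"
  shows "P g"
proof -
  obtain B where "\<And>x. x \<in> I \<Longrightarrow> cmod (f x) \<le> B" using bdd_borel_cmod[OF assms(1)] by metis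
  then show ?thesis
    using assms by (intro lim[where F="\<lambda>_. f" and f=g and B=B]) (auto dest: bdd_borelD)
qed

lemma sum:
  assumes "\<And>k. k \<in> K \<Longrightarrow> bdd_borel I (f k)" "\<And>k. k \<in> K \<Longrightarrow> P (f k)" "P (\<lambda>_. 0)"
  shows "P (\<lambda>x. \<Sum>k\<in>K. f k x)"
  using assms
  by (induction K rule: infinite_finite_induct) (auto intro!: add bdd_borel_sum)

text \<open>Measure-theoretic induction for bounded nonnegative functions; a constant shift reaches
  bounded real functions, real and imaginary parts the complex ones.\<close>

lemma of_indicators:
  assumes ind: "\<And>A. A \<in> sets borel \<Longrightarrow> P (indicator A)" and f: "bdd_borel I f"
  shows "P f"
proof -
  have real_nonneg: "bounded (range u) \<Longrightarrow> P (\<lambda>x. complex_of_real (u x))"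
    if "u \<in> borel_measurable borel" "\<And>x. 0 \<le> u x" for u :: "real \<Rightarrow> real"
    using that
  proof (induction rule: borel_measurable_induct_real)
    case (set A)
    have "(\<lambda>x. complex_of_real (indicator A x)) = indicator A" by (auto simp: indicator_def)
    then show ?case using ind set by simp
  next
    case (mult u c)
    show ?case
    \<comment> \<open>Boundedness belongs to the induction claim and must be passed to
      \<open>u\<close>; for \<open>c = 0\<close> the product says nothing about
      \<open>u\<close>.\<close>
    proof (cases "c = 0")
      case True
      moreover have "(\<lambda>_. 0) = (indicator {} :: real \<Rightarrow> complex)" by auto
      ultimately show ?thesis using ind[of "{}"] by simp
    next
      case False
      obtain B where B: "\<And>x. \<bar>c * u x\<bar> \<le> B" using mult.prems by (auto simp: bounded_iff)
      have "\<bar>u x\<bar> \<le> B / c" for x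
        using B[of x] False mult.hyps by (simp add: abs_mult field_simps)
      then have bu: "bounded (range u)" by (auto simp: bounded_iff)
      have "bdd_borel I (\<lambda>x. complex_of_real (u x))"
        by (rule bdd_borelI[of _ _ "B/c"]) (use mult \<open>\<And>x. \<bar>u x\<bar> \<le> B / c\<close> in auto)
      from scale[OF this mult.IH[OF bu], of "of_real c"] show ?thesis by simp
    qed
  next
    case (add u v)
    obtain B where B: "\<And>x. \<bar>v x + u x\<bar> \<le> B" using add.prems by (auto simp: bounded_iff)
    have le: "\<bar>u x\<bar> \<le> B" "\<bar>v x\<bar> \<le> B" for x
      using B[of x] add.hyps(2,4)[of x] by auto
    have "bounded (range u)" "bounded (range v)"
      using le by (auto simp: bounded_iff)
    moreover have "bdd_borel I (\<lambda>x. complex_of_real (u x))" "bdd_borel I (\<lambda>x. complex_of_real (v x))"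
      by (rule bdd_borelI[of _ _ B]; use add le in auto)+
    ultimately show ?case
      using bdd_borel_class.add[OF bdd_borel_class_axioms, of "\<lambda>x. complex_of_real (v x)" "\<lambda>x. complex_of_real (u x)"]
        add.IH by simp
  next
    case (seq U)
    obtain B where B: "\<And>x. \<bar>u x\<bar> \<le> B" using seq.prems by (auto simp: bounded_iff)
    have "U i x \<le> u x" for i x
      using incseq_le[of "\<lambda>i. U i x" "u x" i] seq.hyps(3,4) by (auto simp: incseq_def le_fun_def)
    then have U: "\<bar>U i x\<bar> \<le> B" for i x
      using B[of x] seq.hyps(2)[of i x] order_trans by fastforce
    show ?case
    proof (rule lim[where F="\<lambda>i x. complex_of_real (U i x)" and B=B])
      show "P (\<lambda>x. complex_of_real (U n x))" for n
        using seq.IH[of n] U by (auto simp: bounded_iff)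
    qed (use seq U that(1) in \<open>auto intro: tendsto_of_real\<close>)
  qed
  \<comment> \<open>Adding the bound \<open>B\<close> makes the function nonnegative; the constant
    is removed as a multiple of the indicator of the line.\<close>
  have real: "P (\<lambda>x. complex_of_real (u x))"
    if [measurable]: "u \<in> borel_measurable borel" and B: "\<And>x. \<bar>u x\<bar> \<le> B" for u B
  proof -
    have "P (\<lambda>x. complex_of_real (u x + B))"
    proof (rule real_nonneg)
      show "0 \<le> u x + B" for x using B[of x] by linarith
      have "\<bar>u x + B\<bar> \<le> 2 * B" for x using B[of x] by linarith
      then show "bounded (range (\<lambda>x. u x + B))" by (auto simp: bounded_iff)
    qed simp
    moreover have "P (\<lambda>x. - of_real B * indicator UNIV x)"
      by (rule scale[OF bdd_borel_indicator ind]) auto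
    moreover have "bdd_borel I (\<lambda>x. complex_of_real (u x + B))"
    proof (rule bdd_borelI[of _ _ "2 * B"])
      show "cmod (complex_of_real (u x + B)) \<le> 2 * B" for x
        using B[of x] unfolding norm_of_real by linarith
    qed simp
    ultimately show ?thesis
      using add[of "\<lambda>x. complex_of_real (u x + B)" "\<lambda>x. - of_real B * indicator UNIV x"] by simp
  qed
  have [measurable]: "I \<in> sets borel" using compact by (simp add: compact_imp_closed)
  have [measurable]: "f \<in> borel_measurable borel" using f by (rule bdd_borelD)
  obtain B where B: "B \<ge> 0" "\<And>x. x \<in> I \<Longrightarrow> cmod (f x) \<le> B" using bdd_borel_cmod[OF f] by metis
  \<comment> \<open>Cutting off outside \<open>I\<close> turns the bound on \<open>I\<close> into a
    global one, as \<open>real\<close> demands.\<close>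
  define g where "g x = (if x \<in> I then f x else 0)" for x
  have [measurable]: "g \<in> borel_measurable borel" unfolding g_def by measurable
  have g: "cmod (g x) \<le> B" for x using B by (auto simp: g_def)
  have "P (\<lambda>x. of_real (Re (g x)))" "P (\<lambda>x. of_real (Im (g x)))"
    using abs_Re_le_cmod[of "g _"] abs_Im_le_cmod[of "g _"] g order_trans
    by (intro real[of _ B]; measurable; blast)+
  moreover have bb: "bdd_borel I (\<lambda>x. of_real (Re (g x)))" "bdd_borel I (\<lambda>x. of_real (Im (g x)))"
    by (rule bdd_borelI[of _ _ B];
      use abs_Re_le_cmod[of "g _"] abs_Im_le_cmod[of "g _"] g order_trans in \<open>simp; blast\<close>)+
  ultimately have "P (\<lambda>x. of_real (Re (g x)) + \<i> * of_real (Im (g x)))"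
    by (intro add scale bdd_borel_mult bdd_borel_const)
  then have "P g" by (simp add: complex_eq[symmetric])
  then show ?thesis
    by (rule cong[rotated -1]) (auto simp: g_def intro!: bdd_borelI[of g I B] g)
qed

text \<open>Powers yield polynomials, Weierstrass approximation on \<open>I\<close> yields
  continuous functions, ramps yield half-lines, and half-lines form an intersection-stable generator
  of the Borel sets.\<close>

lemma of_powers:
  assumes pow: "\<And>k. P (\<lambda>x. of_real x ^ k)" and f: "bdd_borel I f"
  shows "P f"
proof -
  have zero: "P (\<lambda>_. 0)"
    using scale[OF bdd_borel_power pow, of 0] compact by simp
  have poly: "P (\<lambda>x. of_real (p x)) \<and> bdd_borel I (\<lambda>x. complex_of_real (p x))"
    if rp: "real_polynomial_function p" for p :: "real \<Rightarrow> real"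
  proof -
    obtain a n where p: "p = (\<lambda>x. \<Sum>i\<le>n. a i * x ^ i)"
      using real_polynomial_function_iff_sum[THEN iffD1, OF rp] by blast
    have "P (\<lambda>x. \<Sum>i\<le>n. of_real (a i) * of_real x ^ i)"
      by (intro sum bdd_borel_mult bdd_borel_const bdd_borel_power compact scale pow zero)
    moreover have "bdd_borel I (\<lambda>x. \<Sum>i\<le>n. of_real (a i) * of_real x ^ i)"
      by (intro bdd_borel_sum bdd_borel_mult bdd_borel_const bdd_borel_power compact)
    ultimately show ?thesis by (simp add: p)
  qed
  have cont: "P (\<lambda>x. of_real (g x))" if g: "continuous_on UNIV g" for g :: "real \<Rightarrow> real"
  proof -
    have "\<exists>p. real_polynomial_function p \<and> (\<forall>x\<in>I. \<bar>g x - p x\<bar> < 1 / real (Suc n))" for n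
      using Stone_Weierstrass_real_polynomial_function[OF compact, of g "1 / real (Suc n)"]
        continuous_on_subset[OF g] by (metis of_nat_0_less_iff subset_UNIV zero_less_Suc zero_less_divide_1_iff)
    then obtain p where p: "\<And>n. real_polynomial_function (p n)"
      "\<And>n x. x \<in> I \<Longrightarrow> \<bar>g x - p n x\<bar> < 1 / real (Suc n)" by metis
    obtain B where B: "\<And>x. x \<in> I \<Longrightarrow> cmod (of_real (g x)) \<le> B"
      using bdd_borel_cmod[OF bdd_borel_of_real_comp[OF g compact]] by metis
    show ?thesis
    proof (rule lim[where F="\<lambda>n x. of_real (p n x)" and B="B + 1"])
      show "P (\<lambda>x. of_real (p n x))" "(\<lambda>x. complex_of_real (p n x)) \<in> borel_measurable borel" for n
        using poly[OF p(1)[of n]] by (auto dest: bdd_borelD)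
      show "(\<lambda>x. complex_of_real (g x)) \<in> borel_measurable borel"
        using bdd_borel_of_real_comp[OF g compact] by (rule bdd_borelD)
      fix x assume x: "x \<in> I"
      show "cmod (of_real (p n x)) \<le> B + 1" for n
      proof -
        have "1 / real (Suc n) \<le> 1" by simp
        then show ?thesis using p(2)[OF x, of n] B[OF x] unfolding norm_of_real by linarith
      qed
      have "(\<lambda>n. p n x) \<longlonglongrightarrow> g x"
      proof (rule LIM_zero_cancel, rule Lim_null_comparison)
        show "\<forall>\<^sub>F n in sequentially. norm (p n x - g x) \<le> 1 / real (Suc n)"
          using p(2)[OF x] by (auto simp: abs_minus_commute intro!: always_eventually less_imp_le)
        show "(\<lambda>n. 1 / real (Suc n)) \<longlonglongrightarrow> 0" using LIMSEQ_inverse_real_of_nat by (simp add: inverse_eq_divide)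
      qed
      then show "(\<lambda>n. complex_of_real (p n x)) \<longlonglongrightarrow> of_real (g x)" by (rule tendsto_of_real)
    qed
  qed
  have atMost: "P (indicator {..t})" for t
  proof -
    \<comment> \<open>The ramp equals 1 up to \<open>t\<close> and, for positive \<open>n\<close>,
      falls linearly to 0 on an interval of length 1/n.\<close>
    define r where "r n x = max 0 (min 1 (1 - real n * (x - t)))" for n x
    have r_cont: "continuous_on UNIV (r n)" for n unfolding r_def by (intro continuous_intros)
    show ?thesis
    proof (rule lim[where F="\<lambda>n x. of_real (r n x)" and B=1])
      show "P (\<lambda>x. complex_of_real (r n x))" for n by (rule cont[OF r_cont])
      show "(\<lambda>x. complex_of_real (r n x)) \<in> borel_measurable borel" for n
        using bdd_borel_of_real_comp[OF r_cont compact] by (rule bdd_borelD)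
      show "cmod (complex_of_real (r n x)) \<le> 1" for n x unfolding norm_of_real by (auto simp: r_def)
      show "(\<lambda>n. complex_of_real (r n x)) \<longlonglongrightarrow> indicator {..t} x" for x
      proof (cases "x \<le> t")
        case True
        then have "real n * (x - t) \<le> 0" for n by (simp add: mult_nonneg_nonpos)
        then have "r n x = 1" for n by (simp add: r_def)
        then show ?thesis using True by simp
      next
        case False
        obtain N :: nat where N: "1 < real N * (x - t)"
          using reals_Archimedean3[of "x - t"] False by (auto simp: not_le)
        have "\<forall>\<^sub>F n in sequentially. complex_of_real (r n x) = indicator {..t} x"
          using eventually_ge_at_top[of N]
        proof eventually_elim
          case (elim n)
          have "real N * (x - t) \<le> real n * (x - t)" using elim False by (intro mult_right_mono) auto
          then have "1 - real n * (x - t) \<le> 0" using N by linarith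
          then show ?case using False by (simp add: r_def max_absorb1)
        qed
        then show ?thesis by (rule tendsto_eventually)
      qed
    qed auto
  qed
  have ind: "P (indicator A)" if "A \<in> sets borel" for A
  proof -
    have s: "sets borel = sigma_sets UNIV (range (\<lambda>a. {..a::real}))"
      by (subst borel_eq_atMost) simp
    have "Int_stable (range (\<lambda>a. {..a::real}))"
      by (auto simp: Int_stable_def min_def)
    moreover have "range (\<lambda>a. {..a::real}) \<subseteq> Pow UNIV" by simp
    moreover have "A \<in> sigma_sets UNIV (range (\<lambda>a. {..a::real}))" using that s by simp
    ultimately show ?thesis
    proof (induction rule: sigma_sets_induct_disjoint)
      case (basic A)
      then show ?case using atMost by auto
    next
      case empty
      then show ?case using zero by simp
    next
      case (compl A)
      \<comment> \<open>The constant 1 is available as the power with exponent 0.\<close>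
      have "P (\<lambda>x. of_real x ^ 0 + - 1 * indicator A x)"
        using compl s pow[of 0]
        by (intro add scale bdd_borel_mult bdd_borel_const bdd_borel_indicator bdd_borel_power compact) auto
      moreover have "(\<lambda>x. of_real x ^ 0 + - 1 * indicator A x :: complex) = indicator (UNIV - A)"
        by (auto simp: indicator_def)
      ultimately show ?case by simp
    next
      case (union A)
      have A: "A i \<in> sets borel" for i using union s by auto
      have disj: "indicator (\<Union>i<n. A i) x = (\<Sum>i<n. indicator (A i) x :: complex)" for n x
        using union(1) by (intro indicator_UN_disjoint) (auto simp: disjoint_family_on_def)
      show ?case
      proof (rule lim[where F="\<lambda>n. indicator (\<Union>i<n. A i)" and B=1])
        show "P (indicator (\<Union>i<n. A i))" for n
          unfolding disj using union A zero by (intro sum bdd_borel_indicator) auto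
        show "(\<lambda>n. indicator (\<Union>i<n. A i) x :: complex) \<longlonglongrightarrow> indicator (\<Union>i. A i) x" for x
          by (rule LIMSEQ_indicator_UN)
      qed (use A in \<open>auto simp: indicator_def\<close>)
    qed
  qed
  show ?thesis by (rule of_indicators[OF ind f])
qed

end

section \<open>Polarization and measure families\<close>

text \<open>The signs of the imaginary terms fit a form that is antilinear in its first argument.
  \<open>q\<close> is arbitrary here: the families of integrals polarized below are not yet known to
  be quadratic.\<close>

definition polar :: "(('v \<Rightarrow> complex) \<Rightarrow> complex) \<Rightarrow> ('v \<Rightarrow> complex) \<Rightarrow> ('v \<Rightarrow> complex) \<Rightarrow> complex" where
  "polar q \<phi> \<psi> = (q (\<lambda>x. \<phi> x + \<psi> x) - q (\<lambda>x. \<phi> x - \<psi> x)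
     - \<i> * q (\<lambda>x. \<phi> x + \<i> * \<psi> x) + \<i> * q (\<lambda>x. \<phi> x - \<i> * \<psi> x)) / 4"

lemma polar_cong:
  assumes "\<phi> \<in> ell2" "\<psi> \<in> ell2" "\<And>\<zeta>. \<zeta> \<in> ell2 \<Longrightarrow> q \<zeta> = q' \<zeta>"
  shows "polar q \<phi> \<psi> = polar q' \<phi> \<psi>"
  unfolding polar_def using assms by (simp add: ell2_closed)

lemma polar_ip:
  assumes A: "bounded_operator A" and "\<phi> \<in> ell2" "\<psi> \<in> ell2"
  shows "polar (\<lambda>\<zeta>. ip \<zeta> (A \<zeta>)) \<phi> \<psi> = ip \<phi> (A \<psi>)"
proof -
  note [simp] = assms(2,3) bounded_operatorD[OF A]
  have diff: "A (\<lambda>x. \<eta> x - \<zeta> x) = (\<lambda>x. A \<eta> x - A \<zeta> x)" if "\<eta> \<in> ell2" "\<zeta> \<in> ell2" for \<eta> \<zeta>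
    using bounded_operatorD(2)[OF A that(1) ell2_uminus[OF that(2)]] bounded_operatorD(3)[OF A that(2), of "-1"]
    by simp
  show ?thesis
    unfolding polar_def
    by (simp add: diff ell2_closed ip_add_left ip_add_right ip_diff_left ip_diff_right
        ip_scale_left ip_scale_right field_simps)
qed

lemma nsq_parallelogram:
  assumes "\<phi> \<in> ell2" "\<psi> \<in> ell2"
  shows "nsq (\<lambda>x. \<phi> x + \<psi> x) + nsq (\<lambda>x. \<phi> x - \<psi> x) = 2 * nsq \<phi> + 2 * nsq \<psi>"
proof -
  have "complex_of_real (nsq (\<lambda>x. \<phi> x + \<psi> x) + nsq (\<lambda>x. \<phi> x - \<psi> x)) = of_real (2 * nsq \<phi> + 2 * nsq \<psi>)"
    using assms
    by (simp add: ip_self[symmetric] ell2_closed ip_add_left ip_add_right ip_diff_left ip_diff_right)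
  then show ?thesis by (simp only: of_real_eq_iff)
qed

text \<open>The four vectors form two parallelograms, so their squared norms add up to four times
  the right-hand norm sum, cancelling the denominator.\<close>

lemma polar_bound:
  assumes "\<phi> \<in> ell2" "\<psi> \<in> ell2" and q: "\<And>\<zeta>. \<zeta> \<in> ell2 \<Longrightarrow> cmod (q \<zeta>) \<le> C * nsq \<zeta>"
  shows "cmod (polar q \<phi> \<psi>) \<le> C * (nsq \<phi> + nsq \<psi>)"
proof -
  have i: "(\<lambda>x. \<i> * \<psi> x) \<in> ell2" "nsq (\<lambda>x. \<i> * \<psi> x) = nsq \<psi>"
    using assms by (simp_all add: ell2_scale nsq_scale)
  have "cmod (polar q \<phi> \<psi>) * 4 \<le> cmod (q (\<lambda>x. \<phi> x + \<psi> x)) + cmod (q (\<lambda>x. \<phi> x - \<psi> x))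
      + cmod (\<i> * q (\<lambda>x. \<phi> x + \<i> * \<psi> x)) + cmod (\<i> * q (\<lambda>x. \<phi> x - \<i> * \<psi> x))"
    unfolding polar_def norm_divide
    by (simp del: norm_mult) (intro norm_triangle_le norm_triangle_le_diff add_mono order_refl; simp)
  also have "\<dots> \<le> C * nsq (\<lambda>x. \<phi> x + \<psi> x) + C * nsq (\<lambda>x. \<phi> x - \<psi> x)
      + C * nsq (\<lambda>x. \<phi> x + \<i> * \<psi> x) + C * nsq (\<lambda>x. \<phi> x - \<i> * \<psi> x)"
    unfolding norm_mult using assms i by (intro add_mono) (simp_all add: q ell2_closed)
  also have "\<dots> = C * (nsq (\<lambda>x. \<phi> x + \<psi> x) + nsq (\<lambda>x. \<phi> x - \<psi> x))
      + C * (nsq (\<lambda>x. \<phi> x + \<i> * \<psi> x) + nsq (\<lambda>x. \<phi> x - \<i> * \<psi> x))"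
    by (simp add: algebra_simps)
  also have "\<dots> = 4 * (C * (nsq \<phi> + nsq \<psi>))"
    using nsq_parallelogram[OF assms(1,2)] nsq_parallelogram[OF assms(1) i(1)] i(2)
    by (simp add: algebra_simps)
  finally show ?thesis by simp
qed

text \<open>Integration against a complex measure carried by \<open>I\<close>, in axiomatic form:
  the polarized integrals are such functionals without any complex measure being
  constructed.\<close>

locale sigma_functional =
  fixes I :: "real set" and \<Lambda> :: "(real \<Rightarrow> complex) \<Rightarrow> complex"
  assumes add: "\<And>f g. bdd_borel I f \<Longrightarrow> bdd_borel I g \<Longrightarrow> \<Lambda> (\<lambda>x. f x + g x) = \<Lambda> f + \<Lambda> g"
    and scale: "\<And>c f. bdd_borel I f \<Longrightarrow> \<Lambda> (\<lambda>x. c * f x) = c * \<Lambda> f"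
    and lim: "\<And>F f B. (\<And>n. F n \<in> borel_measurable borel) \<Longrightarrow> f \<in> borel_measurable borel \<Longrightarrow>
      (\<And>n x. x \<in> I \<Longrightarrow> cmod (F n x) \<le> B) \<Longrightarrow> (\<And>x. x \<in> I \<Longrightarrow> (\<lambda>n. F n x) \<longlonglongrightarrow> f x) \<Longrightarrow>
      (\<lambda>n. \<Lambda> (F n)) \<longlonglongrightarrow> \<Lambda> f"

lemmas sigma_functionalI = sigma_functional.intro
lemmas sigma_functionalD = sigma_functional.add sigma_functional.scale sigma_functional.lim

lemma sigma_functional_add:
  assumes "sigma_functional I \<Lambda>" "sigma_functional I \<Lambda>'"
  shows "sigma_functional I (\<lambda>f. \<Lambda> f + \<Lambda>' f)"
proof (rule sigma_functionalI)
  fix F f B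
  assume F: "\<And>n. F n \<in> borel_measurable borel" "f \<in> borel_measurable borel"
    "\<And>n x. x \<in> I \<Longrightarrow> cmod (F n x) \<le> B" "\<And>x. x \<in> I \<Longrightarrow> (\<lambda>n. F n x) \<longlonglongrightarrow> f x"
  show "(\<lambda>n. \<Lambda> (F n) + \<Lambda>' (F n)) \<longlonglongrightarrow> \<Lambda> f + \<Lambda>' f"
    by (rule tendsto_add[OF sigma_functionalD(3)[OF assms(1) F] sigma_functionalD(3)[OF assms(2) F]])
qed (simp_all add: sigma_functionalD(1,2)[OF assms(1)] sigma_functionalD(1,2)[OF assms(2)] algebra_simps)

lemma sigma_functional_cmult:
  assumes "sigma_functional I \<Lambda>"
  shows "sigma_functional I (\<lambda>f. c * \<Lambda> f)"
proof (rule sigma_functionalI)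
  fix F f B
  assume F: "\<And>n. F n \<in> borel_measurable borel" "f \<in> borel_measurable borel"
    "\<And>n x. x \<in> I \<Longrightarrow> cmod (F n x) \<le> B" "\<And>x. x \<in> I \<Longrightarrow> (\<lambda>n. F n x) \<longlonglongrightarrow> f x"
  show "(\<lambda>n. c * \<Lambda> (F n)) \<longlonglongrightarrow> c * \<Lambda> f"
    by (rule tendsto_mult_left[OF sigma_functionalD(3)[OF assms F]])
qed (simp_all add: sigma_functionalD(1,2)[OF assms] algebra_simps)

lemma sigma_functional_mult_arg:
  assumes "sigma_functional I \<Lambda>" and g: "bdd_borel I g"
  shows "sigma_functional I (\<lambda>f. \<Lambda> (\<lambda>x. f x * g x))"
proof (rule sigma_functionalI)
  fix F f B
  assume F: "\<And>n. F n \<in> borel_measurable borel" "f \<in> borel_measurable borel"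
    "\<And>n x. x \<in> I \<Longrightarrow> cmod (F n x) \<le> B" "\<And>x. x \<in> I \<Longrightarrow> (\<lambda>n. F n x) \<longlonglongrightarrow> f x"
  obtain C where C: "C \<ge> 0" "\<And>x. x \<in> I \<Longrightarrow> cmod (g x) \<le> C" using bdd_borel_cmod[OF g] by metis
  show "(\<lambda>n. \<Lambda> (\<lambda>x. F n x * g x)) \<longlonglongrightarrow> \<Lambda> (\<lambda>x. f x * g x)"
  proof (rule sigma_functionalD(3)[OF assms(1), where B="\<bar>B\<bar> * C"])
    show "cmod (F n x * g x) \<le> \<bar>B\<bar> * C" if "x \<in> I" for n x
      unfolding norm_mult using F(3)[OF that, of n] C(2)[OF that] C(1) by (intro mult_mono) auto
  qed (use F bdd_borelD[OF g] in \<open>auto intro: tendsto_mult_right\<close>)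
qed (use g in \<open>simp_all add: distrib_right mult.assoc sigma_functionalD[OF assms(1)] bdd_borel_mult\<close>)

text \<open>Conjugation inside restores the linearity that conjugation outside destroys; this
  expresses the symmetry of polarized integrals.\<close>

lemma sigma_functional_cnj:
  assumes "sigma_functional I \<Lambda>"
  shows "sigma_functional I (\<lambda>f. cnj (\<Lambda> (\<lambda>x. cnj (f x))))"
proof (rule sigma_functionalI)
  have meas: "(\<lambda>x. cnj (f x)) \<in> borel_measurable borel" if "f \<in> borel_measurable borel" for f :: "real \<Rightarrow> complex"
    using that
    by (rule measurable_compose[OF _ borel_measurable_continuous_onI[OF continuous_on_cnj[OF continuous_on_id]]])
  have bb: "bdd_borel I (\<lambda>x. cnj (f x))" if "bdd_borel I f" for f
    using that unfolding bdd_borel_iff by (auto intro: meas)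
  show "cnj (\<Lambda> (\<lambda>x. cnj (f x + g x))) = cnj (\<Lambda> (\<lambda>x. cnj (f x))) + cnj (\<Lambda> (\<lambda>x. cnj (g x)))"
    if "bdd_borel I f" "bdd_borel I g" for f g
    using that by (simp add: sigma_functionalD(1)[OF assms] bb)
  show "cnj (\<Lambda> (\<lambda>x. cnj (c * f x))) = c * cnj (\<Lambda> (\<lambda>x. cnj (f x)))"
    if "bdd_borel I f" for c f
    using that by (simp add: sigma_functionalD(2)[OF assms] bb)
  show "(\<lambda>n. cnj (\<Lambda> (\<lambda>x. cnj (F n x)))) \<longlonglongrightarrow> cnj (\<Lambda> (\<lambda>x. cnj (f x)))"
    if "\<And>n. F n \<in> borel_measurable borel" "f \<in> borel_measurable borel"
      "\<And>n x. x \<in> I \<Longrightarrow> cmod (F n x) \<le> B" "\<And>x. x \<in> I \<Longrightarrow> (\<lambda>n. F n x) \<longlonglongrightarrow> f x" for F f B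
    using that by (intro tendsto_cnj sigma_functionalD(3)[OF assms, where B=B]) (auto intro: meas)
qed

text \<open>The image measure under \<open>g\<close>, carried by any set that contains the image of
  \<open>I\<close>.\<close>

lemma sigma_functional_compose:
  assumes "sigma_functional I \<Lambda>" and g: "g \<in> borel_measurable borel" "g ` I \<subseteq> J"
  shows "sigma_functional J (\<lambda>f. \<Lambda> (\<lambda>x. f (g x)))"
proof (rule sigma_functionalI)
  have bb: "bdd_borel I (\<lambda>x. f (g x))" if "bdd_borel J f" for f
    using that g unfolding bdd_borel_iff by (auto intro: measurable_compose[OF g(1)])
  show "(\<lambda>n. \<Lambda> (\<lambda>x. F n (g x))) \<longlonglongrightarrow> \<Lambda> (\<lambda>x. f (g x))"
    if "\<And>n. F n \<in> borel_measurable borel" "f \<in> borel_measurable borel"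
      "\<And>n x. x \<in> J \<Longrightarrow> cmod (F n x) \<le> B" "\<And>x. x \<in> J \<Longrightarrow> (\<lambda>n. F n x) \<longlonglongrightarrow> f x" for F f B
    using that g by (intro sigma_functionalD(3)[OF assms(1), where B=B])
      (auto intro: measurable_compose[OF g(1)])
  show "\<Lambda> (\<lambda>x. f (g x) + h (g x)) = \<Lambda> (\<lambda>x. f (g x)) + \<Lambda> (\<lambda>x. h (g x))"
    if "bdd_borel J f" "bdd_borel J h" for f h
    using sigma_functionalD(1)[OF assms(1) bb[OF that(1)] bb[OF that(2)]] .
  show "\<Lambda> (\<lambda>x. c * f (g x)) = c * \<Lambda> (\<lambda>x. f (g x))" if "bdd_borel J f" for c f
    using sigma_functionalD(2)[OF assms(1) bb[OF that]] .
qed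

text \<open>A larger set strengthens the boundedness and convergence hypotheses; two functionals
  carried by different sets can thus be compared on a common one.\<close>

lemma sigma_functional_mono:
  assumes "sigma_functional I \<Lambda>" "I \<subseteq> J" shows "sigma_functional J \<Lambda>"
  using sigma_functional_compose[OF assms(1), of "\<lambda>x. x" J] assms(2) by simp

lemma sigma_functional_cong:
  assumes "sigma_functional I \<Lambda>" "bdd_borel I f" "g \<in> borel_measurable borel" "\<And>x. x \<in> I \<Longrightarrow> f x = g x"
  shows "\<Lambda> f = \<Lambda> g"
proof -
  obtain B where "\<And>x. x \<in> I \<Longrightarrow> cmod (f x) \<le> B" using bdd_borel_cmod[OF assms(2)] by metis
  then have "(\<lambda>n::nat. \<Lambda> f) \<longlonglongrightarrow> \<Lambda> g"
    using assms by (intro sigma_functionalD(3)[OF assms(1), where F="\<lambda>_. f"]) (auto dest: bdd_borelD)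
  then show ?thesis by (simp add: LIMSEQ_const_iff)
qed

text \<open>The functions on which two functionals agree form a monotone class; this yields
  determination by moments, and also by values on indicators.\<close>

lemma sigma_functional_eq_class:
  assumes "compact I" "sigma_functional I \<Lambda>" "sigma_functional I \<Lambda>'"
  shows "bdd_borel_class I (\<lambda>f. \<Lambda> f = \<Lambda>' f)"
proof
  fix F f B
  assume F: "\<And>n. F n \<in> borel_measurable borel" "f \<in> borel_measurable borel"
    "\<And>n x. x \<in> I \<Longrightarrow> cmod (F n x) \<le> B" "\<And>x. x \<in> I \<Longrightarrow> (\<lambda>n. F n x) \<longlonglongrightarrow> f x"
    and eq: "\<And>n. \<Lambda> (F n) = \<Lambda>' (F n)"
  show "\<Lambda> f = \<Lambda>' f"
    using sigma_functionalD(3)[OF assms(2) F] sigma_functionalD(3)[OF assms(3) F] eq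
    by (auto intro: LIMSEQ_unique)
qed (simp_all add: assms(1) sigma_functionalD[OF assms(2)] sigma_functionalD[OF assms(3)])

lemmas sigma_functional_eq_powers = bdd_borel_class.of_powers[OF sigma_functional_eq_class]
lemmas sigma_functional_eq_indicators = bdd_borel_class.of_indicators[OF sigma_functional_eq_class]

text \<open>Covers two families: the measures obtained from moments, and the scalar measures of an
  arbitrary projection-valued measure, to be compared with the first.\<close>

locale measure_family =
  fixes m :: "('v \<Rightarrow> complex) \<Rightarrow> real measure" and I :: "real set"
  assumes finite_measure: "\<psi> \<in> ell2 \<Longrightarrow> finite_measure (m \<psi>)"
    and sets_m: "\<psi> \<in> ell2 \<Longrightarrow> sets (m \<psi>) = sets borel"
    and AE_m: "\<psi> \<in> ell2 \<Longrightarrow> AE x in m \<psi>. x \<in> I"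
begin

text \<open>Candidate for the matrix element of the operator f applied between \<open>\<phi>\<close>
  and \<open>\<psi>\<close>; sesquilinearity is not built in and has to be proved.\<close>

definition J :: "(real \<Rightarrow> complex) \<Rightarrow> ('v \<Rightarrow> complex) \<Rightarrow> ('v \<Rightarrow> complex) \<Rightarrow> complex" where
  "J f = polar (\<lambda>\<psi>. \<integral>x. f x \<partial>m \<psi>)"

lemma measurable_m: "\<psi> \<in> ell2 \<Longrightarrow> f \<in> borel_measurable borel \<Longrightarrow> f \<in> borel_measurable (m \<psi>)"
  using sets_m by (simp cong: measurable_cong_sets)

lemma integrable_m:
  assumes "\<psi> \<in> ell2" "bdd_borel I f" shows "integrable (m \<psi>) f"
proof -
  interpret finite_measure "m \<psi>" using finite_measure assms(1) .
  obtain B where "\<And>x. x \<in> I \<Longrightarrow> cmod (f x) \<le> B" using bdd_borel_cmod[OF assms(2)] by metis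
  then have "AE x in m \<psi>. cmod (f x) \<le> B" using AE_m[OF assms(1)] by (auto elim: AE_mp)
  then show ?thesis
    using measurable_m[OF assms(1) bdd_borelD[OF assms(2)]] by (rule integrable_const_bound)
qed

lemma sigma_functional_integral:
  assumes "\<psi> \<in> ell2" shows "sigma_functional I (\<lambda>f. \<integral>x. f x \<partial>m \<psi>)"
proof (rule sigma_functionalI)
  fix F f B
  assume F: "\<And>n. F n \<in> borel_measurable borel" "f \<in> borel_measurable borel"
    "\<And>n x. x \<in> I \<Longrightarrow> cmod (F n x) \<le> B" "\<And>x. x \<in> I \<Longrightarrow> (\<lambda>n. F n x) \<longlonglongrightarrow> f x"
  interpret finite_measure "m \<psi>" using finite_measure assms(1) .
  show "(\<lambda>n. \<integral>x. F n x \<partial>m \<psi>) \<longlonglongrightarrow> (\<integral>x. f x \<partial>m \<psi>)"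
    by (rule integral_dominated_convergence[where w="\<lambda>_. B"])
      (use F AE_m[OF assms] in \<open>auto simp: measurable_m[OF assms] elim: AE_mp\<close>)
qed (simp_all add: integrable_m[OF assms])

lemma sigma_functional_J:
  assumes "\<phi> \<in> ell2" "\<psi> \<in> ell2" shows "sigma_functional I (\<lambda>f. J f \<phi> \<psi>)"
proof -
  have "sigma_functional I (\<lambda>f. (1/4) * (\<integral>x. f x \<partial>m (\<lambda>x. \<phi> x + \<psi> x)) +
      (-1/4) * (\<integral>x. f x \<partial>m (\<lambda>x. \<phi> x - \<psi> x)) +
      (-\<i>/4) * (\<integral>x. f x \<partial>m (\<lambda>x. \<phi> x + \<i> * \<psi> x)) + (\<i>/4) * (\<integral>x. f x \<partial>m (\<lambda>x. \<phi> x - \<i> * \<psi> x)))"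
    using assms
    by (intro sigma_functional_add sigma_functional_cmult sigma_functional_integral ell2_closed)
  then show ?thesis by (simp add: J_def polar_def diff_divide_distrib add_divide_distrib)
qed

lemma J_eq_ip:
  assumes "bounded_operator A" "\<And>\<zeta>. \<zeta> \<in> ell2 \<Longrightarrow> (\<integral>x. f x \<partial>m \<zeta>) = ip \<zeta> (A \<zeta>)"
    and "\<phi> \<in> ell2" "\<psi> \<in> ell2"
  shows "J f \<phi> \<psi> = ip \<phi> (A \<psi>)"
  unfolding J_def using assms polar_cong[OF assms(3,4,2)] by (simp add: polar_ip)

lemma J_indicator_eq_ip:
  assumes "bounded_operator A" "B \<in> sets borel"
    "\<And>\<zeta>. \<zeta> \<in> ell2 \<Longrightarrow> of_real (measure (m \<zeta>) B) = ip \<zeta> (A \<zeta>)"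
    and "\<phi> \<in> ell2" "\<psi> \<in> ell2"
  shows "J (indicator B) \<phi> \<psi> = ip \<phi> (A \<psi>)"
proof (rule J_eq_ip[OF assms(1) _ assms(4,5)])
  fix \<zeta> :: "'v \<Rightarrow> complex" assume \<zeta>: "\<zeta> \<in> ell2"
  have "(\<integral>x. indicator B x \<partial>m \<zeta>) = (\<integral>x. complex_of_real (indicator B x) \<partial>m \<zeta>)"
    by (intro Bochner_Integration.integral_cong) (auto simp: indicator_def)
  also have "\<dots> = of_real (measure (m \<zeta>) B)"
    unfolding integral_complex_of_real using sets_m[OF \<zeta>] assms(2)
    by (simp add: sets_eq_imp_space_eq[OF sets_m[OF \<zeta>]])
  finally show "(\<integral>x. indicator B x \<partial>m \<zeta>) = ip \<zeta> (A \<zeta>)" using assms(3)[OF \<zeta>] by simp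
qed

end

section \<open>Borel functional calculus of an operator between 0 and 1\<close>

lemma self_adjoint_ident: "self_adjoint (\<lambda>\<psi>. \<psi>)"
  by (simp add: self_adjoint_def bounded_operator_ident)

lemma self_adjoint_add:
  assumes "self_adjoint A" "self_adjoint B" shows "self_adjoint (\<lambda>\<psi> x. A \<psi> x + B \<psi> x)"
  using assms
  by (auto simp: self_adjoint_def bounded_operator_add bounded_operatorD(1) ip_add_left ip_add_right)

lemma self_adjoint_scale:
  assumes "self_adjoint A" shows "self_adjoint (\<lambda>\<psi> x. of_real a * A \<psi> x)"
  using assms
  by (auto simp: self_adjoint_def bounded_operator_scale ip_scale_left ip_scale_right)

lemma self_adjoint_diff:
  assumes "self_adjoint A" "self_adjoint B" shows "self_adjoint (\<lambda>\<psi> x. A \<psi> x - B \<psi> x)"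
  using assms
  by (auto simp: self_adjoint_def bounded_operator_diff bounded_operatorD(1) ip_diff_left ip_diff_right)

lemma self_adjoint_funpow:
  assumes "self_adjoint A" shows "self_adjoint (A ^^ n)"
proof (induction n)
  case 0
  then show ?case using self_adjoint_ident by (simp add: id_def)
next
  case (Suc n)
  have "ip \<phi> (A ((A ^^ n) \<psi>)) = ip (A ((A ^^ n) \<phi>)) \<psi>" if "\<phi> \<in> ell2" "\<psi> \<in> ell2" for \<phi> \<psi>
  proof -
    have "ip \<phi> (A ((A ^^ n) \<psi>)) = ip ((A ^^ n) (A \<phi>)) \<psi>"
      using Suc assms that by (simp add: self_adjoint_def bounded_operatorD(1))
    then show ?thesis by (simp add: funpow_swap1)
  qed
  then show ?case
    using bounded_operator_funpow[of A "Suc n"] assms by (simp add: self_adjoint_def comp_def)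
qed

lemma ip_self_adjoint_real:
  assumes "self_adjoint A" "\<psi> \<in> ell2" shows "ip \<psi> (A \<psi>) = of_real (Re (ip \<psi> (A \<psi>)))"
proof -
  have "cnj (ip \<psi> (A \<psi>)) = ip \<psi> (A \<psi>)"
    using assms by (simp add: cnj_ip self_adjoint_def)
  then show ?thesis by (simp add: Reals_cnj_iff of_real_Re)
qed

locale unit_operator =
  fixes K :: "'v operator"
  assumes self_adjoint: "self_adjoint K"
    and ip_nonneg: "\<psi> \<in> ell2 \<Longrightarrow> 0 \<le> Re (ip \<psi> (K \<psi>))"
    and ip_le: "\<psi> \<in> ell2 \<Longrightarrow> Re (ip \<psi> (K \<psi>)) \<le> nsq \<psi>"
begin

lemma bounded: "bounded_operator K"
  using self_adjoint by (rule self_adjointD)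

lemmas K_simps = bounded_operatorD[OF bounded]

lemma K_diff: "\<phi> \<in> ell2 \<Longrightarrow> \<psi> \<in> ell2 \<Longrightarrow> K (\<lambda>x. \<phi> x - \<psi> x) = (\<lambda>x. K \<phi> x - K \<psi> x)"
  using K_simps(2)[OF _ ell2_uminus, of \<phi> \<psi>] K_simps(3)[of \<psi> "-1"] by simp

definition K' :: "'v operator" where "K' \<psi> = (\<lambda>x. \<psi> x - K \<psi> x)"

lemma self_adjoint': "self_adjoint K'"
  unfolding K'_def[abs_def] by (rule self_adjoint_diff[OF self_adjoint_ident self_adjoint])

lemma K'_ell2 [simp]: "\<psi> \<in> ell2 \<Longrightarrow> K' \<psi> \<in> ell2"
  by (rule bounded_operatorD(1)[OF self_adjointD(1)[OF self_adjoint']])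

lemma pow_ell2 [simp]: "\<psi> \<in> ell2 \<Longrightarrow> (K ^^ i) \<psi> \<in> ell2" "\<psi> \<in> ell2 \<Longrightarrow> (K' ^^ j) \<psi> \<in> ell2"
  by (rule bounded_operatorD(1)[OF self_adjointD(1)[OF self_adjoint_funpow[OF self_adjoint]]]
      bounded_operatorD(1)[OF self_adjointD(1)[OF self_adjoint_funpow[OF self_adjoint']]]; assumption)+

lemma K_K': "\<psi> \<in> ell2 \<Longrightarrow> K (K' \<psi>) = K' (K \<psi>)"
  by (simp add: K'_def K_diff K_simps)

lemma K_K'_pow: "\<psi> \<in> ell2 \<Longrightarrow> K ((K' ^^ j) \<psi>) = (K' ^^ j) (K \<psi>)"
  by (induction j) (simp_all add: K_K')

definition a :: "('v \<Rightarrow> complex) \<Rightarrow> nat \<Rightarrow> nat \<Rightarrow> real" where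
  "a \<psi> i j = Re (ip \<psi> ((K ^^ i) ((K' ^^ j) \<psi>)))"

text \<open>This is K + (1 - K) = 1, inserted between the two powers.\<close>

lemma a_rec:
  assumes "\<psi> \<in> ell2" shows "a \<psi> i j = a \<psi> (Suc i) j + a \<psi> i (Suc j)"
proof -
  let ?\<eta> = "(K' ^^ j) \<psi>"
  have \<eta>: "?\<eta> \<in> ell2" using assms by simp
  have "(\<lambda>x. K ?\<eta> x + K' ?\<eta> x) = ?\<eta>" by (simp add: K'_def)
  moreover have "(K ^^ i) (\<lambda>x. K ?\<eta> x + K' ?\<eta> x) = (\<lambda>x. (K ^^ i) (K ?\<eta>) x + (K ^^ i) (K' ?\<eta>) x)"
    using \<eta> K_simps(1)[OF \<eta>] K'_ell2[OF \<eta>]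
    by (intro bounded_operatorD(2) bounded_operator_funpow bounded)
  ultimately have "(K ^^ i) ?\<eta> = (\<lambda>x. (K ^^ i) (K ?\<eta>) x + (K ^^ i) (K' ?\<eta>) x)"
    by simp
  then have "ip \<psi> ((K ^^ i) ?\<eta>) = ip \<psi> ((K ^^ i) (K ?\<eta>)) + ip \<psi> ((K ^^ i) (K' ?\<eta>))"
    using ip_add_right[OF assms pow_ell2(1)[OF K_simps(1)[OF \<eta>]] pow_ell2(1)[OF K'_ell2[OF \<eta>]], of i i]
    by simp
  then show ?thesis by (simp add: a_def funpow_swap1)
qed

text \<open>Of two factors \<open>K\<close>, self-adjointness moves one to the left vector, and
  commutation with \<open>K'\<close> brings the other to the right vector, so the exponent drops by
  2.\<close>

lemma a_shift_K:
  assumes "\<psi> \<in> ell2" shows "a \<psi> (Suc (Suc i)) j = a (K \<psi>) i j"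
proof -
  have "ip \<psi> (K ((K ^^ i) (K ((K' ^^ j) \<psi>)))) = ip (K \<psi>) ((K ^^ i) ((K' ^^ j) (K \<psi>)))"
    using assms self_adjointD(2)[OF self_adjoint] by (simp add: K_K'_pow K_simps)
  then show ?thesis by (simp add: a_def funpow_swap1)
qed

lemma a_shift_K':
  assumes "\<psi> \<in> ell2" shows "a \<psi> i (Suc (Suc j)) = a (K' \<psi>) i j"
proof -
  have comm: "(K ^^ i) (K' \<eta>) = K' ((K ^^ i) \<eta>)" if "\<eta> \<in> ell2" for \<eta>
    using that by (induction i) (simp_all add: K_K')
  have "ip \<psi> ((K ^^ i) (K' ((K' ^^ j) (K' \<psi>)))) = ip (K' \<psi>) ((K ^^ i) ((K' ^^ j) (K' \<psi>)))"
    using assms self_adjointD(2)[OF self_adjoint'] by (simp add: comm)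
  then show ?thesis by (simp add: a_def funpow_swap1)
qed

text \<open>Everything reduces to exponents at most 1, where \<open>K (1 - K) = K (1 - K) K + (1 - K) K (1 - K)\<close>.\<close>

lemma a_nonneg:
  assumes "\<psi> \<in> ell2" shows "0 \<le> a \<psi> i j"
  using assms
proof (induction "i + j" arbitrary: \<psi> i j rule: less_induct)
  case less
  note \<psi> = \<open>\<psi> \<in> ell2\<close>
  have a10: "0 \<le> a \<eta> 1 0" and a01: "0 \<le> a \<eta> 0 1" if "\<eta> \<in> ell2" for \<eta>
    using ip_nonneg[OF that] ip_le[OF that] that
    by (simp_all add: a_def K'_def ip_diff_right K_simps ip_self)
  consider "2 \<le> i" | "2 \<le> j" | "i = 0" "j = 0" | "i = 1" "j = 0" | "i = 0" "j = 1" | "i = 1" "j = 1"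
    by linarith
  then show ?case
  proof cases
    case 1
    then obtain i' where i: "i = Suc (Suc i')" by (metis add_2_eq_Suc le_Suc_ex)
    then show ?thesis using less.hyps[of i' j "K \<psi>"] \<psi> by (simp add: a_shift_K K_simps)
  next
    case 2
    then obtain j' where j: "j = Suc (Suc j')" by (metis add_2_eq_Suc le_Suc_ex)
    then show ?thesis using less.hyps[of i j' "K' \<psi>"] \<psi> by (simp add: a_shift_K')
  next
    case 3
    then show ?thesis using \<psi> by (simp add: a_def ip_self)
  next
    case 6
    have "a \<psi> 1 1 = a (K \<psi>) 0 1 + a (K' \<psi>) 1 0"
      using a_rec[OF \<psi>, of 1 1] a_shift_K[OF \<psi>, of 0 1] a_shift_K'[OF \<psi>, of 1 0]
      by (simp add: numeral_eq_Suc)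
    then show ?thesis using 6 a10[of "K' \<psi>"] a01[of "K \<psi>"] \<psi> K_simps by simp
  qed (use a10 a01 \<psi> in auto)
qed

definition is_mu :: "('v \<Rightarrow> complex) \<Rightarrow> real measure \<Rightarrow> bool" where
  "is_mu \<psi> N \<longleftrightarrow> finite_measure N \<and> sets N = sets borel \<and> (AE x in N. x \<in> {0..1}) \<and>
     (\<forall>k. (\<integral>x. x ^ k \<partial>N) = Re (ip \<psi> ((K ^^ k) \<psi>)))"

text \<open>Division by \<open>nsq \<psi>\<close> normalizes the zeroth moment to 1, and a constant
  density undoes it afterwards; the zero vector receives the null measure.\<close>

lemma ex_mu:
  assumes \<psi>: "\<psi> \<in> ell2" shows "\<exists>N. is_mu \<psi> N"
proof (cases "nsq \<psi> = 0")
  case True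
  then have "\<psi> = (\<lambda>_. 0)" using \<psi> nsq_eqD by blast
  moreover have "is_mu (\<lambda>_. 0) (null_measure borel)"
    unfolding is_mu_def
    by (intro conjI finite_measureI AE_I[of _ _ UNIV]) (auto simp: integral_null_measure)
  ultimately show ?thesis by auto
next
  case False
  define c where "c = nsq \<psi>"
  have c: "c > 0" using False by (simp add: c_def less_le)
  obtain M where M: "real_distribution M" "AE x in M. x \<in> {0..1}" "\<And>k. (\<integral>x. x ^ k \<partial>M) = a \<psi> k 0 / c"
  proof (rule real_distribution_of_moments[of "\<lambda>i j. a \<psi> i j / c"])
    show "a \<psi> i j / c = a \<psi> (Suc i) j / c + a \<psi> i (Suc j) / c" for i j
      using a_rec[OF \<psi>, of i j] by (simp add: add_divide_distrib)
    show "a \<psi> 0 0 / c = 1" using c \<psi> by (simp add: a_def ip_self c_def)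
  qed (use c a_nonneg[OF \<psi>] in auto)
  interpret real_distribution M by fact
  define N where "N = density M (\<lambda>_. ennreal c)"
  have "emeasure N (space N) = c"
    unfolding N_def by (simp add: emeasure_density emeasure_space_1[simplified])
  then have "finite_measure N" by (intro finite_measureI) simp
  moreover have "AE x in N. x \<in> {0..1}"
    unfolding N_def using M(2) by (subst AE_density) (auto elim: AE_mp)
  moreover have "(\<integral>x. x ^ k \<partial>N) = Re (ip \<psi> ((K ^^ k) \<psi>))" for k
    unfolding N_def using c M(3)[of k] by (simp add: integral_density a_def)
  moreover have "sets N = sets borel" by (simp add: N_def)
  ultimately have "is_mu \<psi> N" unfolding is_mu_def by blast
  then show ?thesis ..
qed

definition mu :: "('v \<Rightarrow> complex) \<Rightarrow> real measure" where
  "mu \<psi> = (SOME N. is_mu \<psi> N)"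

lemma is_mu_mu: "\<psi> \<in> ell2 \<Longrightarrow> is_mu \<psi> (mu \<psi>)"
  unfolding mu_def by (rule someI_ex[OF ex_mu])

sublocale measure_family mu "{0..1}"
proof (rule measure_family.intro)
  fix \<psi> :: "'v \<Rightarrow> complex" assume "\<psi> \<in> ell2"
  from is_mu_mu[OF this]
  show "finite_measure (mu \<psi>)" "sets (mu \<psi>) = sets borel" "AE x in mu \<psi>. x \<in> {0..1}"
    unfolding is_mu_def by blast+
qed

lemma measure_mu:
  assumes "\<psi> \<in> ell2" shows "measure (mu \<psi>) UNIV = nsq \<psi>"
proof -
  have "(\<integral>x. x ^ 0 \<partial>mu \<psi>) = Re (ip \<psi> ((K ^^ 0) \<psi>))"
    using is_mu_mu[OF assms] unfolding is_mu_def by blast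
  then show ?thesis
    using assms sets_eq_imp_space_eq[OF sets_m[OF assms]] by (simp add: ip_self)
qed

lemma integral_mu_power:
  assumes "\<psi> \<in> ell2" shows "(\<integral>x. of_real x ^ k \<partial>mu \<psi>) = ip \<psi> ((K ^^ k) \<psi>)"
proof -
  have "(\<integral>x. of_real x ^ k \<partial>mu \<psi>) = (\<integral>x. complex_of_real (x ^ k) \<partial>mu \<psi>)" by simp
  also have "\<dots> = of_real (\<integral>x. x ^ k \<partial>mu \<psi>)" by (rule integral_complex_of_real)
  also have "\<dots> = of_real (Re (ip \<psi> ((K ^^ k) \<psi>)))"
    using is_mu_mu[OF assms] by (simp add: is_mu_def)
  also have "\<dots> = ip \<psi> ((K ^^ k) \<psi>)"
    using ip_self_adjoint_real[OF self_adjoint_funpow[OF self_adjoint] assms] by simp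
  finally show ?thesis .
qed

lemma J_power: "\<phi> \<in> ell2 \<Longrightarrow> \<psi> \<in> ell2 \<Longrightarrow> J (\<lambda>x. of_real x ^ k) \<phi> \<psi> = ip \<phi> ((K ^^ k) \<psi>)"
  by (rule J_eq_ip[OF bounded_operator_funpow[OF bounded]]) (simp_all add: integral_mu_power)

text \<open>Moments determine a functional on the unit interval; the algebraic laws of the calculus
  reduce through this to laws for powers of \<open>K\<close>.\<close>

lemma J_eqI:
  assumes "sigma_functional {0..1} \<Lambda>" "sigma_functional {0..1} \<Lambda>'"
    and "\<And>k. \<Lambda> (\<lambda>x. of_real x ^ k) = \<Lambda>' (\<lambda>x. of_real x ^ k)" "bdd_borel {0..1} f"
  shows "\<Lambda> f = \<Lambda>' f"
  by (rule sigma_functional_eq_powers[OF compact_Icc assms(1-4)])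

text \<open>The operator f(K), given by its coordinates.\<close>

definition \<Phi> :: "(real \<Rightarrow> complex) \<Rightarrow> 'v operator" where
  "\<Phi> f \<psi> = (\<lambda>x. J f (ket x) \<psi>)"

text \<open>The measures \<open>mu\<close> are chosen separately for each vector, so additivity and
  homogeneity of \<open>J f\<close> are not visible from its construction. For powers they hold
  because \<open>J\<close> is then an inner product with a power of \<open>K\<close>, and they
  extend to \<open>f\<close>. The norm bound uses that \<open>mu \<zeta>\<close> has total mass
  \<open>nsq \<zeta>\<close>.\<close>

lemma
  assumes f: "bdd_borel {0..1} f"
  shows bounded_operator_\<Phi>: "bounded_operator (\<Phi> f)"
    and ip_\<Phi>: "\<And>\<phi> \<psi>. \<phi> \<in> ell2 \<Longrightarrow> \<psi> \<in> ell2 \<Longrightarrow> ip \<phi> (\<Phi> f \<psi>) = J f \<phi> \<psi>"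
proof -
  note [simp] = ell2_closed sigma_functional_J J_power
  have add_left: "J f (\<lambda>x. \<phi> x + \<psi> x) \<zeta> = J f \<phi> \<zeta> + J f \<psi> \<zeta>"
    if "\<phi> \<in> ell2" "\<psi> \<in> ell2" "\<zeta> \<in> ell2" for \<phi> \<psi> \<zeta>
    by (rule J_eqI[OF _ _ _ f]) (use that in \<open>auto intro!: sigma_functional_add simp: ip_add_left\<close>)
  have add_right: "J f \<phi> (\<lambda>x. \<psi> x + \<zeta> x) = J f \<phi> \<psi> + J f \<phi> \<zeta>"
    if "\<phi> \<in> ell2" "\<psi> \<in> ell2" "\<zeta> \<in> ell2" for \<phi> \<psi> \<zeta>
    by (rule J_eqI[OF _ _ _ f])
      (use that in \<open>auto intro!: sigma_functional_add
        simp: ip_add_right bounded_operatorD(2)[OF bounded_operator_funpow[OF bounded]]\<close>)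
  have scale_left: "J f (\<lambda>x. c * \<phi> x) \<psi> = cnj c * J f \<phi> \<psi>"
    if "\<phi> \<in> ell2" "\<psi> \<in> ell2" for c \<phi> \<psi>
    by (rule J_eqI[OF _ _ _ f]) (use that in \<open>auto intro!: sigma_functional_cmult simp: ip_scale_left\<close>)
  have scale_right: "J f \<phi> (\<lambda>x. c * \<psi> x) = c * J f \<phi> \<psi>"
    if "\<phi> \<in> ell2" "\<psi> \<in> ell2" for c \<phi> \<psi>
    by (rule J_eqI[OF _ _ _ f])
      (use that in \<open>auto intro!: sigma_functional_cmult
        simp: ip_scale_right bounded_operatorD(3)[OF bounded_operator_funpow[OF bounded]]\<close>)
  obtain B where B: "B \<ge> 0" "\<And>x. x \<in> {0..1} \<Longrightarrow> cmod (f x) \<le> B" using bdd_borel_cmod[OF f] by metis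
  have bound: "cmod (J f \<phi> \<psi>) \<le> B * (nsq \<phi> + nsq \<psi>)" if "\<phi> \<in> ell2" "\<psi> \<in> ell2" for \<phi> \<psi>
    unfolding J_def
  proof (rule polar_bound[OF that])
    fix \<zeta> :: "'v \<Rightarrow> complex" assume \<zeta>: "\<zeta> \<in> ell2"
    interpret finite_measure "mu \<zeta>" using finite_measure[OF \<zeta>] .
    have sp: "space (mu \<zeta>) = UNIV" using sets_eq_imp_space_eq[OF sets_m[OF \<zeta>]] by simp
    have "cmod (\<integral>x. f x \<partial>mu \<zeta>) \<le> (\<integral>x. cmod (f x) \<partial>mu \<zeta>)" by (rule integral_norm_bound)
    also have "\<dots> \<le> (\<integral>x. B \<partial>mu \<zeta>)"
      by (rule integral_mono_AE) (use integrable_m[OF \<zeta> f] AE_m[OF \<zeta>] B in \<open>auto elim: AE_mp\<close>)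
    also have "\<dots> = B * nsq \<zeta>" using measure_mu[OF \<zeta>] sp by (simp add: mult.commute)
    finally show "cmod (\<integral>x. f x \<partial>mu \<zeta>) \<le> B * nsq \<zeta>" .
  qed
  show "bounded_operator (\<Phi> f)"
    unfolding \<Phi>_def[abs_def] by (rule sesquilinear_operator(1)[OF add_left add_right scale_left scale_right bound])
  show "\<And>\<phi> \<psi>. \<phi> \<in> ell2 \<Longrightarrow> \<psi> \<in> ell2 \<Longrightarrow> ip \<phi> (\<Phi> f \<psi>) = J f \<phi> \<psi>"
    unfolding \<Phi>_def[abs_def] by (rule sesquilinear_operator(2)[OF add_left add_right scale_left scale_right bound])
qed

lemma \<Phi>_ell2 [simp]: "bdd_borel {0..1} f \<Longrightarrow> \<psi> \<in> ell2 \<Longrightarrow> \<Phi> f \<psi> \<in> ell2"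
  by (rule bounded_operatorD(1)[OF bounded_operator_\<Phi>])

text \<open>Two extensions in succession: with one factor a power, the identity is extended to all
  \<open>g\<close>; with this \<open>g\<close> fixed, the power is then replaced by
  \<open>f\<close>.\<close>

lemma \<Phi>_mult:
  assumes f: "bdd_borel {0..1} f" and g: "bdd_borel {0..1} g" and \<psi>: "\<psi> \<in> ell2"
  shows "\<Phi> (\<lambda>x. f x * g x) \<psi> = \<Phi> f (\<Phi> g \<psi>)"
proof (rule ell2_eqI)
  fix \<phi> :: "'v \<Rightarrow> complex" assume \<phi>: "\<phi> \<in> ell2"
  have sa: "ip \<eta> ((K ^^ k) \<zeta>) = ip ((K ^^ k) \<eta>) \<zeta>" if "\<eta> \<in> ell2" "\<zeta> \<in> ell2" for \<eta> \<zeta> k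
    using self_adjointD(2)[OF self_adjoint_funpow[OF self_adjoint] that] .
  \<comment> \<open>The power is absorbed into the left vector, using self-adjointness of the powers
    of \<open>K\<close>.\<close>
  have 1: "J (\<lambda>x. g x * of_real x ^ k) \<phi> \<psi> = J g ((K ^^ k) \<phi>) \<psi>" for k
  proof (rule J_eqI[OF _ _ _ g])
    show "sigma_functional {0..1} (\<lambda>f. J (\<lambda>x. f x * of_real x ^ k) \<phi> \<psi>)"
      using \<phi> \<psi> by (intro sigma_functional_mult_arg sigma_functional_J bdd_borel_power) auto
    show "sigma_functional {0..1} (\<lambda>f. J f ((K ^^ k) \<phi>) \<psi>)"
      using \<phi> \<psi> by (intro sigma_functional_J) auto
    fix j
    have "J (\<lambda>x. of_real x ^ j * of_real x ^ k) \<phi> \<psi> = ip \<phi> ((K ^^ (k + j)) \<psi>)"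
      using J_power[OF \<phi> \<psi>, of "k + j"] by (simp add: power_add mult.commute)
    also have "\<dots> = ip ((K ^^ k) \<phi>) ((K ^^ j) \<psi>)"
      using \<phi> \<psi> by (simp add: funpow_add sa)
    finally show "J (\<lambda>x. of_real x ^ j * of_real x ^ k) \<phi> \<psi> = J (\<lambda>x. of_real x ^ j) ((K ^^ k) \<phi>) \<psi>"
      using \<phi> \<psi> by (simp add: J_power)
  qed
  have "J (\<lambda>x. f x * g x) \<phi> \<psi> = J f \<phi> (\<Phi> g \<psi>)"
  proof (rule J_eqI[OF _ _ _ f])
    show "sigma_functional {0..1} (\<lambda>f. J (\<lambda>x. f x * g x) \<phi> \<psi>)"
      using \<phi> \<psi> g by (intro sigma_functional_mult_arg sigma_functional_J) auto
    show "sigma_functional {0..1} (\<lambda>f. J f \<phi> (\<Phi> g \<psi>))"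
      using \<phi> \<psi> g by (intro sigma_functional_J) auto
    show "J (\<lambda>x. of_real x ^ k * g x) \<phi> \<psi> = J (\<lambda>x. of_real x ^ k) \<phi> (\<Phi> g \<psi>)" for k
      using 1[of k] \<phi> \<psi> g by (simp add: mult.commute J_power sa ip_\<Phi>)
  qed
  then show "ip \<phi> (\<Phi> (\<lambda>x. f x * g x) \<psi>) = ip \<phi> (\<Phi> f (\<Phi> g \<psi>))"
    using f g \<phi> \<psi> by (simp add: ip_\<Phi> bdd_borel_mult)
qed

text \<open>The form and its conjugate transpose agree on powers, which are real; reality of
  \<open>f\<close> then removes the inner conjugation.\<close>

lemma self_adjoint_\<Phi>:
  assumes f: "bdd_borel {0..1} f" and real: "\<And>x. cnj (f x) = f x"
  shows "self_adjoint (\<Phi> f)"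
  unfolding self_adjoint_def
proof (intro conjI ballI bounded_operator_\<Phi> f)
  fix \<phi> \<psi> :: "'v \<Rightarrow> complex" assume *: "\<phi> \<in> ell2" "\<psi> \<in> ell2"
  have "J f \<phi> \<psi> = cnj (J (\<lambda>x. cnj (f x)) \<psi> \<phi>)"
  proof (rule J_eqI[OF _ _ _ f])
    show "J (\<lambda>x. of_real x ^ k) \<phi> \<psi> = cnj (J (\<lambda>x. cnj (of_real x ^ k)) \<psi> \<phi>)" for k
      using * self_adjointD(2)[OF self_adjoint_funpow[OF self_adjoint]] by (simp add: J_power cnj_ip)
  qed (use * in \<open>auto intro: sigma_functional_J sigma_functional_cnj\<close>)
  then show "ip \<phi> (\<Phi> f \<psi>) = ip (\<Phi> f \<phi>) \<psi>"
    using f * cnj_ip[of \<psi> "\<Phi> f \<phi>"] by (simp add: ip_\<Phi> real)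
qed

end

section \<open>Spectral measures of bounded self-adjoint operators\<close>

lemma scalar_spectral_measure_eqI:
  assumes "finite_measure N" "sets N = sets borel"
    and "\<And>B. B \<in> sets borel \<Longrightarrow> Re (ip \<psi> (E B \<psi>)) = measure N B"
  shows "scalar_spectral_measure E \<psi> = N"
proof -
  interpret finite_measure N by fact
  have sp: "space N = UNIV" using sets_eq_imp_space_eq[OF assms(2)] by simp
  have "scalar_spectral_measure E \<psi> = measure_of UNIV (sets borel) (emeasure N)"
    unfolding scalar_spectral_measure_def
  proof (rule measure_of_eq)
    fix B :: "real set" assume "B \<in> sigma_sets UNIV (sets borel)"
    then have "B \<in> sets borel" using sets.sigma_sets_eq[of "borel :: real measure"] by simp
    then show "ennreal (Re (ip \<psi> (E B \<psi>))) = emeasure N B"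
      using assms(3) by (simp add: emeasure_eq_measure)
  qed simp
  also have "\<dots> = N"
    using measure_of_of_measure[of N] sp assms(2) by simp
  finally show ?thesis .
qed

context
  fixes E :: "real set \<Rightarrow> 'v operator"
  assumes pvm: "projection_valued_measure E"
begin

lemma pvm_self_adjoint: "B \<in> sets borel \<Longrightarrow> self_adjoint (E B)"
  using pvm unfolding projection_valued_measure_def by blast

lemma pvm_UNIV: "\<psi> \<in> ell2 \<Longrightarrow> E UNIV \<psi> = \<psi>" and pvm_empty: "\<psi> \<in> ell2 \<Longrightarrow> E {} \<psi> = (\<lambda>_. 0)"
  using pvm unfolding projection_valued_measure_def by blast+

lemma pvm_Int: "B \<in> sets borel \<Longrightarrow> C \<in> sets borel \<Longrightarrow> \<psi> \<in> ell2 \<Longrightarrow> E (B \<inter> C) \<psi> = E B (E C \<psi>)"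
  using pvm unfolding projection_valued_measure_def by blast

lemma pvm_ell2: "B \<in> sets borel \<Longrightarrow> \<psi> \<in> ell2 \<Longrightarrow> E B \<psi> \<in> ell2"
  by (rule bounded_operatorD(1)[OF self_adjointD(1)[OF pvm_self_adjoint]])

text \<open>Idempotence comes from intersecting \<open>B\<close> with itself. The resulting
  positivity ensures that \<open>ennreal\<close> in the scalar measure truncates nothing.\<close>

lemma ip_pvm: "B \<in> sets borel \<Longrightarrow> \<psi> \<in> ell2 \<Longrightarrow> ip \<psi> (E B \<psi>) = of_real (nsq (E B \<psi>))"
  using pvm_Int[of B B \<psi>] self_adjointD(2)[OF pvm_self_adjoint, of B \<psi> "E B \<psi>"]
  by (simp add: ip_self pvm_ell2)

lemma sets_scalar_spectral_measure: "sets (scalar_spectral_measure E \<psi>) = sets borel"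
  unfolding scalar_spectral_measure_def using sets.sigma_sets_eq[of borel] by simp

lemma emeasure_scalar_spectral_measure:
  assumes "B \<in> sets borel" "\<psi> \<in> ell2"
  shows "emeasure (scalar_spectral_measure E \<psi>) B = ennreal (Re (ip \<psi> (E B \<psi>)))"
  unfolding scalar_spectral_measure_def
proof (rule emeasure_measure_of_sigma[OF _ _ _ assms(1)])
  show "sigma_algebra UNIV (sets (borel :: real measure))"
    using sets.sigma_algebra_axioms[of "borel :: real measure"] by simp
  show "positive (sets borel) (\<lambda>B. ennreal (Re (ip \<psi> (E B \<psi>))))"
    using assms by (simp add: positive_def pvm_empty)
  show "countably_additive (sets borel) (\<lambda>B. ennreal (Re (ip \<psi> (E B \<psi>))))"
  proof (rule countably_additiveI)
    fix A :: "nat \<Rightarrow> real set"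
    assume A: "range A \<subseteq> sets borel" "disjoint_family A" "\<Union> (range A) \<in> sets borel"
    have "(\<lambda>i. ip \<psi> (E (A i) \<psi>)) sums ip \<psi> (E (\<Union>i. A i) \<psi>)"
      using pvm A assms(2) unfolding projection_valued_measure_def by blast
    then have "(\<lambda>i. Re (ip \<psi> (E (A i) \<psi>))) sums Re (ip \<psi> (E (\<Union>i. A i) \<psi>))"
      by (rule sums_Re)
    then show "(\<Sum>i. ennreal (Re (ip \<psi> (E (A i) \<psi>)))) = ennreal (Re (ip \<psi> (E (\<Union> (range A)) \<psi>)))"
      using A assms(2) by (intro suminf_ennreal_eq) (auto simp: ip_pvm)
  qed
qed

lemma finite_scalar_spectral_measure:
  assumes "\<psi> \<in> ell2" shows "finite_measure (scalar_spectral_measure E \<psi>)"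
  using emeasure_scalar_spectral_measure[OF _ assms, of UNIV]
    sets_eq_imp_space_eq[OF sets_scalar_spectral_measure[of \<psi>]]
  by (intro finite_measureI) simp

lemma measure_scalar_spectral_measure:
  assumes "B \<in> sets borel" "\<psi> \<in> ell2"
  shows "of_real (measure (scalar_spectral_measure E \<psi>) B) = ip \<psi> (E B \<psi>)"
  using emeasure_scalar_spectral_measure[OF assms] ip_pvm[OF assms] by (simp add: measure_def)

text \<open>\<open>E {-R..R}\<close> acts as the identity, so the complement acts as the projection
  of an empty intersection, that is, as zero.\<close>

lemma measure_family_scalar_spectral_measure:
  assumes R: "\<And>\<psi>. \<psi> \<in> ell2 \<Longrightarrow> E {-R..R} \<psi> = \<psi>"
  shows "measure_family (scalar_spectral_measure E) {-R..R}"
proof (rule measure_family.intro)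
  fix \<psi> :: "'v \<Rightarrow> complex" assume \<psi>: "\<psi> \<in> ell2"
  have c: "- {-R..R} \<in> sets borel" by simp
  have "E (- {-R..R}) \<psi> = E (- {-R..R} \<inter> {-R..R}) \<psi>"
    using R[OF \<psi>] pvm_Int[OF c, of "{-R..R}" \<psi>] \<psi> by simp
  then have "E (- {-R..R}) \<psi> = (\<lambda>_. 0)" using pvm_empty \<psi> by simp
  then have "emeasure (scalar_spectral_measure E \<psi>) (- {-R..R}) = 0"
    using emeasure_scalar_spectral_measure[OF c \<psi>] by simp
  then show "AE x in scalar_spectral_measure E \<psi>. x \<in> {-R..R}"
    using sets_scalar_spectral_measure[of \<psi>] by (intro AE_I[of _ _ "- {-R..R}"]) auto
qed (use finite_scalar_spectral_measure sets_scalar_spectral_measure in auto)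

end

locale spectral_bound =
  fixes H :: "'v operator" and R :: real
  assumes self_adjoint_H: "self_adjoint H" and R_pos: "0 < R"
    and ip_H_le: "\<psi> \<in> ell2 \<Longrightarrow> \<bar>Re (ip \<psi> (H \<psi>))\<bar> \<le> R * nsq \<psi>"
begin

text \<open>(H + R)/(2R): the affine image of \<open>H\<close> with quadratic form between 0 and 1.
  The map \<open>aff\<close> carries [0,1] back to [-R,R].\<close>

definition K :: "'v operator" where
  "K \<psi> = (\<lambda>x. of_real (1 / (2 * R)) * (H \<psi> x + of_real R * \<psi> x))"

definition aff :: "real \<Rightarrow> real" where "aff t = 2 * R * t - R"
definition aff_inv :: "real \<Rightarrow> real" where "aff_inv t = (t + R) / (2 * R)"

lemma aff_aff_inv [simp]: "aff (aff_inv t) = t"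
  using R_pos by (simp add: aff_def aff_inv_def)

lemma measurable_aff [measurable]: "aff \<in> borel_measurable borel"
  and measurable_aff_inv [measurable]: "aff_inv \<in> borel_measurable borel"
  unfolding aff_def[abs_def] aff_inv_def[abs_def] by measurable

lemmas H_ell2 = bounded_operatorD(1)[OF self_adjointD(1)[OF self_adjoint_H]]

lemma ip_K: "\<psi> \<in> ell2 \<Longrightarrow> \<phi> \<in> ell2 \<Longrightarrow> ip \<phi> (K \<psi>) = of_real (1 / (2 * R)) * (ip \<phi> (H \<psi>) + of_real R * ip \<phi> \<psi>)"
  unfolding K_def ip_scale_right
  by (subst ip_add_right) (simp_all add: ip_scale_right ell2_scale H_ell2)

sublocale unit_operator K
proof
  show "self_adjoint K"
    unfolding K_def[abs_def]
    by (intro self_adjoint_scale self_adjoint_add self_adjoint_H self_adjoint_ident)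
  fix \<psi> :: "'v \<Rightarrow> complex" assume \<psi>: "\<psi> \<in> ell2"
  have eq: "Re (ip \<psi> (K \<psi>)) = (Re (ip \<psi> (H \<psi>)) + R * nsq \<psi>) / (2 * R)"
    using \<psi> by (simp add: ip_K ip_self del: of_real_divide of_real_mult)
  show "0 \<le> Re (ip \<psi> (K \<psi>))" "Re (ip \<psi> (K \<psi>)) \<le> nsq \<psi>"
    unfolding eq using ip_H_le[OF \<psi>] R_pos by (auto simp: abs_le_iff field_simps)
qed

lemma bdd_borel_aff:
  assumes "f \<in> borel_measurable borel" "bounded (range f)"
  shows "bdd_borel {0..1} (\<lambda>t. f (aff t))"
  using assms unfolding bdd_borel_iff by (auto simp: bounded_iff)

text \<open>Polarization returns the integral on the diagonal, since both sides agree on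
  powers.\<close>

lemma J_diag:
  assumes "\<psi> \<in> ell2" "bdd_borel {0..1} f" shows "J f \<psi> \<psi> = (\<integral>x. f x \<partial>mu \<psi>)"
  by (rule J_eqI[OF sigma_functional_J sigma_functional_integral])
    (use assms in \<open>simp_all add: J_power integral_mu_power\<close>)

definition E :: "real set \<Rightarrow> 'v operator" where
  "E B = \<Phi> (\<lambda>t. indicator B (aff t))"

lemma bdd_indicator: "B \<in> sets borel \<Longrightarrow> bdd_borel {0..1} (\<lambda>t. indicator B (aff t))"
  by (rule bdd_borel_aff) (auto simp: bounded_iff indicator_def intro!: exI[of _ 1])

lemma J_one: "\<phi> \<in> ell2 \<Longrightarrow> \<psi> \<in> ell2 \<Longrightarrow> (\<And>x. x \<in> {0..1} \<Longrightarrow> f x = 1) \<Longrightarrow> f \<in> borel_measurable borel \<Longrightarrow>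
    J f \<phi> \<psi> = ip \<phi> \<psi>"
  using J_power[of \<phi> \<psi> 0] sigma_functional_cong[OF sigma_functional_J, of \<phi> \<psi> "\<lambda>_. 1" f] by simp

text \<open>Intersections are products of indicators, hence handled by multiplicativity of the
  calculus; countable additivity is continuity under bounded convergence of the finite partial
  unions.\<close>

lemma projection_valued_measure_E: "projection_valued_measure E"
  unfolding projection_valued_measure_def
proof (intro conjI ballI allI impI)
  show "self_adjoint (E B)" if "B \<in> sets borel" for B
    unfolding E_def using that by (intro self_adjoint_\<Phi> bdd_indicator) (auto simp: indicator_def)
  show "E {} \<psi> = (\<lambda>_. 0)" if "\<psi> \<in> ell2" for \<psi>
  proof (rule ell2_eqI)
    fix \<phi> :: "'v \<Rightarrow> complex" assume "\<phi> \<in> ell2"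
    then show "ip \<phi> (E {} \<psi>) = ip \<phi> (\<lambda>_. 0)"
      using that ip_\<Phi>[OF bdd_indicator[of "{}"], of \<phi> \<psi>]
        sigma_functionalD(2)[OF sigma_functional_J, of \<phi> \<psi> "\<lambda>_. 0" 0] by (simp add: E_def)
  qed
  show "E UNIV \<psi> = \<psi>" if "\<psi> \<in> ell2" for \<psi>
  proof (rule ell2_eqI)
    fix \<phi> :: "'v \<Rightarrow> complex" assume "\<phi> \<in> ell2"
    then show "ip \<phi> (E UNIV \<psi>) = ip \<phi> \<psi>"
      using that ip_\<Phi>[OF bdd_indicator[of UNIV], of \<phi> \<psi>] J_one[of \<phi> \<psi> "\<lambda>_. 1"] by (simp add: E_def)
  qed
  show "E (B \<inter> C) \<psi> = E B (E C \<psi>)" if "B \<in> sets borel" "C \<in> sets borel" "\<psi> \<in> ell2" for B C \<psi>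
    unfolding E_def \<Phi>_mult[OF bdd_indicator[OF that(1)] bdd_indicator[OF that(2)] that(3), symmetric]
    by (simp add: indicator_inter_arith)
  fix B :: "nat \<Rightarrow> real set" and \<phi> \<psi> :: "'v \<Rightarrow> complex"
  assume B: "range B \<subseteq> sets borel" "disjoint_family B" and *: "\<phi> \<in> ell2" "\<psi> \<in> ell2"
  have Bi: "B i \<in> sets borel" for i using B by auto
  have EJ: "ip \<phi> (E C \<psi>) = J (\<lambda>t. indicator C (aff t)) \<phi> \<psi>" if "C \<in> sets borel" for C
    unfolding E_def using that * by (intro ip_\<Phi> bdd_indicator)
  have part: "(\<Sum>i<n. ip \<phi> (E (B i) \<psi>)) = J (\<lambda>t. indicator (\<Union>i<n. B i) (aff t)) \<phi> \<psi>" for n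
  proof (induction n)
    case 0
    then show ?case using EJ[of "{}"] sigma_functionalD(2)[OF sigma_functional_J[OF *], of "\<lambda>_. 0" 0] by simp
  next
    case (Suc n)
    have "indicator (\<Union>i<Suc n. B i) x = (indicator (\<Union>i<n. B i) x + indicator (B n) x :: complex)" for x
    proof -
      have "B i \<inter> B n = {}" if "i < n" for i
        using B(2) that by (simp add: disjoint_family_on_def)
      then have "(\<Union>i<n. B i) \<inter> B n = {}" by auto
      then show ?thesis by (auto simp: lessThan_Suc indicator_def)
    qed
    then show ?case
      using Suc sigma_functionalD(1)[OF sigma_functional_J[OF *] bdd_indicator[of "\<Union>i<n. B i"] bdd_indicator[of "B n"]] Bi
      by (simp add: EJ)
  qed
  show "(\<lambda>i. ip \<phi> (E (B i) \<psi>)) sums ip \<phi> (E (\<Union>i. B i) \<psi>)"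
    unfolding sums_def part EJ[OF sets.countable_UN[OF B(1)[unfolded image_subset_iff[symmetric]]]]
  proof (rule sigma_functionalD(3)[OF sigma_functional_J[OF *], where B=1])
    show "(\<lambda>n. indicator (\<Union>i<n. B i) (aff x) :: complex) \<longlonglongrightarrow> indicator (\<Union>i. B i) (aff x)" for x
      by (rule LIMSEQ_indicator_UN)
  qed (use Bi in \<open>auto simp: indicator_def intro!: bdd_borelD[OF bdd_indicator]\<close>)
qed

lemma scalar_spectral_measure_E:
  assumes "\<psi> \<in> ell2" shows "scalar_spectral_measure E \<psi> = distr (mu \<psi>) borel aff"
proof (rule scalar_spectral_measure_eqI)
  interpret finite_measure "mu \<psi>" using finite_measure[OF assms] .
  have meas: "aff \<in> measurable (mu \<psi>) borel" by (rule measurable_m[OF assms]) simp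
  show "finite_measure (distr (mu \<psi>) borel aff)" by (rule finite_measure_distr[OF meas])
  fix B :: "real set" assume B: "B \<in> sets borel"
  have sp: "space (mu \<psi>) = UNIV" using sets_eq_imp_space_eq[OF sets_m[OF assms]] by simp
  have "ip \<psi> (E B \<psi>) = (\<integral>t. indicator B (aff t) \<partial>mu \<psi>)"
    unfolding E_def using assms B by (simp add: ip_\<Phi> bdd_indicator J_diag)
  also have "\<dots> = (\<integral>t. complex_of_real (indicator B (aff t)) \<partial>mu \<psi>)"
    by (intro Bochner_Integration.integral_cong) (auto simp: indicator_def)
  also have "\<dots> = of_real (\<integral>t. indicator (aff -` B \<inter> space (mu \<psi>)) t \<partial>mu \<psi>)"
    unfolding integral_complex_of_real
    by (intro arg_cong[where f=of_real] Bochner_Integration.integral_cong) (auto simp: indicator_def)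
  also have "\<dots> = of_real (measure (distr (mu \<psi>) borel aff) B)"
    using measurable_sets[OF meas B] B meas by (simp add: measure_distr)
  finally show "Re (ip \<psi> (E B \<psi>)) = measure (distr (mu \<psi>) borel aff) B" by simp
qed simp

lemma is_spectral_measure_E: "is_spectral_measure H E"
  unfolding is_spectral_measure_def
proof (intro conjI projection_valued_measure_E exI[of _ R] ballI)
  fix \<psi> :: "'v \<Rightarrow> complex" assume \<psi>: "\<psi> \<in> ell2"
  show "E {-R..R} \<psi> = \<psi>"
  proof (rule ell2_eqI)
    fix \<phi> :: "'v \<Rightarrow> complex" assume \<phi>: "\<phi> \<in> ell2"
    have "indicator {-R..R} (aff x) = (1::complex)" if "x \<in> {0..1}" for x
      using that R_pos by (auto simp: aff_def indicator_def field_simps)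
    then show "ip \<phi> (E {-R..R} \<psi>) = ip \<phi> \<psi>"
      using J_one[OF \<phi> \<psi> _ bdd_borelD[OF bdd_indicator[of "{-R..R}"]]] \<phi> \<psi>
      by (simp add: E_def ip_\<Phi> bdd_indicator)
  qed
  have meas: "aff \<in> measurable (mu \<psi>) borel" by (rule measurable_m[OF \<psi>]) simp
  have "complex_of_real (\<integral>t. t \<partial>scalar_spectral_measure E \<psi>) = (\<integral>t. complex_of_real (aff t) \<partial>mu \<psi>)"
    unfolding scalar_spectral_measure_E[OF \<psi>] integral_complex_of_real using meas by (simp add: integral_distr)
  \<comment> \<open>Written with exponents 1 and 0 so that the first two moments of
    \<open>mu \<psi>\<close> apply.\<close>
  also have "\<dots> = (\<integral>t. of_real (2 * R) * of_real t ^ 1 + of_real (- R) * of_real t ^ 0 \<partial>mu \<psi>)"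
    by (simp add: aff_def)
  also have "\<dots> = of_real (2 * R) * ip \<psi> (K \<psi>) - of_real R * ip \<psi> \<psi>"
    using \<psi> integral_mu_power[OF \<psi>, of 1] integral_mu_power[OF \<psi>, of 0]
      sigma_functionalD(1)[OF sigma_functional_integral[OF \<psi>] bdd_borel_mult[OF bdd_borel_const bdd_borel_power]
        bdd_borel_mult[OF bdd_borel_const bdd_borel_power], of "of_real (2 * R)" 1 "of_real (- R)" 0]
      sigma_functionalD(2)[OF sigma_functional_integral[OF \<psi>] bdd_borel_power, of "of_real (2 * R)" 1]
      sigma_functionalD(2)[OF sigma_functional_integral[OF \<psi>] bdd_borel_power, of "of_real (- R)" 0]
    by simp
  also have "\<dots> = ip \<psi> (H \<psi>)"
    using \<psi> R_pos by (simp add: ip_K field_simps)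
  finally show "ip \<psi> (H \<psi>) = complex_of_real (\<integral>t. t \<partial>scalar_spectral_measure E \<psi>)" by simp
qed

end

section \<open>Independence of the chosen spectral measure\<close>

context spectral_bound
begin

lemma unit_operator_K: "unit_operator K"
  by (rule unit_operator_axioms)

text \<open>Only the mean of \<open>F\<close> is prescribed. Together with multiplicativity on
  intersections it shows that the k-th power of \<open>aff_inv\<close> integrates to the k-th power
  of \<open>K\<close>, and equality of moments identifies \<open>F\<close> with
  \<open>E\<close>.\<close>

lemma is_spectral_measure_unique:
  assumes F: "is_spectral_measure H F" and \<psi>: "\<psi> \<in> ell2"
  shows "scalar_spectral_measure F \<psi> = distr (mu \<psi>) borel aff"
proof -
  have pvm: "projection_valued_measure F"
    and mean: "\<And>\<psi>. \<psi> \<in> ell2 \<Longrightarrow> ip \<psi> (H \<psi>) = of_real (\<integral>t. t \<partial>scalar_spectral_measure F \<psi>)"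
    using F unfolding is_spectral_measure_def by blast+
  obtain r where r: "\<And>\<psi>. \<psi> \<in> ell2 \<Longrightarrow> F {-r..r} \<psi> = \<psi>"
    using F unfolding is_spectral_measure_def by blast
  define I where "I = {-r..r}"
  interpret nu: measure_family "scalar_spectral_measure F" I
    unfolding I_def by (rule measure_family_scalar_spectral_measure[OF pvm r])
  have I: "compact I" by (simp add: I_def)
  have J_ind: "nu.J (indicator B) \<phi> \<psi> = ip \<phi> (F B \<psi>)"
    if "B \<in> sets borel" "\<phi> \<in> ell2" "\<psi> \<in> ell2" for B \<phi> \<psi>
    using that measure_scalar_spectral_measure[OF pvm] self_adjointD(1)[OF pvm_self_adjoint[OF pvm]]
    by (intro nu.J_indicator_eq_ip) auto
  \<comment> \<open>For indicators \<open>g\<close> this is the intersection law of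
    \<open>F\<close>; linearity and limits give all bounded Borel \<open>g\<close>.\<close>
  have J_restrict: "nu.J (\<lambda>t. g t * indicator B t) \<phi> \<psi> = nu.J g \<phi> (F B \<psi>)"
    if B: "B \<in> sets borel" and *: "\<phi> \<in> ell2" "\<psi> \<in> ell2" and g: "bdd_borel I g" for B g \<phi> \<psi>
  proof (rule sigma_functional_eq_indicators[OF I _ _ _ g])
    show "sigma_functional I (\<lambda>g. nu.J (\<lambda>t. g t * indicator B t) \<phi> \<psi>)"
      using * B by (intro sigma_functional_mult_arg nu.sigma_functional_J bdd_borel_indicator)
    show "sigma_functional I (\<lambda>g. nu.J g \<phi> (F B \<psi>))"
      using * B pvm_ell2[OF pvm] by (intro nu.sigma_functional_J) auto
    fix C :: "real set" assume C: "C \<in> sets borel"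
    have "nu.J (indicator (C \<inter> B)) \<phi> \<psi> = ip \<phi> (F C (F B \<psi>))"
      using J_ind[of "C \<inter> B"] pvm_Int[OF pvm C B] B C * by simp
    then show "nu.J (\<lambda>t. indicator C t * indicator B t) \<phi> \<psi> = nu.J (indicator C) \<phi> (F B \<psi>)"
      using J_ind[OF C *(1) pvm_ell2[OF pvm B *(2)]] by (simp add: indicator_inter_arith[abs_def])
  qed
  define \<kappa> where "\<kappa> t = complex_of_real (aff_inv t)" for t
  have \<kappa>: "bdd_borel I \<kappa>"
    unfolding \<kappa>_def[abs_def] aff_inv_def using I R_pos
    by (intro bdd_borel_of_real_comp continuous_intros) auto
  have \<kappa>_pow: "bdd_borel I (\<lambda>t. \<kappa> t ^ k)" for k
    by (induction k) (auto intro: bdd_borel_mult \<kappa>)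
  \<comment> \<open>The mean condition after the affine change of variable, carried off the diagonal
    by polarization.\<close>
  have J_\<kappa>: "nu.J \<kappa> \<phi> \<psi> = ip \<phi> (K \<psi>)" if *: "\<phi> \<in> ell2" "\<psi> \<in> ell2" for \<phi> \<psi>
  proof (rule nu.J_eq_ip[OF bounded _ *])
    fix \<zeta> :: "'v \<Rightarrow> complex" assume \<zeta>: "\<zeta> \<in> ell2"
    let ?N = "scalar_spectral_measure F \<zeta>"
    have sp: "space ?N = UNIV"
      using sets_eq_imp_space_eq[OF nu.sets_m[OF \<zeta>]] by simp
    have "(\<integral>t. complex_of_real 1 \<partial>?N) = of_real (\<integral>t. 1 \<partial>?N)"
      by (rule integral_complex_of_real)
    then have one: "(\<integral>t. 1 \<partial>?N) = ip \<zeta> \<zeta>"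
      using measure_scalar_spectral_measure[OF pvm _ \<zeta>, of UNIV] \<zeta> sp pvm_UNIV[OF pvm \<zeta>]
      by simp
    have \<kappa>_eq: "\<kappa> = (\<lambda>t. of_real (1 / (2 * R)) * (of_real t ^ 1 + of_real R * 1))"
      using R_pos by (auto simp: \<kappa>_def aff_inv_def field_simps)
    note D = sigma_functionalD[OF nu.sigma_functional_integral[OF \<zeta>]]
    have "(\<integral>t. \<kappa> t \<partial>?N) = of_real (1 / (2 * R)) * (\<integral>t. complex_of_real t ^ 1 + of_real R * 1 \<partial>?N)"
      unfolding \<kappa>_eq by (intro D bdd_borel_add bdd_borel_power[OF I] bdd_borel_mult bdd_borel_const)
    also have "(\<integral>t. complex_of_real t ^ 1 + of_real R * 1 \<partial>?N) =
        (\<integral>t. of_real t ^ 1 \<partial>?N) + (\<integral>t. complex_of_real R * 1 \<partial>?N)"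
      by (intro D bdd_borel_power[OF I] bdd_borel_mult bdd_borel_const)
    also have "(\<integral>t. complex_of_real R * 1 \<partial>?N) = of_real R * (\<integral>t. 1 \<partial>?N)"
      by (intro D bdd_borel_const)
    finally have "(\<integral>t. \<kappa> t \<partial>?N) =
        of_real (1 / (2 * R)) * ((\<integral>t. of_real t ^ 1 \<partial>?N) + of_real R * (\<integral>t. 1 \<partial>?N))" .
    then show "(\<integral>t. \<kappa> t \<partial>?N) = ip \<zeta> (K \<zeta>)"
      unfolding one power_one_right integral_complex_of_real mean[OF \<zeta>, symmetric]
      using \<zeta> by (simp add: ip_K)
  qed
  \<comment> \<open>Multiplying by \<open>\<kappa>\<close> acts as \<open>K\<close> on the left
    vector; \<open>J_restrict\<close> proves it for indicators, and induction on the exponent then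
    gives all moments.\<close>
  have J_mult_\<kappa>: "nu.J (\<lambda>t. g t * \<kappa> t) \<phi> \<psi> = nu.J g (K \<phi>) \<psi>"
    if *: "\<phi> \<in> ell2" "\<psi> \<in> ell2" and g: "bdd_borel I g" for g \<phi> \<psi>
  proof (rule sigma_functional_eq_indicators[OF I _ _ _ g])
    show "sigma_functional I (\<lambda>g. nu.J (\<lambda>t. g t * \<kappa> t) \<phi> \<psi>)"
      using * \<kappa> by (intro sigma_functional_mult_arg nu.sigma_functional_J)
    show "sigma_functional I (\<lambda>g. nu.J g (K \<phi>) \<psi>)"
      using * K_simps(1) by (intro nu.sigma_functional_J)
    fix B :: "real set" assume B: "B \<in> sets borel"
    have "nu.J (\<lambda>t. \<kappa> t * indicator B t) \<phi> \<psi> = ip \<phi> (K (F B \<psi>))"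
      using J_restrict[OF B * \<kappa>] J_\<kappa>[OF *(1) pvm_ell2[OF pvm B *(2)]] by simp
    also have "\<dots> = ip (K \<phi>) (F B \<psi>)"
      using self_adjointD(2)[OF self_adjoint *(1) pvm_ell2[OF pvm B *(2)]] .
    also have "\<dots> = nu.J (indicator B) (K \<phi>) \<psi>"
      using J_ind[OF B K_simps(1)[OF *(1)] *(2)] by simp
    finally show "nu.J (\<lambda>t. indicator B t * \<kappa> t) \<phi> \<psi> = nu.J (indicator B) (K \<phi>) \<psi>"
      by (simp add: mult.commute)
  qed
  have J_pow: "nu.J (\<lambda>t. \<kappa> t ^ k) \<phi> \<psi> = ip ((K ^^ k) \<phi>) \<psi>" if "\<phi> \<in> ell2" "\<psi> \<in> ell2" for k \<phi> \<psi>
    using that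
  proof (induction k arbitrary: \<phi>)
    case 0
    have "(\<lambda>t::real. 1::complex) = indicator UNIV" by auto
    then show ?case using J_ind[OF _ 0, of UNIV] pvm_UNIV[OF pvm 0(2)] by simp
  next
    case (Suc k)
    have "nu.J (\<lambda>t. \<kappa> t ^ k * \<kappa> t) \<phi> \<psi> = ip ((K ^^ k) (K \<phi>)) \<psi>"
      using J_mult_\<kappa>[OF Suc.prems \<kappa>_pow] Suc K_simps(1) by simp
    then show ?case by (simp add: mult.commute funpow_swap1)
  qed
  \<comment> \<open>The bound \<open>r\<close> that comes with \<open>F\<close> is unrelated to
    \<open>R\<close>, so moments are compared on an interval containing both [0,1] and the
    transported support of \<open>F\<close>.\<close>
  define M where "M = 1 + \<bar>aff_inv r\<bar> + \<bar>aff_inv (- r)\<bar>"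
  have M: "{0..1} \<subseteq> {-M..M}" "aff_inv ` I \<subseteq> {-M..M}"
  proof -
    have "aff_inv (- r) \<le> aff_inv t \<and> aff_inv t \<le> aff_inv r" if "t \<in> I" for t
      using that R_pos by (auto simp: I_def aff_inv_def divide_right_mono)
    then show "aff_inv ` I \<subseteq> {-M..M}" unfolding M_def by fastforce
  qed (auto simp: M_def)
  have F_eq: "F B \<psi> = E B \<psi>" if B: "B \<in> sets borel" and \<psi>: "\<psi> \<in> ell2" for B \<psi>
  proof (rule ell2_eqI)
    fix \<phi> :: "'v \<Rightarrow> complex" assume \<phi>: "\<phi> \<in> ell2"
    have "nu.J (\<lambda>t. indicator B (aff (aff_inv t))) \<phi> \<psi> = J (\<lambda>t. indicator B (aff t)) \<phi> \<psi>"
    proof (rule sigma_functional_eq_powers[where I="{-M..M}" and \<Lambda>="\<lambda>f. nu.J (\<lambda>t. f (aff_inv t)) \<phi> \<psi>" and \<Lambda>'="\<lambda>f. J f \<phi> \<psi>"])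
      show "sigma_functional {-M..M} (\<lambda>f. nu.J (\<lambda>t. f (aff_inv t)) \<phi> \<psi>)"
        by (rule sigma_functional_compose[OF nu.sigma_functional_J[OF \<phi> \<psi>] measurable_aff_inv M(2)])
      show "sigma_functional {-M..M} (\<lambda>f. J f \<phi> \<psi>)"
        by (rule sigma_functional_mono[OF sigma_functional_J[OF \<phi> \<psi>] M(1)])
      show "nu.J (\<lambda>t. of_real (aff_inv t) ^ k) \<phi> \<psi> = J (\<lambda>t. of_real t ^ k) \<phi> \<psi>" for k
        using J_pow[OF \<phi> \<psi>, of k] J_power[OF \<phi> \<psi>, of k]
          self_adjointD(2)[OF self_adjoint_funpow[OF self_adjoint] \<phi> \<psi>, of k] by (simp add: \<kappa>_def)
      show "bdd_borel {-M..M} (\<lambda>t. indicator B (aff t))"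
        using bdd_borelD[OF bdd_indicator[OF B]] by (intro bdd_borelI[of _ _ 1]) (auto simp: indicator_def)
    qed simp
    then show "ip \<phi> (F B \<psi>) = ip \<phi> (E B \<psi>)"
      using J_ind[OF B \<phi> \<psi>] by (simp add: E_def ip_\<Phi> bdd_indicator B \<phi> \<psi>)
  qed
  have "scalar_spectral_measure F \<psi> = scalar_spectral_measure E \<psi>"
    unfolding scalar_spectral_measure_def
    by (rule measure_of_eq)
      (use F_eq \<psi> sets.sigma_sets_eq[of "borel :: real measure"] in auto)
  then show ?thesis using scalar_spectral_measure_E[OF \<psi>] by simp
qed

text \<open>Neither choice matters: scalar measures do not depend on the spectral measure selected,
  \<open>\<Phi>\<close> shows that an admissible operator exists, and the diagonal condition fixes
  every admissible operator by polarization.\<close>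

lemma ip_functional_calculus:
  assumes f: "f \<in> borel_measurable borel" "bounded (range f)" and "\<phi> \<in> ell2" "\<psi> \<in> ell2"
  shows "ip \<phi> (functional_calculus f H \<psi>) = J (\<lambda>t. f (aff t)) \<phi> \<psi>"
proof -
  note bb = bdd_borel_aff[OF f]
  have "is_spectral_measure H (spectral_measure H)"
    unfolding spectral_measure_def using someI[of "is_spectral_measure H", OF is_spectral_measure_E] .
  then have int: "(\<integral>t. f t \<partial>scalar_spectral_measure (spectral_measure H) \<zeta>) = (\<integral>t. f (aff t) \<partial>mu \<zeta>)"
    if "\<zeta> \<in> ell2" for \<zeta>
    using that f measurable_m[OF that measurable_aff] by (simp add: is_spectral_measure_unique integral_distr)
  define P where "P A \<longleftrightarrow> bounded_operator A \<and>
    (\<forall>\<psi>\<in>ell2. ip \<psi> (A \<psi>) = (\<integral>t. f t \<partial>scalar_spectral_measure (spectral_measure H) \<psi>))" for A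
  have "P (\<Phi> (\<lambda>t. f (aff t)))"
    unfolding P_def using bb by (auto simp: int bounded_operator_\<Phi> ip_\<Phi> J_diag)
  then have "P (functional_calculus f H)"
    unfolding functional_calculus_def P_def[symmetric] using someI[of P] by blast
  then show ?thesis
    using assms(3,4) int unfolding P_def by (intro J_eq_ip[symmetric]) auto
qed

end

section \<open>Measurable dependence on a parameter\<close>

lemma finite_to_nat_less: "finite {x::'v::countable. to_nat x < n}"
  using finite_vimageI[of "{..<n}" "to_nat :: 'v \<Rightarrow> nat"] by (simp add: vimage_def)

text \<open>The sets \<open>{x. to_nat x < n}\<close> are finite and eventually contain every finite
  set, so the unordered sum becomes a limit of a sequence of measurable functions.\<close>

lemma borel_measurable_infsum_countable:
  fixes f :: "'w \<Rightarrow> 'v::countable \<Rightarrow> complex"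
  assumes "\<And>\<omega>. \<omega> \<in> space M \<Longrightarrow> f \<omega> summable_on UNIV"
    and "\<And>x. (\<lambda>\<omega>. f \<omega> x) \<in> borel_measurable M"
  shows "(\<lambda>\<omega>. \<Sum>\<^sub>\<infinity>x. f \<omega> x) \<in> borel_measurable M"
proof (rule borel_measurable_LIMSEQ_metric)
  show "(\<lambda>\<omega>. \<Sum>x | to_nat x < n. f \<omega> x) \<in> borel_measurable M" for n
    by (intro borel_measurable_sum assms)
  fix \<omega> assume "\<omega> \<in> space M"
  then have "(sum (f \<omega>) \<longlongrightarrow> (\<Sum>\<^sub>\<infinity>x. f \<omega> x)) (finite_subsets_at_top UNIV)"
    using assms(1) by (simp add: has_sum_def[symmetric])
  moreover have "filterlim (\<lambda>n. {x::'v. to_nat x < n}) (finite_subsets_at_top UNIV) sequentially"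
    unfolding filterlim_finite_subsets_at_top
  proof (intro allI impI)
    fix X :: "'v set" assume "finite X \<and> X \<subseteq> UNIV"
    then have "finite (to_nat ` X)" by simp
    then obtain N where N: "\<And>x. x \<in> X \<Longrightarrow> to_nat x < N"
      unfolding finite_nat_set_iff_bounded by auto
    show "\<forall>\<^sub>F n in sequentially. finite {x::'v. to_nat x < n} \<and> X \<subseteq> {x. to_nat x < n} \<and> {x::'v. to_nat x < n} \<subseteq> UNIV"
      using eventually_ge_at_top[of N]
      by eventually_elim (use N finite_to_nat_less in \<open>auto dest!: N\<close>)
  qed
  ultimately show "(\<lambda>n. \<Sum>x | to_nat x < n. f \<omega> x) \<longlonglongrightarrow> (\<Sum>\<^sub>\<infinity>x. f \<omega> x)"
    by (rule filterlim_compose)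
qed

lemma borel_measurable_ip:
  fixes \<phi> \<psi> :: "'w \<Rightarrow> 'v::countable \<Rightarrow> complex"
  assumes "\<And>\<omega>. \<omega> \<in> space M \<Longrightarrow> \<phi> \<omega> \<in> ell2" "\<And>\<omega>. \<omega> \<in> space M \<Longrightarrow> \<psi> \<omega> \<in> ell2"
    and "\<And>x. (\<lambda>\<omega>. \<phi> \<omega> x) \<in> borel_measurable M" "\<And>x. (\<lambda>\<omega>. \<psi> \<omega> x) \<in> borel_measurable M"
  shows "(\<lambda>\<omega>. ip (\<phi> \<omega>) (\<psi> \<omega>)) \<in> borel_measurable M"
  unfolding ip_def
proof (rule borel_measurable_infsum_countable)
  show "(\<lambda>x. cnj (\<phi> \<omega> x) * \<psi> \<omega> x) summable_on UNIV" if "\<omega> \<in> space M" for \<omega>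
    using has_sum_imp_summable[OF ip_has_sum] assms(1,2) that by blast
  have "(\<lambda>\<omega>. cnj (\<phi> \<omega> x)) \<in> borel_measurable M" for x
    using assms(3)
    by (rule measurable_compose[OF _ borel_measurable_continuous_onI[OF continuous_on_cnj[OF continuous_on_id]]])
  then show "(\<lambda>\<omega>. cnj (\<phi> \<omega> x) * \<psi> \<omega> x) \<in> borel_measurable M" for x
    using assms(4) by (intro borel_measurable_times)
qed

text \<open>The functional may vary with \<open>\<omega>\<close> while \<open>I\<close> does not;
  for fixed \<open>I\<close> the functions with measurable dependence form a monotone class.\<close>

lemma borel_measurable_sigma_functional:
  assumes "compact I" and \<Lambda>: "\<And>\<omega>. \<omega> \<in> space M \<Longrightarrow> sigma_functional I (\<Lambda> \<omega>)"
    and pow: "\<And>k. (\<lambda>\<omega>. \<Lambda> \<omega> (\<lambda>t. of_real t ^ k)) \<in> borel_measurable M" and f: "bdd_borel I f"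
  shows "(\<lambda>\<omega>. \<Lambda> \<omega> f) \<in> borel_measurable M"
proof -
  interpret bdd_borel_class I "\<lambda>f. (\<lambda>\<omega>. \<Lambda> \<omega> f) \<in> borel_measurable M"
  proof
    fix f g assume *: "bdd_borel I f" "bdd_borel I g"
      "(\<lambda>\<omega>. \<Lambda> \<omega> f) \<in> borel_measurable M" "(\<lambda>\<omega>. \<Lambda> \<omega> g) \<in> borel_measurable M"
    then have "(\<lambda>\<omega>. \<Lambda> \<omega> f + \<Lambda> \<omega> g) \<in> borel_measurable M" by measurable
    then show "(\<lambda>\<omega>. \<Lambda> \<omega> (\<lambda>x. f x + g x)) \<in> borel_measurable M"
      by (rule measurable_cong[THEN iffD2, rotated]) (use * sigma_functionalD(1)[OF \<Lambda>] in auto)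
  next
    fix c f assume *: "bdd_borel I f" "(\<lambda>\<omega>. \<Lambda> \<omega> f) \<in> borel_measurable M"
    then have "(\<lambda>\<omega>. c * \<Lambda> \<omega> f) \<in> borel_measurable M" by measurable
    then show "(\<lambda>\<omega>. \<Lambda> \<omega> (\<lambda>x. c * f x)) \<in> borel_measurable M"
      by (rule measurable_cong[THEN iffD2, rotated]) (use * sigma_functionalD(2)[OF \<Lambda>] in auto)
  next
    fix F f B
    assume F: "\<And>n. F n \<in> borel_measurable borel" "f \<in> borel_measurable borel"
      "\<And>n x. x \<in> I \<Longrightarrow> cmod (F n x) \<le> B" "\<And>x. x \<in> I \<Longrightarrow> (\<lambda>n. F n x) \<longlonglongrightarrow> f x"
      and m: "\<And>n. (\<lambda>\<omega>. \<Lambda> \<omega> (F n)) \<in> borel_measurable M"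
    show "(\<lambda>\<omega>. \<Lambda> \<omega> f) \<in> borel_measurable M"
      by (rule borel_measurable_LIMSEQ_metric[OF m sigma_functionalD(3)[OF \<Lambda> F]])
  qed fact
  show ?thesis by (rule of_powers[OF pow f])
qed

text \<open>By the calculus it suffices to treat powers of the rescaled operator. Their coordinates
  are measurable by induction, each new factor being moved onto a basis vector.\<close>

lemma random_operatorI:
  fixes H :: "'w \<Rightarrow> 'v::countable operator"
  assumes "prob_space M"
    and sa: "\<And>\<omega>. \<omega> \<in> space M \<Longrightarrow> self_adjoint (H \<omega>)"
    and bound: "\<And>\<omega> \<psi>. \<omega> \<in> space M \<Longrightarrow> \<psi> \<in> ell2 \<Longrightarrow> nsq (H \<omega> \<psi>) \<le> C * nsq \<psi>"
    and meas: "\<And>x y. (\<lambda>\<omega>. H \<omega> (ket x) y) \<in> borel_measurable M"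
  shows "random_operator M H"
  unfolding random_operator_def
proof (intro conjI ballI impI)
  show "prob_space M" by fact
  show "self_adjoint (H \<omega>)" if "\<omega> \<in> space M" for \<omega> using sa that .
  fix f :: "real \<Rightarrow> complex" and \<phi> \<psi> :: "'v \<Rightarrow> complex"
  assume f: "f \<in> borel_measurable borel" "bounded (range f)" and \<phi>: "\<phi> \<in> ell2" and \<psi>: "\<psi> \<in> ell2"
  \<comment> \<open>The quadratic form is at most (1 + C)/2 times \<open>nsq\<close>, so this
    positive \<open>R\<close> works for every \<open>\<omega>\<close> at once, and
    \<open>2 * R * t - R\<close> is the same substitution throughout.\<close>
  define R where "R = 1 + \<bar>C\<bar>"
  have sb: "spectral_bound (H \<omega>) R" if "\<omega> \<in> space M" for \<omega>
  proof
    fix \<zeta> :: "'v \<Rightarrow> complex" assume \<zeta>: "\<zeta> \<in> ell2"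
    have H\<zeta>: "H \<omega> \<zeta> \<in> ell2" using sa[OF that] \<zeta> by (simp add: self_adjoint_def bounded_operatorD(1))
    have "\<bar>Re (ip \<zeta> (H \<omega> \<zeta>))\<bar> \<le> (nsq \<zeta> + nsq (H \<omega> \<zeta>)) / 2"
      using abs_Re_le_cmod cmod_ip_le[OF \<zeta> H\<zeta>] by (rule order_trans)
    also have "\<dots> \<le> (nsq \<zeta> + C * nsq \<zeta>) / 2" using bound[OF that \<zeta>] by simp
    also have "\<dots> = ((1 + C) / 2) * nsq \<zeta>" by (simp add: algebra_simps)
    also have "\<dots> \<le> R * nsq \<zeta>" unfolding R_def by (intro mult_right_mono) auto
    finally show "\<bar>Re (ip \<zeta> (H \<omega> \<zeta>))\<bar> \<le> R * nsq \<zeta>" .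
  qed (use sa that in \<open>auto simp: R_def\<close>)
  define K where "K \<omega> = spectral_bound.K (H \<omega>) R" for \<omega>
  have uo: "unit_operator (K \<omega>)" if "\<omega> \<in> space M" for \<omega>
    unfolding K_def by (rule spectral_bound.unit_operator_K[OF sb[OF that]])
  have K_ell2: "K \<omega> \<zeta> \<in> ell2" if "\<omega> \<in> space M" "\<zeta> \<in> ell2" for \<omega> \<zeta>
    using unit_operator.K_simps(1)[OF uo] that .
  have K_pow_ell2: "(K \<omega> ^^ k) \<psi> \<in> ell2" if "\<omega> \<in> space M" for \<omega> k
    using unit_operator.pow_ell2(1)[OF uo[OF that] \<psi>] .
  have K_eq: "K \<omega> \<zeta> = (\<lambda>x. of_real (1 / (2 * R)) * (H \<omega> \<zeta> x + of_real R * \<zeta> x))" if "\<omega> \<in> space M" for \<omega> \<zeta>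
    unfolding K_def by (rule spectral_bound.K_def[OF sb[OF that]])
  have K_meas: "(\<lambda>\<omega>. K \<omega> (ket x) y) \<in> borel_measurable M" for x y
  proof -
    have "(\<lambda>\<omega>. of_real (1 / (2 * R)) * (H \<omega> (ket x) y + of_real R * ket x y)) \<in> borel_measurable M"
      using meas[of x y] by measurable
    then show ?thesis by (rule measurable_cong[THEN iffD2, rotated]) (auto simp: K_eq)
  qed
  have pow_meas: "(\<lambda>\<omega>. (K \<omega> ^^ k) \<psi> x) \<in> borel_measurable M" for k x
  proof (induction k arbitrary: x)
    case (Suc k)
    have meas: "(\<lambda>\<omega>. ip (K \<omega> (ket x)) ((K \<omega> ^^ k) \<psi>)) \<in> borel_measurable M"
      using Suc K_meas by (intro borel_measurable_ip) (auto simp: K_ell2 K_pow_ell2)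
    \<comment> \<open>Self-adjointness writes a coordinate of the next power as an inner product of
      two vectors already known to be measurable.\<close>
    have eq: "ip (K \<omega> (ket x)) ((K \<omega> ^^ k) \<psi>) = (K \<omega> ^^ Suc k) \<psi> x" if "\<omega> \<in> space M" for \<omega>
      using self_adjointD(2)[OF unit_operator.self_adjoint[OF uo[OF that]], of "ket x" "(K \<omega> ^^ k) \<psi>"]
        unit_operator.pow_ell2(1)[OF uo[OF that] \<psi>] by simp
    show ?case by (rule measurable_cong[THEN iffD1, OF eq meas])
  qed simp
  have meas: "(\<lambda>\<omega>. measure_family.J (unit_operator.mu (K \<omega>)) (\<lambda>t. f (2 * R * t - R)) \<phi> \<psi>) \<in> borel_measurable M"
  proof (rule borel_measurable_sigma_functional[where I="{0..1}"
        and \<Lambda>="\<lambda>\<omega> f. measure_family.J (unit_operator.mu (K \<omega>)) f \<phi> \<psi>"])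
    fix \<omega> assume \<omega>: "\<omega> \<in> space M"
    interpret unit_operator "K \<omega>" by (rule uo[OF \<omega>])
    show "sigma_functional {0..1} (\<lambda>f. J f \<phi> \<psi>)" by (rule sigma_functional_J[OF \<phi> \<psi>])
  next
    fix k
    have "(\<lambda>\<omega>. ip \<phi> ((K \<omega> ^^ k) \<psi>)) \<in> borel_measurable M"
      using pow_meas \<phi> by (intro borel_measurable_ip) (auto simp: K_pow_ell2)
    then show "(\<lambda>\<omega>. measure_family.J (unit_operator.mu (K \<omega>)) (\<lambda>t. of_real t ^ k) \<phi> \<psi>) \<in> borel_measurable M"
      by (rule measurable_cong[THEN iffD2, rotated]) (simp add: unit_operator.J_power[OF uo \<phi> \<psi>])
  next
    show "bdd_borel {0..1} (\<lambda>t. f (2 * R * t - R))"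
      using f unfolding bdd_borel_iff by (auto simp: bounded_iff intro!: measurable_compose[OF _ f(1)])
  qed simp
  have eq: "ip \<phi> (functional_calculus f (H \<omega>) \<psi>) =
      measure_family.J (unit_operator.mu (K \<omega>)) (\<lambda>t. f (2 * R * t - R)) \<phi> \<psi>" if "\<omega> \<in> space M" for \<omega>
    using spectral_bound.ip_functional_calculus[OF sb[OF that] f \<phi> \<psi>]
    unfolding spectral_bound.aff_def[OF sb[OF that]] K_def .
  show "(\<lambda>\<omega>. ip \<phi> (functional_calculus f (H \<omega>) \<psi>)) \<in> borel_measurable M"
    by (rule measurable_cong[THEN iffD2, OF eq meas])
qed

section \<open>Irrational rotations\<close>

lemma emeasure_lborel_shift:
  fixes c :: real
  assumes "B \<in> sets borel"
  shows "emeasure lborel {t. t + c \<in> B} = emeasure lborel B"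
proof -
  have "emeasure lborel B = emeasure (distr lborel borel ((+) c)) B"
    by (simp add: lborel_distr_plus)
  also have "\<dots> = emeasure lborel {t. t + c \<in> B}"
    using assms by (subst emeasure_distr) (auto simp: vimage_def add.commute)
  finally show ?thesis by simp
qed

lemma measure_lborel_shift:
  fixes c :: real
  shows "B \<in> sets borel \<Longrightarrow> measure lborel {t. t + c \<in> B} = measure lborel B"
  by (simp add: measure_def emeasure_lborel_shift)

text \<open>An invariant shift close to \<open>c\<close> differs from \<open>c\<close> only near the
  two ends of an interval, so the measure of \<open>A\<close> in intervals is invariant under all
  translations. Additivity and the bound by the length make it linear; if the factor is not zero,
  rescaled Lebesgue measure on \<open>A\<close> is Lebesgue measure itself, and it does not charge
  the complement.\<close>

lemma shift_invariant_zero_one: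
  fixes A :: "real set"
  assumes A [measurable]: "A \<in> sets borel"
    and dense: "\<And>c \<epsilon>. \<epsilon> > 0 \<Longrightarrow> \<exists>d. \<bar>d - c\<bar> < \<epsilon> \<and> (\<forall>t. t + d \<in> A \<longleftrightarrow> t \<in> A)"
  shows "emeasure lborel A = 0 \<or> emeasure lborel (- A) = 0"
proof -
  define G where "G x y = measure lborel (A \<inter> {x..<y})" for x y
  have fmI: "{x..<y} \<in> fmeasurable lborel" for x y :: real
    by (cases "x \<le> y") (auto simp: fmeasurable_def)
  have fm: "A \<inter> {x..<y} \<in> fmeasurable lborel" for x y :: real
    by (rule fmeasurableI2[OF fmI]) auto
  have G_shift_le: "G (x + c) (y + c) \<le> G x y" if "x \<le> y" for x y c
  proof (rule field_le_epsilon)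
    fix e :: real assume "e > 0"
    \<comment> \<open>Two end pieces of length \<open>\<epsilon>\<close> account for the error
      \<open>e\<close>.\<close>
    define \<epsilon> where "\<epsilon> = e / 2"
    have e: "\<epsilon> > 0" using \<open>e > 0\<close> by (simp add: \<epsilon>_def)
    obtain d where d: "\<bar>d - c\<bar> < \<epsilon>" "\<And>t. t + d \<in> A \<longleftrightarrow> t \<in> A" using dense[OF e] by blast
    have "{t. t + d \<in> A \<inter> {x + d..<y + d}} = A \<inter> {x..<y}" using d by auto
    then have Gd: "measure lborel (A \<inter> {x + d..<y + d}) = G x y"
      unfolding G_def by (metis A atLeastLessThan_borel measure_lborel_shift sets.Int)
    have "G (x + c) (y + c) \<le>
      measure lborel ((A \<inter> {x + d..<y + d}) \<union> ({x + c..<x + c + \<epsilon>} \<union> {y + c - \<epsilon>..<y + c}))"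
      unfolding G_def
      by (rule measure_mono_fmeasurable) (use d in \<open>auto intro!: fmeasurable.Un fm fmI\<close>)
    also have "\<dots> \<le> measure lborel (A \<inter> {x + d..<y + d}) +
      (measure lborel {x + c..<x + c + \<epsilon>} + measure lborel {y + c - \<epsilon>..<y + c})"
      by (intro order_trans[OF measure_Un_le] add_left_mono measure_Un_le) auto
    also have "\<dots> = G x y + e" using e by (simp add: Gd \<epsilon>_def)
    finally show "G (x + c) (y + c) \<le> G x y + e" .
  qed
  have G_shift: "G (x + c) (y + c) = G x y" if "x \<le> y" for x y c
    \<comment> \<open>The reverse inequality is the same one for the translated interval and the
      shift \<open>- c\<close>.\<close>
    using G_shift_le[OF that, of c] G_shift_le[of "x + c" "y + c" "- c"] that by simp
  have G_add: "G x z = G x y + G y z" if "x \<le> y" "y \<le> z" for x y z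
  proof -
    have "A \<inter> {x..<z} = (A \<inter> {x..<y}) \<union> (A \<inter> {y..<z})" using that by auto
    then show ?thesis
      unfolding G_def using fmeasurableD2[OF fm] by (simp add: measure_Union Int_assoc[symmetric])
        (subst measure_Union; auto)
  qed
  have G_le: "G x y \<le> y - x" if "x \<le> y" for x y
  proof -
    have "G x y \<le> measure lborel {x..<y}"
      unfolding G_def by (rule measure_mono_fmeasurable) (auto intro: fmI)
    then show ?thesis using that by simp
  qed
  have G_nonneg: "0 \<le> G x y" for x y by (simp add: G_def)
  define c where "c = G 0 1"
  have G_mult: "G 0 (real k * s) = real k * G 0 s" if "s \<ge> 0" for k s
  proof (induction k)
    case 0
    show ?case by (simp add: G_def)
  next
    case (Suc k)
    have "G 0 (real (Suc k) * s) = G 0 (real k * s) + G (real k * s) (real (Suc k) * s)"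
      using that by (intro G_add) (auto simp: algebra_simps)
    also have "G (real k * s) (real (Suc k) * s) = G (0 + real k * s) (s + real k * s)"
      by (simp add: algebra_simps)
    also have "\<dots> = G 0 s" by (rule G_shift[OF that])
    finally show ?case using Suc by (simp add: algebra_simps)
  qed
  have G_lin0: "G 0 t = c * t" if t: "t \<ge> 0" for t
  proof -
    \<comment> \<open>\<open>t\<close> is rounded down to the grid of mesh 1/N, where linearity is
      exact. The remainders on both sides lie in [0, 1/N], the one with \<open>c\<close> because
      \<open>c\<close> is at most 1.\<close>
    have bd: "\<bar>G 0 t - c * t\<bar> \<le> 2 / real (Suc n)" for n
    proof -
      define N where "N = real (Suc n)"
      have N: "N > 0" by (simp add: N_def)
      define k where "k = nat \<lfloor>N * t\<rfloor>"
      have k: "real k \<le> N * t" "N * t < real k + 1" using t N by (auto simp: k_def)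
      define s where "s = real k * (1 / N)"
      have "real k / N \<le> t" "t \<le> (real k + 1) / N"
        using k N by (simp_all add: pos_divide_le_eq pos_le_divide_eq mult.commute)
      then have s: "0 \<le> s" "s \<le> t" "t - s \<le> 1 / N"
        using N by (auto simp: s_def add_divide_distrib)
      have "c = N * G 0 (1 / N)"
        using G_mult[of "1/N" "Suc n"] N by (simp add: c_def N_def)
      then have "G 0 s = c * s"
        using G_mult[of "1/N" k] N by (simp add: s_def)
      moreover have "G 0 t = G 0 s + G s t" using s by (intro G_add) auto
      ultimately have "G 0 t - c * t = G s t - c * (t - s)" by (simp add: algebra_simps)
      moreover have "0 \<le> G s t" "G s t \<le> 1 / N" using G_le[of s t] s G_nonneg by auto
      moreover have "0 \<le> c * (t - s)" "c * (t - s) \<le> 1 * (1 / N)"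
        using G_le[of 0 1] G_nonneg[of 0 1] s N
        by (simp add: c_def, intro mult_mono) (simp_all add: c_def)
      ultimately show ?thesis by (auto simp: N_def abs_le_iff)
    qed
    have "(\<lambda>n. 2 / real (Suc n)) \<longlonglongrightarrow> 0"
      using tendsto_mult_left[OF LIMSEQ_inverse_real_of_nat, of 2] by (simp add: divide_inverse)
    then have "\<bar>G 0 t - c * t\<bar> \<le> 0"
      by (rule LIMSEQ_le_const) (use bd in auto)
    then show ?thesis by simp
  qed
  have G_lin: "G x y = c * (y - x)" if "x \<le> y" for x y
    using G_shift[of 0 "y - x" x] G_lin0[of "y - x"] that by simp
  show ?thesis
  proof (cases "c = 0")
    case True
    have "emeasure lborel (A \<inter> {- real n..<real n}) = 0" for n
      using G_lin[of "- real n" "real n"] True fm[of "- real n" "real n"]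
      by (simp add: G_def measure_eq_0_null_sets fmeasurableD2 emeasure_eq_measure2)
    then have "(\<Union>n. A \<inter> {- real n..<real n}) \<in> null_sets lborel"
      by (intro null_sets_UN) auto
    moreover have "A \<subseteq> (\<Union>n. A \<inter> {- real n..<real n})"
    proof
      fix t assume "t \<in> A"
      obtain n :: nat where "\<bar>t\<bar> < real n" using reals_Archimedean2 by blast
      then show "t \<in> (\<Union>n. A \<inter> {- real n..<real n})" using \<open>t \<in> A\<close> by (auto intro!: exI[of _ n])
    qed
    ultimately show ?thesis using null_sets_subset[of _ lborel A] by auto
  next
    case False
    then have c: "c > 0" using G_nonneg[of 0 1] by (simp add: c_def)
    \<comment> \<open>On intervals the factor 1/c compensates the density \<open>c\<close> of
      \<open>A\<close>, and a measure giving boxes their volume is \<open>lborel\<close>.\<close>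
    define \<nu> where "\<nu> = scale_measure (ennreal (1 / c)) (density lborel (indicator A))"
    have \<nu>: "emeasure \<nu> B = ennreal (1 / c) * emeasure lborel (A \<inter> B)" if "B \<in> sets borel" for B
      using that by (simp add: \<nu>_def emeasure_density flip: indicator_inter_arith)
    have "lborel = \<nu>"
    proof (rule lborel_eqI)
      fix l u :: real assume "\<And>b. b \<in> Basis \<Longrightarrow> l \<bullet> b \<le> u \<bullet> b"
      then have lu: "l \<le> u" by simp
      have "emeasure lborel (A \<inter> {l<..<u}) = emeasure lborel (A \<inter> {l..<u})"
        by (rule emeasure_eq_AE) (use AE_lborel_singleton[of l] in auto)
      also have "\<dots> = ennreal (c * (u - l))"
        using G_lin[OF lu] fm[of l u] by (simp add: G_def emeasure_eq_measure2 fmeasurableD2)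
      finally have "emeasure \<nu> {l<..<u} = ennreal (1 / c) * ennreal (c * (u - l))"
        by (simp add: \<nu>)
      also have "\<dots> = ennreal (u - l)"
        using c lu by (subst ennreal_mult[symmetric]) auto
      finally show "emeasure \<nu> (box l u) = (\<Prod>b\<in>Basis. (u - l) \<bullet> b)" by (simp add: box_real)
    qed (simp add: \<nu>_def)
    then have "emeasure lborel (- A) = emeasure \<nu> (- A)" by simp
    also have "\<dots> = 0" by (subst \<nu>) auto
    finally show ?thesis by simp
  qed
qed

section \<open>Periodic sets and rotations of a half-open interval\<close>

lemma borel_measurable_rmod [measurable (raw)]:
  "f \<in> borel_measurable M \<Longrightarrow> (\<lambda>t. f t rmod m) \<in> borel_measurable M"
  unfolding rmod_def
  by (intro borel_measurable_diff borel_measurable_times borel_measurable_const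
      measurable_compose[OF borel_measurable_divide borel_measurable_real_floor])

lemma rmod_add_multiple [simp]: "(t + of_int k * m) rmod m = t rmod m"
  by (metis add.right_neutral rmod_add rmod_rmod rmod_self_multiple_int)

lemma rmod_eq_minus: "m > 0 \<Longrightarrow> t rmod m = t - of_int \<lfloor>t / m\<rfloor> * m"
  by (simp add: rmod_def algebra_simps)

text \<open>Whole periods reduce the left end of the window to \<open>r\<close> in [0, L); the part
  of the window beyond \<open>L\<close> is then moved down by one period and fills [0, r).\<close>

lemma emeasure_periodic:
  fixes A :: "real set"
  assumes L: "L > 0" and A [measurable]: "A \<in> sets borel" and periodic: "\<And>t. t + L \<in> A \<longleftrightarrow> t \<in> A"
  shows "emeasure lborel (A \<inter> {x..<x + L}) = emeasure lborel (A \<inter> {0..<L})"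
proof -
  have per: "t + of_int k * L \<in> A \<longleftrightarrow> t \<in> A" for t k
  proof (induction k arbitrary: t rule: int_induct[where k=0])
    case (step1 i)
    then show ?case using periodic[of "t + of_int i * L"] by (simp add: algebra_simps)
  next
    case (step2 i)
    then show ?case using periodic[of "t + of_int (i - 1) * L"] by (simp add: algebra_simps)
  qed simp
  define r where "r = x rmod L"
  have r: "0 \<le> r" "r < L" using L by (auto simp: r_def rmod_nonneg rmod_less)
  have x: "x = r + of_int \<lfloor>x / L\<rfloor> * L" using L by (simp add: r_def rmod_eq_minus)
  have "emeasure lborel (A \<inter> {x..<x + L}) = emeasure lborel {t. t + of_int \<lfloor>x / L\<rfloor> * L \<in> A \<inter> {x..<x + L}}"
    by (rule emeasure_lborel_shift[symmetric]) simp
  also have "{t. t + of_int \<lfloor>x / L\<rfloor> * L \<in> A \<inter> {x..<x + L}} = A \<inter> {r..<r + L}"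
    using x by (auto simp: per)
  also have "A \<inter> {r..<r + L} = (A \<inter> {r..<L}) \<union> (A \<inter> {L..<r + L})"
    using r by auto
  also have "emeasure lborel \<dots> = emeasure lborel (A \<inter> {r..<L}) + emeasure lborel (A \<inter> {L..<r + L})"
    by (rule plus_emeasure[symmetric]) auto
  also have "emeasure lborel (A \<inter> {L..<r + L}) = emeasure lborel {t. t + L \<in> A \<inter> {L..<r + L}}"
    by (rule emeasure_lborel_shift[symmetric]) simp
  also have "{t. t + L \<in> A \<inter> {L..<r + L}} = A \<inter> {0..<r}"
    using periodic by auto
  also have "emeasure lborel (A \<inter> {r..<L}) + emeasure lborel (A \<inter> {0..<r}) =
      emeasure lborel ((A \<inter> {r..<L}) \<union> (A \<inter> {0..<r}))"
    by (rule plus_emeasure) auto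
  also have "(A \<inter> {r..<L}) \<union> (A \<inter> {0..<r}) = A \<inter> {0..<L}"
    using r by auto
  finally show ?thesis .
qed

context
  fixes \<theta> :: real
  assumes \<theta>: "\<theta> < 1"
begin

lemma space_moire_space [simp]: "space (moire_space \<theta>) = {0..<1 - \<theta>}"
  by (simp add: moire_space_def space_restrict_space)

lemma sets_moire_space: "A \<in> sets (moire_space \<theta>) \<longleftrightarrow> A \<in> sets borel \<and> A \<subseteq> {0..<1 - \<theta>}"
  by (auto simp: moire_space_def sets_restrict_space_iff)

lemma emeasure_moire_space:
  assumes "A \<in> sets (moire_space \<theta>)"
  shows "emeasure (moire_space \<theta>) A = emeasure lborel A / ennreal (1 - \<theta>)"
proof -
  have "A \<in> sets (restrict_space lborel {0..<1 - \<theta>})" "{0..<1-\<theta>} \<in> sets (restrict_space lborel {0..<1 - \<theta>})"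
    using assms by (auto simp: sets_moire_space sets_restrict_space_iff)
  moreover have "{0..<1 - \<theta>} \<inter> A = A" using assms by (auto simp: sets_moire_space)
  ultimately show ?thesis
    using assms \<theta> emeasure_restrict_space[of "{0..<1 - \<theta>}" lborel A]
      emeasure_restrict_space[of "{0..<1 - \<theta>}" lborel "{0..<1 - \<theta>}"]
    unfolding sets_moire_space by (simp add: moire_space_def)
qed

lemma prob_space_moire_space: "prob_space (moire_space \<theta>)"
proof
  show "emeasure (moire_space \<theta>) (space (moire_space \<theta>)) = 1"
    using \<theta> by (subst emeasure_moire_space) (auto simp: sets_moire_space divide_ennreal)
qed

lemma moire_shift_in_space: "moire_shift \<theta> x b \<in> {0..<1 - \<theta>}"
  using \<theta> by (auto simp: moire_shift_def rmod_nonneg rmod_less)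

lemma transformation_group_moire_shift:
  "transformation_group (space (moire_space \<theta>)) (moire_shift \<theta>)"
proof -
  have "moire_shift \<theta> (x + y) a = moire_shift \<theta> x (moire_shift \<theta> y a)" for x y a
  proof -
    have "moire_shift \<theta> x (moire_shift \<theta> y a) =
      (a + of_int y + of_int x + of_int (- \<lfloor>(a + of_int y) / (1 - \<theta>)\<rfloor>) * (1 - \<theta>)) rmod (1 - \<theta>)"
      using \<theta> by (simp add: moire_shift_def rmod_eq_minus algebra_simps)
    also have "\<dots> = moire_shift \<theta> (x + y) a"
      unfolding rmod_add_multiple by (simp add: moire_shift_def algebra_simps)
    finally show ?thesis ..
  qed
  moreover have "moire_shift \<theta> 0 a = a" if "a \<in> {0..<1 - \<theta>}" for a
    using that \<theta> by (simp add: moire_shift_def)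
  ultimately show ?thesis
    unfolding transformation_group_def using moire_shift_in_space by simp
qed

lemma measurable_moire_shift [measurable]: "moire_shift \<theta> x \<in> measurable (moire_space \<theta>) (moire_space \<theta>)"
proof -
  have "moire_shift \<theta> x = (\<lambda>b. (b + of_int x) rmod (1 - \<theta>))"
    by (simp add: fun_eq_iff moire_shift_def)
  then have "moire_shift \<theta> x \<in> borel_measurable borel" by simp
  then have "moire_shift \<theta> x \<in> measurable (restrict_space borel {0..<1 - \<theta>}) (restrict_space borel {0..<1 - \<theta>})"
    using moire_shift_in_space
    by (intro measurable_restrict_space2 measurable_restrict_space1) auto
  moreover have "sets (moire_space \<theta>) = sets (restrict_space borel {0..<1 - \<theta>})"
    by (auto simp: moire_space_def sets_restrict_space)
  ultimately show ?thesis by (simp cong: measurable_cong_sets)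
qed

text \<open>The periodic extension of \<open>A\<close>, which trades the rotation with its
  wrap-around for an ordinary translation of the line.\<close>

lemma vimage_rmod:
  assumes "A \<in> sets (moire_space \<theta>)"
  shows "{t. t rmod (1 - \<theta>) \<in> A} \<in> sets borel"
    and "A = {t. t rmod (1 - \<theta>) \<in> A} \<inter> {0..<1 - \<theta>}"
proof -
  have "(\<lambda>t. t rmod (1 - \<theta>)) -` A \<inter> space borel \<in> sets borel"
    using assms by (intro measurable_sets[OF borel_measurable_rmod]) (auto simp: sets_moire_space)
  then show "{t. t rmod (1 - \<theta>) \<in> A} \<in> sets borel" by (simp add: vimage_def)
  show "A = {t. t rmod (1 - \<theta>) \<in> A} \<inter> {0..<1 - \<theta>}"
    using assms \<theta> by (auto simp: sets_moire_space subset_iff)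
qed

lemma measure_preserving_moire_shift:
  "measure_preserving_group (moire_space \<theta>) (moire_shift \<theta>)"
  unfolding measure_preserving_group_def
proof (intro conjI allI transformation_group_moire_shift measurable_moire_shift)
  fix x :: int
  show "distr (moire_space \<theta>) (moire_space \<theta>) (moire_shift \<theta> x) = moire_space \<theta>"
  proof (rule measure_eqI)
    fix A assume "A \<in> sets (distr (moire_space \<theta>) (moire_space \<theta>) (moire_shift \<theta> x))"
    then have A: "A \<in> sets (moire_space \<theta>)" by simp
    let ?A = "{t. t rmod (1 - \<theta>) \<in> A}" and ?T = "moire_shift \<theta> x -` A \<inter> space (moire_space \<theta>)"
    have T: "?T \<in> sets (moire_space \<theta>)" using A by measurable
    \<comment> \<open>The preimage is the translate of one full period window of the periodic
      extension, whose measure does not depend on its position.\<close>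
    have "?T = {t. t + of_int x \<in> ?A \<inter> {of_int x..<of_int x + (1 - \<theta>)}}"
      by (auto simp: moire_shift_def)
    then have "emeasure lborel ?T = emeasure lborel (?A \<inter> {of_int x..<of_int x + (1 - \<theta>)})"
      using vimage_rmod(1)[OF A] by (simp add: emeasure_lborel_shift del: Int_iff)
    also have "\<dots> = emeasure lborel (?A \<inter> {0..<1 - \<theta>})"
      using \<theta> vimage_rmod(1)[OF A] rmod_add_multiple[of _ 1 "1 - \<theta>"]
      by (intro emeasure_periodic) auto
    also have "\<dots> = emeasure lborel A" using vimage_rmod(2)[OF A] by simp
    finally show "emeasure (distr (moire_space \<theta>) (moire_space \<theta>) (moire_shift \<theta> x)) A =
        emeasure (moire_space \<theta>) A"
      using A T by (simp add: emeasure_distr emeasure_moire_space)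
  qed simp
qed

lemma ergodic_moire_shift:
  assumes irr: "\<theta> \<notin> \<rat>"
  shows "ergodic_action (moire_space \<theta>) (moire_shift \<theta>)"
  unfolding ergodic_action_def
proof (intro ballI impI)
  fix A assume A: "A \<in> sets (moire_space \<theta>)"
    and inv: "\<forall>x. moire_shift \<theta> x -` A \<inter> space (moire_space \<theta>) = A"
  define L where "L = 1 - \<theta>"
  have L: "L > 0" using \<theta> by (simp add: L_def)
  define A' where "A' = {t. t rmod L \<in> A}"
  have A' [measurable]: "A' \<in> sets borel" using vimage_rmod(1)[OF A] by (simp add: A'_def L_def)
  have A_eq: "A = A' \<inter> {0..<L}" using vimage_rmod(2)[OF A] by (simp add: A'_def L_def)
  have period: "t + of_int k * L \<in> A' \<longleftrightarrow> t \<in> A'" for t k by (simp add: A'_def)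
  have shift: "t + of_int x \<in> A' \<longleftrightarrow> t \<in> A'" for t x
  proof -
    have b: "t rmod L \<in> space (moire_space \<theta>)" using L by (simp add: L_def rmod_nonneg rmod_less)
    \<comment> \<open>Reduction before and after the shift differ by a multiple of \<open>L\<close>,
      so invariance on the fundamental interval passes to the periodic extension.\<close>
    have "t rmod L + of_int x = (t + of_int x) + of_int (- \<lfloor>t / L\<rfloor>) * L"
      using L by (simp add: rmod_eq_minus)
    then have "(t rmod L + of_int x) rmod L = (t + of_int x) rmod L"
      by (metis rmod_add_multiple)
    moreover have "(t rmod L + of_int x) rmod L \<in> A \<longleftrightarrow> t rmod L \<in> A"
      using b inv[rule_format, of x] by (auto simp: moire_shift_def L_def set_eq_iff)
    ultimately show ?thesis by (simp add: A'_def)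
  qed
  have "emeasure lborel A' = 0 \<or> emeasure lborel (- A') = 0"
  proof (rule shift_invariant_zero_one[OF A'])
    fix c e :: real assume e: "e > 0"
    \<comment> \<open>Irrationality enters here: the numbers k L - h are dense by Kronecker's
      theorem, and each of them is a shift preserving \<open>A'\<close>.\<close>
    have "L \<notin> \<rat>" using irr Rats_diff[OF Rats_1, of L] by (auto simp: L_def)
    then obtain h k where "\<bar>of_int k * L - of_int h - c\<bar> < e"
      using sequence_of_fractional_parts_is_dense[OF _ e] by metis
    moreover have "t + (of_int k * L - of_int h) \<in> A' \<longleftrightarrow> t \<in> A'" for t
      using period[of "t + of_int (- h)" k] shift[of t "- h"] by (simp add: algebra_simps)
    ultimately show "\<exists>d. \<bar>d - c\<bar> < e \<and> (\<forall>t. t + d \<in> A' \<longleftrightarrow> t \<in> A')" by blast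
  qed
  then show "measure (moire_space \<theta>) A = 0 \<or> measure (moire_space \<theta>) A = 1"
  proof
    assume "emeasure lborel A' = 0"
    then have "emeasure lborel A = 0"
      unfolding A_eq by (metis A' emeasure_mono inf_le1 le_zero_eq sets_lborel)
    then show ?thesis using emeasure_moire_space[OF A] by (simp add: measure_def)
  next
    assume 0: "emeasure lborel (- A') = 0"
    have "AE t in lborel. t \<in> A'"
      by (rule AE_I[of _ _ "- A'"]) (use 0 in auto)
    then have "AE t in lborel. t \<in> A \<longleftrightarrow> t \<in> {0..<L}"
      unfolding A_eq by eventually_elim auto
    then have "emeasure lborel A = emeasure lborel {0..<L}"
      by (rule emeasure_eq_AE) (use A sets_moire_space in auto)
    then show ?thesis
      using emeasure_moire_space[OF A] L by (simp add: measure_def L_def divide_ennreal)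
  qed
qed

end

section \<open>Integral kernels and translations\<close>

definition kernel_op :: "('v \<Rightarrow> 'v \<Rightarrow> complex) \<Rightarrow> 'v operator" where
  "kernel_op k \<psi> = (\<lambda>x. \<Sum>\<^sub>\<infinity>y. k x y * \<psi> y)"

text \<open>Hypothesis of the Schur test. One bound for rows and columns makes it symmetric under
  transposition.\<close>

definition schur_kernel :: "('v \<Rightarrow> 'v \<Rightarrow> complex) \<Rightarrow> real \<Rightarrow> bool" where
  "schur_kernel k B \<longleftrightarrow>
     (\<forall>x. (\<lambda>y. cmod (k x y)) summable_on UNIV \<and> (\<Sum>\<^sub>\<infinity>y. cmod (k x y)) \<le> B) \<and>
     (\<forall>y. (\<lambda>x. cmod (k x y)) summable_on UNIV \<and> (\<Sum>\<^sub>\<infinity>x. cmod (k x y)) \<le> B)"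

lemma schur_kernel_adjoint: "schur_kernel k B \<Longrightarrow> schur_kernel (\<lambda>x y. cnj (k y x)) B"
  by (simp add: schur_kernel_def)

text \<open>One half of the Schur estimate: summing along rows first leaves the weights of
  \<open>\<phi>\<close> times row sums. The half for the other vector is this lemma for the adjoint
  kernel.\<close>

lemma schur_weighted_has_sum:
  assumes k: "schur_kernel k B" and \<phi>: "\<phi> \<in> ell2"
  obtains s where "((\<lambda>(x, y). cmod (k x y) * (cmod (\<phi> x))\<^sup>2) has_sum s) (UNIV \<times> UNIV)" "s \<le> B * nsq \<phi>"
proof -
  let ?r = "\<lambda>x. \<Sum>\<^sub>\<infinity>y. cmod (k x y)"
  have r: "((\<lambda>y. cmod (k x y)) has_sum ?r x) UNIV" "0 \<le> ?r x" "?r x \<le> B" for x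
    using k by (auto simp: schur_kernel_def intro: infsum_nonneg)
  have le: "?r x * (cmod (\<phi> x))\<^sup>2 \<le> B * (cmod (\<phi> x))\<^sup>2" for x
    using r by (intro mult_right_mono) auto
  have Bs: "((\<lambda>x. B * (cmod (\<phi> x))\<^sup>2) has_sum (B * nsq \<phi>)) UNIV"
    by (intro has_sum_cmult_right has_sum_nsq \<phi>)
  have sr: "(\<lambda>x. ?r x * (cmod (\<phi> x))\<^sup>2) summable_on UNIV"
    by (rule summable_on_comparison_test[OF has_sum_imp_summable[OF Bs]]) (use le r in auto)
  have f: "((\<lambda>y. (\<lambda>(x, y). cmod (k x y) * (cmod (\<phi> x))\<^sup>2) (x, y)) has_sum (?r x * (cmod (\<phi> x))\<^sup>2)) UNIV" for x
    using has_sum_cmult_left[OF r(1)[of x], of "(cmod (\<phi> x))\<^sup>2"] by simp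
  have "(\<lambda>(x, y). cmod (k x y) * (cmod (\<phi> x))\<^sup>2) summable_on (UNIV \<times> UNIV)"
    by (rule summable_on_SigmaI[OF f sr]) auto
  then have "((\<lambda>(x, y). cmod (k x y) * (cmod (\<phi> x))\<^sup>2) has_sum (\<Sum>\<^sub>\<infinity>x. ?r x * (cmod (\<phi> x))\<^sup>2)) (UNIV \<times> UNIV)"
    by (intro has_sum_SigmaI[OF f has_sum_infsum[OF sr]])
  moreover have "(\<Sum>\<^sub>\<infinity>x. ?r x * (cmod (\<phi> x))\<^sup>2) \<le> B * nsq \<phi>"
    by (rule has_sum_mono[OF has_sum_infsum[OF sr] Bs le])
  ultimately show ?thesis using that by blast
qed

context
  fixes k :: "'v \<Rightarrow> 'v \<Rightarrow> complex" and B :: real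
  assumes k: "schur_kernel k B"
begin

definition schur_form :: "('v \<Rightarrow> complex) \<Rightarrow> ('v \<Rightarrow> complex) \<Rightarrow> complex" where
  "schur_form \<phi> \<psi> = (\<Sum>\<^sub>\<infinity>(x, y)\<in>UNIV \<times> UNIV. cnj (\<phi> x) * k x y * \<psi> y)"

text \<open>The inequality between arithmetic and geometric means splits each term into the two
  weighted halves; absolute convergence of the double sum makes the order of summation
  irrelevant.\<close>

lemma
  assumes "\<phi> \<in> ell2" "\<psi> \<in> ell2"
  shows schur_form_has_sum: "((\<lambda>(x, y). cnj (\<phi> x) * k x y * \<psi> y) has_sum schur_form \<phi> \<psi>) (UNIV \<times> UNIV)"
    and schur_form_le: "cmod (schur_form \<phi> \<psi>) \<le> B / 2 * (nsq \<phi> + nsq \<psi>)"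
proof -
  obtain s where s: "((\<lambda>(x, y). cmod (k x y) * (cmod (\<phi> x))\<^sup>2) has_sum s) (UNIV \<times> UNIV)" "s \<le> B * nsq \<phi>"
    using schur_weighted_has_sum[OF k assms(1)] .
  obtain t where "((\<lambda>(x, y). cmod (cnj (k y x)) * (cmod (\<psi> x))\<^sup>2) has_sum t) (UNIV \<times> UNIV)" and t: "t \<le> B * nsq \<psi>"
    using schur_weighted_has_sum[OF schur_kernel_adjoint[OF k] assms(2)] .
  then have t': "((\<lambda>(x, y). cmod (k x y) * (cmod (\<psi> y))\<^sup>2) has_sum t) (UNIV \<times> UNIV)"
    by (subst has_sum_swap) simp
  have g: "((\<lambda>p. ((\<lambda>(x, y). cmod (k x y) * (cmod (\<phi> x))\<^sup>2) p + (\<lambda>(x, y). cmod (k x y) * (cmod (\<psi> y))\<^sup>2) p) / 2)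
      has_sum ((s + t) / 2)) (UNIV \<times> UNIV)"
    by (intro has_sum_divide_const has_sum_add s t')
  have le: "norm ((\<lambda>(x, y). cnj (\<phi> x) * k x y * \<psi> y) p) \<le>
      ((\<lambda>(x, y). cmod (k x y) * (cmod (\<phi> x))\<^sup>2) p + (\<lambda>(x, y). cmod (k x y) * (cmod (\<psi> y))\<^sup>2) p) / 2" for p
  proof -
    obtain x y where p: "p = (x, y)" by (cases p)
    have "cmod (k x y) * cmod (cnj (\<phi> x) * \<psi> y) \<le> cmod (k x y) * (((cmod (\<phi> x))\<^sup>2 + (cmod (\<psi> y))\<^sup>2) / 2)"
      by (intro mult_left_mono cmod_mult_le) auto
    then show ?thesis by (simp add: p norm_mult algebra_simps)
  qed
  have 2: "(\<lambda>p. norm ((\<lambda>(x, y). cnj (\<phi> x) * k x y * \<psi> y) p)) summable_on (UNIV \<times> UNIV)"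
    by (rule summable_on_comparison_test[OF has_sum_imp_summable[OF g]]) (use le in auto)
  show 1: "((\<lambda>(x, y). cnj (\<phi> x) * k x y * \<psi> y) has_sum schur_form \<phi> \<psi>) (UNIV \<times> UNIV)"
    unfolding schur_form_def by (rule has_sum_infsum[OF abs_summable_summable[OF 2]])
  have "cmod (schur_form \<phi> \<psi>) \<le> (s + t) / 2"
    by (rule norm_infsum_le[OF 1 g le])
  also have "\<dots> \<le> B / 2 * (nsq \<phi> + nsq \<psi>)"
    using s t by (simp add: algebra_simps)
  finally show "cmod (schur_form \<phi> \<psi>) \<le> B / 2 * (nsq \<phi> + nsq \<psi>)" .
qed

lemma kernel_op_has_sum:
  assumes "\<psi> \<in> ell2" shows "((\<lambda>y. k x y * \<psi> y) has_sum kernel_op k \<psi> x) UNIV"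
proof -
  have "(\<lambda>y. cmod (k x y) * sqrt (nsq \<psi>)) summable_on UNIV"
    using k by (intro summable_on_cmult_left) (auto simp: schur_kernel_def)
  then have 1: "(\<lambda>y. norm (k x y * \<psi> y)) summable_on UNIV"
  proof (rule summable_on_comparison_test)
    show "norm (k x y * \<psi> y) \<le> cmod (k x y) * sqrt (nsq \<psi>)" for y
      using cmod_le_nsq[OF assms, of y] by (auto simp: norm_mult intro!: mult_left_mono real_le_rsqrt)
  qed auto
  show ?thesis
    unfolding kernel_op_def by (rule has_sum_infsum[OF abs_summable_summable[OF 1]])
qed

lemma schur_form_ket: "\<psi> \<in> ell2 \<Longrightarrow> schur_form (ket x) \<psi> = kernel_op k \<psi> x"
proof -
  assume \<psi>: "\<psi> \<in> ell2"
  have "((\<lambda>x'. cnj (ket x x') * kernel_op k \<psi> x') has_sum schur_form (ket x) \<psi>) UNIV"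
    by (rule has_sum_SigmaD[OF schur_form_has_sum[OF ket_ell2 \<psi>]])
      (use has_sum_cmult_right[OF kernel_op_has_sum[OF \<psi>]] in \<open>simp add: mult.assoc\<close>)
  then have "schur_form (ket x) \<psi> = ip (ket x) (kernel_op k \<psi>)"
    unfolding ip_def by (metis infsumI)
  then show ?thesis by simp
qed

text \<open>The Schur form satisfies the hypotheses of \<open>sesquilinear_operator\<close> with
  constant B/2, and 4 (B/2)^2 gives the sharp-looking B^2.\<close>

lemma
  shows bounded_kernel_op: "bounded_operator (kernel_op k)"
    and ip_kernel_op_form: "\<And>\<phi> \<psi>. \<phi> \<in> ell2 \<Longrightarrow> \<psi> \<in> ell2 \<Longrightarrow> ip \<phi> (kernel_op k \<psi>) = schur_form \<phi> \<psi>"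
    and nsq_kernel_op_le: "\<And>\<psi>. \<psi> \<in> ell2 \<Longrightarrow> nsq (kernel_op k \<psi>) \<le> B\<^sup>2 * nsq \<psi>"
proof -
  note hs = schur_form_has_sum
  have add_left: "schur_form (\<lambda>x. \<phi> x + \<psi> x) \<zeta> = schur_form \<phi> \<zeta> + schur_form \<psi> \<zeta>"
    if "\<phi> \<in> ell2" "\<psi> \<in> ell2" "\<zeta> \<in> ell2" for \<phi> \<psi> \<zeta>
    using has_sum_add[OF hs[OF that(1,3)] hs[OF that(2,3)]] hs[OF ell2_add[OF that(1,2)] that(3)]
    by (intro has_sum_unique) (auto simp: algebra_simps case_prod_unfold)
  have add_right: "schur_form \<phi> (\<lambda>x. \<psi> x + \<zeta> x) = schur_form \<phi> \<psi> + schur_form \<phi> \<zeta>"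
    if "\<phi> \<in> ell2" "\<psi> \<in> ell2" "\<zeta> \<in> ell2" for \<phi> \<psi> \<zeta>
    using has_sum_add[OF hs[OF that(1,2)] hs[OF that(1,3)]] hs[OF that(1) ell2_add[OF that(2,3)]]
    by (intro has_sum_unique) (auto simp: algebra_simps case_prod_unfold)
  have scale_left: "schur_form (\<lambda>x. a * \<phi> x) \<psi> = cnj a * schur_form \<phi> \<psi>"
    if "\<phi> \<in> ell2" "\<psi> \<in> ell2" for a \<phi> \<psi>
    using has_sum_cmult_right[OF hs[OF that], of "cnj a"] hs[OF ell2_scale[OF that(1)] that(2)]
    by (intro has_sum_unique) (auto simp: algebra_simps case_prod_unfold)
  have scale_right: "schur_form \<phi> (\<lambda>x. a * \<psi> x) = a * schur_form \<phi> \<psi>"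
    if "\<phi> \<in> ell2" "\<psi> \<in> ell2" for a \<phi> \<psi>
    using has_sum_cmult_right[OF hs[OF that], of a] hs[OF that(1) ell2_scale[OF that(2)]]
    by (intro has_sum_unique) (auto simp: algebra_simps case_prod_unfold)
  have S1: "bounded_operator (\<lambda>\<psi> x. schur_form (ket x) \<psi>)"
    by (rule sesquilinear_operator(1)[OF add_left add_right scale_left scale_right schur_form_le])
  have S2: "ip \<phi> (\<lambda>x. schur_form (ket x) \<psi>) = schur_form \<phi> \<psi>" if "\<phi> \<in> ell2" "\<psi> \<in> ell2" for \<phi> \<psi>
    by (rule sesquilinear_operator(2)[OF add_left add_right scale_left scale_right schur_form_le that])
  have S3: "nsq (\<lambda>x. schur_form (ket x) \<psi>) \<le> 4 * (B / 2)\<^sup>2 * nsq \<psi>" if "\<psi> \<in> ell2" for \<psi>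
    by (rule sesquilinear_operator(3)[OF add_left add_right scale_left scale_right schur_form_le that])
  have eq: "kernel_op k \<psi> = (\<lambda>x. schur_form (ket x) \<psi>)" if "\<psi> \<in> ell2" for \<psi>
    using schur_form_ket[OF that] by auto
  show "ip \<phi> (kernel_op k \<psi>) = schur_form \<phi> \<psi>" if "\<phi> \<in> ell2" "\<psi> \<in> ell2" for \<phi> \<psi>
    unfolding eq[OF that(2)] using S2 that .
  show nsq: "nsq (kernel_op k \<psi>) \<le> B\<^sup>2 * nsq \<psi>" if "\<psi> \<in> ell2" for \<psi>
    unfolding eq[OF that] using S3[OF that] by (simp add: power2_eq_square)
  show "bounded_operator (kernel_op k)"
    by (rule bounded_operatorI[OF _ _ _ nsq])
      (auto simp: eq ell2_closed bounded_operatorD(1)[OF S1] add_right scale_right)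
qed

end

text \<open>Both sides are the same absolutely convergent double sum, once the indices are swapped
  and the terms conjugated.\<close>

lemma ip_kernel_op_adjoint:
  assumes k: "schur_kernel k B" and "\<phi> \<in> ell2" "\<psi> \<in> ell2"
  shows "ip \<phi> (kernel_op k \<psi>) = ip (kernel_op (\<lambda>x y. cnj (k y x)) \<phi>) \<psi>"
proof -
  note k' = schur_kernel_adjoint[OF k]
  have 1: "((\<lambda>(x, y). cnj (\<phi> x) * k x y * \<psi> y) has_sum ip \<phi> (kernel_op k \<psi>)) (UNIV \<times> UNIV)"
    using schur_form_has_sum[OF k assms(2,3)] ip_kernel_op_form[OF k assms(2,3)] by simp
  have "((\<lambda>(x, y). cnj (\<psi> x) * cnj (k y x) * \<phi> y) has_sum ip \<psi> (kernel_op (\<lambda>x y. cnj (k y x)) \<phi>)) (UNIV \<times> UNIV)"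
    using schur_form_has_sum[OF k' assms(3,2)] ip_kernel_op_form[OF k' assms(3,2)] by simp
  then have "((\<lambda>p. cnj ((\<lambda>(x, y). cnj (\<psi> x) * cnj (k y x) * \<phi> y) p)) has_sum
      cnj (ip \<psi> (kernel_op (\<lambda>x y. cnj (k y x)) \<phi>))) (UNIV \<times> UNIV)"
    by (subst has_sum_cnj_iff)
  then have "((\<lambda>(x, y). \<psi> x * k y x * cnj (\<phi> y)) has_sum ip (kernel_op (\<lambda>x y. cnj (k y x)) \<phi>) \<psi>) (UNIV \<times> UNIV)"
    by (simp add: case_prod_unfold cnj_ip)
  then have "((\<lambda>(x, y). \<psi> y * k x y * cnj (\<phi> x)) has_sum ip (kernel_op (\<lambda>x y. cnj (k y x)) \<phi>) \<psi>) (UNIV \<times> UNIV)"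
    by (subst has_sum_swap) simp
  then show ?thesis
    using 1 by (intro has_sum_unique[OF 1]) (simp add: mult.commute mult.left_commute)
qed

lemma kernel_op_ket [simp]: "kernel_op k (ket x) = (\<lambda>y. k y x)"
proof
  fix y
  have "kernel_op k (ket x) y = (\<Sum>\<^sub>\<infinity>z\<in>{x}. k y z * ket x z)"
    unfolding kernel_op_def by (rule infsum_cong_neutral) (auto simp: ket_def)
  then show "kernel_op k (ket x) y = k y x" by (simp add: ket_def)
qed

section \<open>Lattice sums of decaying functions\<close>

lemma bij_int_shift: "bij (\<lambda>n::int. n + m)"
  by (rule bij_betwI[of _ _ _ "\<lambda>n. n - m"]) auto

lemma summable_exp_abs_int:
  assumes "a > 0" shows "(\<lambda>n::int. exp (- a * \<bar>real_of_int n\<bar>)) summable_on UNIV"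
proof -
  have "summable (\<lambda>n. exp (- a) ^ n)"
    using assms by (intro summable_geometric) auto
  then have nat: "(\<lambda>n::nat. exp (- a * real n)) summable_on UNIV"
    by (subst summable_on_UNIV_nonneg_real_iff) (auto simp: exp_of_nat_mult mult.commute simp flip: exp_of_nat_mult)
  have r1: "(\<lambda>n::int. exp (- a * \<bar>real_of_int n\<bar>)) summable_on (range int)"
    using nat by (subst summable_on_reindex) (auto simp: inj_def comp_def)
  have r2: "(\<lambda>n::int. exp (- a * \<bar>real_of_int n\<bar>)) summable_on (range (\<lambda>n. - int n))"
    using nat by (subst summable_on_reindex) (auto simp: inj_def comp_def)
  have U: "(UNIV :: int set) = range int \<union> range (\<lambda>n. - int n)"
    using int_cases2 by blast
  show ?thesis using summable_on_union[OF r1 r2, folded U] .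
qed

text \<open>Uniformity in the offset \<open>s\<close> is the point. Reindexing by the integer part
  of s/L leaves an offset in [0, L], which costs only the factor \<open>exp (c * L)\<close>.\<close>

lemma exponentially_decaying_sum:
  assumes h: "exponentially_decaying h" and L: "L > 0"
  obtains B where "B \<ge> 0" "\<And>s. (\<lambda>n::int. \<bar>h (L * of_int n + s)\<bar>) summable_on UNIV"
    "\<And>s. (\<Sum>\<^sub>\<infinity>n::int. \<bar>h (L * of_int n + s)\<bar>) \<le> B"
proof -
  obtain C c where C: "C > 0" and c: "c > 0" and le: "\<And>\<eta>. \<bar>h \<eta>\<bar> \<le> C * exp (- c * \<bar>\<eta>\<bar>)"
    using h unfolding exponentially_decaying_def by blast
  define e where "e n = C * exp (c * L) * exp (- (c * L) * \<bar>real_of_int n\<bar>)" for n :: int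
  have e: "e summable_on UNIV"
    unfolding e_def using c L by (intro summable_on_cmult_right summable_exp_abs_int) auto
  have "(\<lambda>n::int. \<bar>h (L * of_int n + s)\<bar>) summable_on UNIV \<and> (\<Sum>\<^sub>\<infinity>n::int. \<bar>h (L * of_int n + s)\<bar>) \<le> infsum e UNIV" for s
  proof -
    define m where "m = \<lfloor>s / L\<rfloor>"
    have m: "0 \<le> s - L * of_int m" "s - L * of_int m \<le> L"
      using L floor_divide_lower[OF L, of s] floor_divide_upper[OF L, of s]
      by (auto simp: m_def algebra_simps)
    have bd: "\<bar>h (L * of_int n + s)\<bar> \<le> e (n + m)" for n :: int
    proof -
      have "L * \<bar>real_of_int (n + m)\<bar> = \<bar>L * of_int n + L * of_int m\<bar>"
        using L by (simp add: abs_mult flip: distrib_left)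
      also have "\<dots> \<le> \<bar>L * of_int n + s\<bar> + L" using m by linarith
      finally have "c * (L * \<bar>real_of_int (n + m)\<bar> - L) \<le> c * \<bar>L * of_int n + s\<bar>"
        using c by (intro mult_left_mono) auto
      then have "exp (- c * \<bar>L * of_int n + s\<bar>) \<le> exp (c * L + - (c * L) * \<bar>real_of_int (n + m)\<bar>)"
        by (simp add: algebra_simps)
      then have "C * exp (- c * \<bar>L * of_int n + s\<bar>) \<le> e (n + m)"
        unfolding e_def exp_add mult.assoc using C by (intro mult_left_mono) auto
      then show ?thesis using le order_trans by blast
    qed
    have e': "(\<lambda>n. e (n + m)) summable_on UNIV"
      using e summable_on_reindex_bij_betw[OF bij_int_shift, of e m] by simp
    have s: "(\<lambda>n::int. \<bar>h (L * of_int n + s)\<bar>) summable_on UNIV"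
      by (rule summable_on_comparison_test[OF e']) (use bd in auto)
    have "(\<Sum>\<^sub>\<infinity>n::int. \<bar>h (L * of_int n + s)\<bar>) \<le> (\<Sum>\<^sub>\<infinity>n. e (n + m))"
      by (rule infsum_mono[OF s e' bd])
    also have "\<dots> = infsum e UNIV" by (rule infsum_reindex_bij_betw[OF bij_int_shift])
    finally show ?thesis using s by simp
  qed
  moreover have "0 \<le> infsum e UNIV" using C by (intro infsum_nonneg) (simp add: e_def)
  ultimately show ?thesis using that by blast
qed

section \<open>Translations and the Laplacian\<close>

lemma nsq_translation [simp]: "nsq (translation x \<psi>) = nsq \<psi>"
  unfolding nsq_def translation_def
  using infsum_reindex_bij_betw[OF bij_int_shift[of "- x"], of "\<lambda>n. (cmod (\<psi> n))\<^sup>2"] by simp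

lemma translation_ell2 [simp]: "translation x \<psi> \<in> ell2 \<longleftrightarrow> \<psi> \<in> ell2"
  unfolding ell2_def translation_def mem_Collect_eq
  using summable_on_reindex_bij_betw[OF bij_int_shift[of "- x"], of "\<lambda>n. (cmod (\<psi> n))\<^sup>2"] by simp

lemma translation_add: "translation (x + y) \<psi> = translation x (translation y \<psi>)"
  by (simp add: translation_def algebra_simps)

lemma translation_zero [simp]: "translation 0 \<psi> = \<psi>"
  by (simp add: translation_def)

lemma ip_translation: "ip (translation x \<phi>) (translation x \<psi>) = ip \<phi> \<psi>"
  unfolding ip_def translation_def
  using infsum_reindex_bij_betw[OF bij_int_shift[of "- x"], of "\<lambda>n. cnj (\<phi> n) * \<psi> n"] by simp

lemma ip_translation_right: "ip \<phi> (translation x \<psi>) = ip (translation (- x) \<phi>) \<psi>"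
  using ip_translation[of x "translation (- x) \<phi>" \<psi>] translation_add[of x "- x" \<phi>, symmetric]
  by simp

lemma bounded_translation: "bounded_operator (translation x)"
proof (rule bounded_operatorI[where C=1])
  show "translation x (\<lambda>n. \<phi> n + \<psi> n) = (\<lambda>n. translation x \<phi> n + translation x \<psi> n)" for \<phi> \<psi>
    by (simp add: translation_def)
  show "translation x (\<lambda>n. a * \<psi> n) = (\<lambda>n. a * translation x \<psi> n)" for a \<psi>
    by (simp add: translation_def)
qed simp_all

lemma unitary_translation: "unitary_operator (translation x)"
  unfolding unitary_operator_def
proof (intro conjI bounded_translation)
  show "bij_betw (translation x) ell2 ell2"
    by (rule bij_betwI[of _ _ _ "translation (- x)"]) (auto simp flip: translation_add)
qed (simp add: ip_translation)

lemma adjoint_translation: "\<phi> \<in> ell2 \<Longrightarrow> adjoint_operator (translation x) \<phi> = translation (- x) \<phi>"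
  by (rule adjoint_operator_eqI) (simp_all add: ip_translation_right)

lemma laplacian_eq: "laplacian \<psi> = (\<lambda>n. (translation (- 1) \<psi> n + translation 1 \<psi> n) - of_real 2 * \<psi> n)"
  by (auto simp: laplacian_def translation_def)

text \<open>The translations by 1 and by -1 are adjoint to each other, so their sum is
  symmetric.\<close>

lemma self_adjoint_laplacian: "self_adjoint laplacian"
proof -
  have "self_adjoint (\<lambda>\<psi> n. translation (- 1) \<psi> n + translation 1 \<psi> n)"
    by (auto simp: self_adjoint_def bounded_operator_add bounded_translation ip_add_left ip_add_right
        ip_translation_right)
  then have "self_adjoint (\<lambda>\<psi> n. (translation (- 1) \<psi> n + translation 1 \<psi> n) - of_real 2 * \<psi> n)"
    by (intro self_adjoint_diff self_adjoint_scale self_adjoint_ident)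
  then show ?thesis by (simp add: laplacian_eq[abs_def])
qed

section \<open>The coupled chain\<close>

text \<open>The roots of z^2 - w z + 1 have product 1 and are real for |w| > 2, so one of them lies
  strictly inside the unit interval. It is obtained as the inverse of the larger root, after a sign
  change if w is negative.\<close>

lemma obtain_green_root:
  fixes w :: real
  assumes "\<bar>w\<bar> > 2"
  obtains z where "z \<noteq> 0" "\<bar>z\<bar> < 1" "z + 1 / z = w"
proof -
  have pos: "\<exists>z. z \<noteq> 0 \<and> \<bar>z\<bar> < 1 \<and> z + 1 / z = v" if v: "v > 2" for v :: real
  proof -
    define r where "r = sqrt (v\<^sup>2 - 4)"
    have "v\<^sup>2 > 2\<^sup>2" using v by (intro power_strict_mono) auto
    then have r: "r\<^sup>2 = v\<^sup>2 - 4" "r \<ge> 0" by (auto simp: r_def)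
    define y where "y = (v + r) / 2"
    have y: "y > 1" using v r by (simp add: y_def)
    have "y * ((v - r) / 2) = 1" using r by (simp add: y_def power2_eq_square algebra_simps)
    then have "1 / y = (v - r) / 2" using y by (simp add: field_simps)
    then have "1 / y + y = v" by (simp add: y_def field_simps)
    then show ?thesis using y by (intro exI[of _ "1 / y"]) auto
  qed
  show ?thesis
  proof (cases "w > 2")
    case True
    then show ?thesis using pos that by blast
  next
    case False
    then have "- w > 2" using assms by auto
    from pos[OF this] obtain z where "z \<noteq> 0" "\<bar>z\<bar> < 1" "z + 1 / z = - w" by blast
    then show ?thesis using that[of "- z"] by auto
  qed
qed

text \<open>The decaying even solution of -g(n+1) + w g(n) - g(n-1) = 0 off the origin. The factor
  z/(1 - z^2) = 1/(1/z - z) normalizes the defect at the origin to 1.\<close>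

definition green :: "real \<Rightarrow> int \<Rightarrow> complex" where
  "green z n = of_real (z / (1 - z\<^sup>2) * z ^ nat \<bar>n\<bar>)"

lemma green_minus [simp]: "green z (- n) = green z n"
  by (simp add: green_def)

text \<open>Right of the origin z^n solves the recurrence because z + 1/z is its coefficient;
  evenness covers the left, and at 0 the prefactor is designed to give 1.\<close>

lemma green_equation:
  assumes z: "z \<noteq> 0" "\<bar>z\<bar> < 1"
  shows "- green z (n + 1) + of_real (z + 1 / z) * green z n - green z (n - 1) = (if n = 0 then 1 else 0)"
proof -
  have z2: "1 - z\<^sup>2 \<noteq> 0" using z by (simp add: abs_square_eq_1)
  have pos: "- green z (n + 1) + of_real (z + 1 / z) * green z n - green z (n - 1) = 0" if "n > 0" for n
  proof -
    define k where "k = nat (n - 1)"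
    have k: "n = int (Suc k)" using that by (simp add: k_def)
    have nat: "nat \<bar>n + 1\<bar> = Suc (Suc k)" "nat \<bar>n\<bar> = Suc k" "nat \<bar>n - 1\<bar> = k" using k by auto
    define c where "c = z / (1 - z\<^sup>2)"
    have "(z + 1 / z) * (z * z ^ k) = z * (z * z ^ k) + z ^ k"
      using z by (simp add: field_simps)
    then have eq: "- (c * (z * (z * z ^ k))) + (z + 1 / z) * (c * (z * z ^ k)) - c * z ^ k = 0"
      by (simp add: mult.left_commute[of _ c] flip: right_diff_distrib distrib_left)
    have green: "green z m = of_real (c * z ^ nat \<bar>m\<bar>)" for m
      by (simp add: green_def c_def)
    have "- green z (n + 1) + of_real (z + 1 / z) * green z n - green z (n - 1) =
        complex_of_real (- (c * (z * (z * z ^ k))) + (z + 1 / z) * (c * (z * z ^ k)) - c * z ^ k)"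
      unfolding green nat by simp
    then show ?thesis unfolding eq by simp
  qed
  show ?thesis
  proof (cases n "0 :: int" rule: linorder_cases)
    case less
    have "- (n + 1) = - n - 1" "- (n - 1) = - n + 1" by simp_all
    then have "green z (n + 1) = green z (- n - 1)" "green z (n - 1) = green z (- n + 1)"
      using green_minus[of z "n + 1"] green_minus[of z "n - 1"] by (simp_all only:)
    then show ?thesis using pos[of "- n"] less by (simp add: diff_eq_eq add.commute)
  next
    case equal
    then show ?thesis
      using z z2 unfolding green_def
      by (simp add: power2_eq_square field_simps flip: of_real_mult of_real_add of_real_diff of_real_minus)
  next
    case greater
    then show ?thesis using pos by simp
  qed
qed

definition green_kernel :: "real \<Rightarrow> int \<Rightarrow> int \<Rightarrow> complex" where
  "green_kernel z m n = green z (m - n)"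

text \<open>The powers of |z| are exponentials with rate -ln |z|, so the lattice sum estimate with
  spacing 1 applies.\<close>

lemma schur_green_kernel:
  assumes z: "z \<noteq> 0" "\<bar>z\<bar> < 1" obtains B where "schur_kernel (green_kernel z) B"
proof -
  define h where "h \<eta> = z / (1 - z\<^sup>2) * exp (ln \<bar>z\<bar> * \<bar>\<eta>\<bar>)" for \<eta> :: real
  have h: "cmod (green z n) = \<bar>h (of_int n)\<bar>" for n
  proof -
    have "\<bar>z\<bar> ^ nat \<bar>n\<bar> = exp (of_nat (nat \<bar>n\<bar>) * ln \<bar>z\<bar>)"
      unfolding exp_of_nat_mult using z by simp
    then have "\<bar>z\<bar> ^ nat \<bar>n\<bar> = exp (ln \<bar>z\<bar> * \<bar>of_int n\<bar>)"
      by (simp add: mult.commute)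
    then show ?thesis
      unfolding green_def h_def norm_of_real by (simp add: abs_mult power_abs)
  qed
  have "exponentially_decaying h"
    unfolding exponentially_decaying_def h_def
  proof (rule exI[of _ "\<bar>z / (1 - z\<^sup>2)\<bar>"], intro conjI exI[of _ "- ln \<bar>z\<bar>"] allI)
    show "0 < - ln \<bar>z\<bar>" using z by (simp add: ln_less_zero)
    show "0 < \<bar>z / (1 - z\<^sup>2)\<bar>" using z by (simp add: abs_square_eq_1)
  qed (simp add: abs_mult)
  then obtain B where B: "B \<ge> 0" "\<And>s. (\<lambda>n::int. \<bar>h (1 * of_int n + s)\<bar>) summable_on UNIV"
    "\<And>s. (\<Sum>\<^sub>\<infinity>n::int. \<bar>h (1 * of_int n + s)\<bar>) \<le> B"
    using exponentially_decaying_sum[of h 1] by (metis zero_less_one)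
  have eq: "cmod (green z (n - m)) = \<bar>h (1 * of_int n + - of_int m)\<bar>"
    "cmod (green z (m - n)) = \<bar>h (1 * of_int n + - of_int m)\<bar>" for m n
    using h[of "n - m"] green_minus[of z "n - m"] by auto
  have "schur_kernel (green_kernel z) B"
    unfolding schur_kernel_def green_kernel_def
  proof (intro conjI allI)
    fix m :: int
    show "(\<lambda>n. cmod (green z (m - n))) summable_on UNIV" "(\<Sum>\<^sub>\<infinity>n. cmod (green z (m - n))) \<le> B"
      unfolding eq(2) using B(2,3)[of "- of_int m"] by auto
    show "(\<lambda>n. cmod (green z (n - m))) summable_on UNIV" "(\<Sum>\<^sub>\<infinity>n. cmod (green z (n - m))) \<le> B"
      unfolding eq(1) using B(2,3)[of "- of_int m"] by auto
  qed
  then show ?thesis using that by blast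
qed

lemma green_kernel_translation:
  "kernel_op (green_kernel z) (translation x \<psi>) = translation x (kernel_op (green_kernel z) \<psi>)"
proof
  fix n
  have "kernel_op (green_kernel z) (translation x \<psi>) n = (\<Sum>\<^sub>\<infinity>m. green z (n - x - (m + - x)) * \<psi> (m + - x))"
    by (simp add: kernel_op_def green_kernel_def translation_def)
  also have "\<dots> = (\<Sum>\<^sub>\<infinity>m. green z (n - x - m) * \<psi> m)"
    by (rule infsum_reindex_bij_betw[OF bij_int_shift])
  finally show "kernel_op (green_kernel z) (translation x \<psi>) n = translation x (kernel_op (green_kernel z) \<psi>) n"
    by (simp add: kernel_op_def green_kernel_def translation_def)
qed

text \<open>\<open>inv_into\<close> needs a preimage inside \<open>ell2\<close> and injectivity
  there. The Green equation shows that \<open>G\<close> is a right inverse; it is also a left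
  inverse because it commutes with translations, from which \<open>T\<close> is built.\<close>

lemma resolvent_eq:
  assumes z: "z \<noteq> 0" "\<bar>z\<bar> < 1" "z + 1 / z = 2 - \<mu>" and \<psi>: "\<psi> \<in> ell2"
  shows "resolvent \<mu> \<psi> = kernel_op (green_kernel z) \<psi>"
proof -
  obtain B where B: "schur_kernel (green_kernel z) B" using schur_green_kernel[OF z(1,2)] .
  define G where "G = kernel_op (green_kernel z)"
  define T where "T \<phi> = (\<lambda>n. - laplacian \<phi> n - of_real \<mu> * \<phi> n)" for \<phi> :: "int \<Rightarrow> complex"
  have T_eq: "T \<phi> = (\<lambda>n. of_real (2 - \<mu>) * \<phi> n - (translation (- 1) \<phi> n + translation 1 \<phi> n))" for \<phi>
    by (auto simp: T_def laplacian_def translation_def algebra_simps)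
  have G: "bounded_operator G" unfolding G_def by (rule bounded_kernel_op[OF B])
  have TG: "T (G \<phi>) = \<phi>" if \<phi>: "\<phi> \<in> ell2" for \<phi>
  proof
    fix n
    have hs: "((\<lambda>y. green z (x - y) * \<phi> y) has_sum G \<phi> x) UNIV" for x
      using kernel_op_has_sum[OF B \<phi>, of x] by (simp add: G_def green_kernel_def)
    have "((\<lambda>y. - (green z (n + 1 - y) * \<phi> y) + of_real (2 - \<mu>) * (green z (n - y) * \<phi> y)
        + - (green z (n - 1 - y) * \<phi> y)) has_sum
        (- G \<phi> (n + 1) + of_real (2 - \<mu>) * G \<phi> n + - G \<phi> (n - 1))) UNIV"
      by (intro has_sum_add has_sum_uminusI has_sum_cmult_right hs)
    moreover have "- (green z (n + 1 - y) * \<phi> y) + of_real (2 - \<mu>) * (green z (n - y) * \<phi> y)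
        + - (green z (n - 1 - y) * \<phi> y) = cnj (ket n y) * \<phi> y" for y
    proof -
      have "- green z (n + 1 - y) + of_real (2 - \<mu>) * green z (n - y) - green z (n - 1 - y) =
          (if n - y = 0 then 1 else 0)"
        using green_equation[OF z(1,2), of "n - y"] unfolding z(3) by (simp add: algebra_simps)
      then have "(- green z (n + 1 - y) + of_real (2 - \<mu>) * green z (n - y) - green z (n - 1 - y)) * \<phi> y =
          cnj (ket n y) * \<phi> y"
        by (simp add: ket_def)
      then show ?thesis by (simp add: algebra_simps)
    qed
    ultimately have "- G \<phi> (n + 1) + of_real (2 - \<mu>) * G \<phi> n + - G \<phi> (n - 1) = ip (ket n) \<phi>"
      unfolding ip_def by (simp add: infsumI)
    then show "T (G \<phi>) n = \<phi> n" by (simp add: T_eq translation_def algebra_simps)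
  qed
  have GT: "G (T \<phi>) = \<phi>" if \<phi>: "\<phi> \<in> ell2" for \<phi>
  proof -
    have "T \<phi> = (\<lambda>n. of_real (2 - \<mu>) * \<phi> n + - 1 * (translation (- 1) \<phi> n + translation 1 \<phi> n))"
      by (simp add: T_eq algebra_simps)
    then have "G (T \<phi>) = (\<lambda>n. of_real (2 - \<mu>) * G \<phi> n + - 1 * (G (translation (- 1) \<phi>) n + G (translation 1 \<phi>) n))"
      using \<phi> bounded_operatorD(2,3)[OF G] by (simp only: ell2_add ell2_scale translation_ell2)
    also have "\<dots> = T (G \<phi>)"
      by (simp add: T_eq G_def green_kernel_translation algebra_simps)
    finally show ?thesis using TG[OF \<phi>] by simp
  qed
  have "inv_into ell2 T \<psi> = G \<psi>"
    by (rule inv_into_f_eq) (use GT TG[OF \<psi>] bounded_operatorD(1)[OF G \<psi>] in \<open>auto intro: inj_on_inverseI\<close>)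
  then show ?thesis by (simp add: resolvent_def T_def[abs_def] G_def)
qed

lemma matrix_element_resolvent:
  assumes "z \<noteq> 0" "\<bar>z\<bar> < 1" "z + 1 / z = 2 - \<mu>"
  shows "matrix_element (resolvent \<mu>) m n = green_kernel z m n"
  by (simp add: matrix_element_def resolvent_eq[OF assms])

section \<open>The reduced operator: bounds, covariance and measurability\<close>

locale coupled_chain =
  fixes \<theta> \<mu> :: real and h :: "real \<Rightarrow> real"
  assumes \<theta>_less: "\<theta> < 1" and \<mu>: "\<mu> \<notin> {0..4}" and even: "h (- \<eta>) = h \<eta>"
    and continuous_h: "continuous_on UNIV h" and decay: "exponentially_decaying h"
begin

definition coupling :: "real \<Rightarrow> int \<Rightarrow> int \<Rightarrow> complex" where
  "coupling b m n = of_real (h ((1 - \<theta>) * of_int m + b - of_int n))"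

lemma cnj_coupling [simp]: "cnj (coupling b m n) = coupling b m n"
  by (simp add: coupling_def)

lemma ex_root: "\<exists>z. z \<noteq> 0 \<and> \<bar>z\<bar> < 1 \<and> z + 1 / z = 2 - \<mu>"
proof -
  have "\<bar>2 - \<mu>\<bar> > 2" using \<mu> by auto
  then show ?thesis using obtain_green_root by blast
qed

definition root :: real where
  "root = (SOME z. z \<noteq> 0 \<and> \<bar>z\<bar> < 1 \<and> z + 1 / z = 2 - \<mu>)"

lemma root: "root \<noteq> 0" "\<bar>root\<bar> < 1" "root + 1 / root = 2 - \<mu>"
  using someI_ex[OF ex_root] unfolding root_def by blast+

abbreviation V :: "real \<Rightarrow> int operator" where "V b \<equiv> kernel_op (coupling b)"
abbreviation V' :: "real \<Rightarrow> int operator" where "V' b \<equiv> kernel_op (\<lambda>m n. coupling b n m)"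
abbreviation G :: "int operator" where "G \<equiv> kernel_op (green_kernel root)"

text \<open>Evenness of \<open>h\<close> makes the outer coupling the transpose of the inner one,
  which exposes the symmetric form: minus the Laplacian minus V' G V.\<close>

lemma H_r_eq: "H_r \<theta> \<mu> h b \<psi> = (\<lambda>n. - laplacian \<psi> n - V' b (G (V b \<psi>)) n)"
proof -
  have "h (of_int n - (1 - \<theta>) * of_int m - b) = h ((1 - \<theta>) * of_int m + b - of_int n)" for m n
    using even[of "(1 - \<theta>) * of_int m + b - of_int n"] by (simp add: algebra_simps)
  then show ?thesis
    unfolding H_r_def kernel_op_def coupling_def matrix_element_resolvent[OF root] by simp
qed

text \<open>Row sums run over a lattice of spacing 1, column sums over one of spacing 1 -
  \<open>\<theta>\<close>. Since \<open>b\<close> only shifts the offset, the bound is uniform in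
  \<open>b\<close>.\<close>

lemma schur_coupling: obtains B where "B \<ge> 0" "\<And>b. schur_kernel (coupling b) B"
proof -
  obtain B1 where B1: "B1 \<ge> 0" "\<And>s. (\<lambda>n::int. \<bar>h (1 * of_int n + s)\<bar>) summable_on UNIV"
    "\<And>s. (\<Sum>\<^sub>\<infinity>n::int. \<bar>h (1 * of_int n + s)\<bar>) \<le> B1"
    using exponentially_decaying_sum[OF decay, of 1] by (metis zero_less_one)
  obtain B2 where B2: "B2 \<ge> 0" "\<And>s. (\<lambda>n::int. \<bar>h ((1 - \<theta>) * of_int n + s)\<bar>) summable_on UNIV"
    "\<And>s. (\<Sum>\<^sub>\<infinity>n::int. \<bar>h ((1 - \<theta>) * of_int n + s)\<bar>) \<le> B2"
    using exponentially_decaying_sum[OF decay, of "1 - \<theta>"] \<theta>_less by (metis diff_gt_0_iff_gt)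
  have eq1: "cmod (coupling b m n) = \<bar>h (1 * of_int n + - ((1 - \<theta>) * of_int m + b))\<bar>" for b m n
    using even[of "(1 - \<theta>) * of_int m + b - of_int n"] by (simp add: coupling_def algebra_simps)
  have eq2: "cmod (coupling b m n) = \<bar>h ((1 - \<theta>) * of_int m + (b - of_int n))\<bar>" for b m n
    by (simp add: coupling_def algebra_simps)
  have "schur_kernel (coupling b) (B1 + B2)" for b
    unfolding schur_kernel_def
  proof (intro conjI allI)
    fix m
    show "(\<lambda>n. cmod (coupling b m n)) summable_on UNIV" "(\<Sum>\<^sub>\<infinity>n. cmod (coupling b m n)) \<le> B1 + B2"
      unfolding eq1 using B1(2,3)[of "- ((1 - \<theta>) * of_int m + b)"] B2(1) by auto
  next
    fix n
    show "(\<lambda>m. cmod (coupling b m n)) summable_on UNIV" "(\<Sum>\<^sub>\<infinity>m. cmod (coupling b m n)) \<le> B1 + B2"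
      unfolding eq2 using B2(2,3)[of "b - of_int n"] B1(1) by auto
  qed
  then show ?thesis using that[of "B1 + B2"] B1(1) B2(1) by simp
qed

lemma schur_coupling': "schur_kernel (coupling b) B \<Longrightarrow> schur_kernel (\<lambda>m n. coupling b n m) B"
  using schur_kernel_adjoint[of "coupling b" B] by simp

lemma bounded_V: "bounded_operator (V b)" and bounded_V': "bounded_operator (V' b)"
  using schur_coupling bounded_kernel_op schur_coupling' by metis+

lemma bounded_G: "bounded_operator G"
  using schur_green_kernel[OF root(1,2)] bounded_kernel_op by metis

lemmas VG_ell2 = bounded_operatorD(1)[OF bounded_V] bounded_operatorD(1)[OF bounded_V']
  bounded_operatorD(1)[OF bounded_G]

lemma ip_V': 
  assumes "\<phi> \<in> ell2" "\<psi> \<in> ell2" shows "ip \<phi> (V' b \<psi>) = ip (V b \<phi>) \<psi>" "ip \<phi> (V b \<psi>) = ip (V' b \<phi>) \<psi>"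
proof -
  obtain B where B: "schur_kernel (coupling b) B" using schur_coupling by metis
  show "ip \<phi> (V' b \<psi>) = ip (V b \<phi>) \<psi>" "ip \<phi> (V b \<psi>) = ip (V' b \<phi>) \<psi>"
    using ip_kernel_op_adjoint[OF schur_coupling'[OF B] assms] ip_kernel_op_adjoint[OF B assms]
    by simp_all
qed

lemma ip_G: "\<phi> \<in> ell2 \<Longrightarrow> \<psi> \<in> ell2 \<Longrightarrow> ip \<phi> (G \<psi>) = ip (G \<phi>) \<psi>"
proof -
  obtain B where B: "schur_kernel (green_kernel root) B" using schur_green_kernel[OF root(1,2)] .
  have "cnj (green_kernel root y x) = green_kernel root x y" for x y
    using green_minus[of root "x - y"] by (simp add: green_kernel_def green_def)
  then show "\<phi> \<in> ell2 \<Longrightarrow> \<psi> \<in> ell2 \<Longrightarrow> ip \<phi> (G \<psi>) = ip (G \<phi>) \<psi>"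
    using ip_kernel_op_adjoint[OF B, of \<phi> \<psi>] by simp
qed

lemma self_adjoint_H_r: "self_adjoint (H_r \<theta> \<mu> h b)"
proof -
  have "bounded_operator (\<lambda>\<psi>. V' b (G (V b \<psi>)))"
    by (intro bounded_operator_compose[OF bounded_V'] bounded_operator_compose[OF bounded_G] bounded_V)
  then have 1: "self_adjoint (\<lambda>\<psi>. V' b (G (V b \<psi>)))"
    by (simp add: self_adjoint_def ip_V' ip_G VG_ell2)
  have "self_adjoint (\<lambda>\<psi> n. of_real (- 1) * laplacian \<psi> n - V' b (G (V b \<psi>)) n)"
    by (intro self_adjoint_diff self_adjoint_scale self_adjoint_laplacian 1)
  then show ?thesis by (simp add: H_r_eq[abs_def])
qed

text \<open>The constant precedes \<open>b\<close>, as required for a rescaling common to the whole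
  family.\<close>

lemma H_r_bounded: obtains C where "\<And>b \<psi>. \<psi> \<in> ell2 \<Longrightarrow> nsq (H_r \<theta> \<mu> h b \<psi>) \<le> C * nsq \<psi>"
proof -
  obtain B where B: "B \<ge> 0" "\<And>b. schur_kernel (coupling b) B" using schur_coupling by blast
  obtain D where D: "schur_kernel (green_kernel root) D" using schur_green_kernel[OF root(1,2)] .
  obtain C where C: "C \<ge> 0" "\<And>\<psi>. \<psi> \<in> ell2 \<Longrightarrow> nsq (laplacian \<psi>) \<le> C * nsq \<psi>"
    using bounded_operator_nsq[OF self_adjointD(1)[OF self_adjoint_laplacian]] by auto
  have "nsq (H_r \<theta> \<mu> h b \<psi>) \<le> (2 * C + 2 * (B\<^sup>2 * (D\<^sup>2 * B\<^sup>2))) * nsq \<psi>" if \<psi>: "\<psi> \<in> ell2" for b \<psi>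
  proof -
    have "nsq (V' b (G (V b \<psi>))) \<le> B\<^sup>2 * nsq (G (V b \<psi>))"
      by (intro nsq_kernel_op_le schur_coupling' B VG_ell2 \<psi>)
    also have "\<dots> \<le> B\<^sup>2 * (D\<^sup>2 * nsq (V b \<psi>))"
      by (intro mult_left_mono nsq_kernel_op_le D VG_ell2 \<psi>) auto
    also have "\<dots> \<le> B\<^sup>2 * (D\<^sup>2 * (B\<^sup>2 * nsq \<psi>))"
      by (intro mult_left_mono nsq_kernel_op_le B \<psi>) auto
    finally have 1: "nsq (V' b (G (V b \<psi>))) \<le> B\<^sup>2 * (D\<^sup>2 * (B\<^sup>2 * nsq \<psi>))" .
    have "nsq (H_r \<theta> \<mu> h b \<psi>) \<le> 2 * nsq (\<lambda>n. - laplacian \<psi> n) + 2 * nsq (V' b (G (V b \<psi>)))"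
      unfolding H_r_eq using bounded_operatorD(1)[OF self_adjointD(1)[OF self_adjoint_laplacian] \<psi>] \<psi>
      by (intro nsq_diff_le ell2_uminus VG_ell2)
    also have "\<dots> \<le> 2 * (C * nsq \<psi>) + 2 * (B\<^sup>2 * (D\<^sup>2 * (B\<^sup>2 * nsq \<psi>)))"
      unfolding nsq_uminus using C(2)[OF \<psi>] 1 by simp
    finally show ?thesis by (simp add: algebra_simps)
  qed
  then show ?thesis using that by blast
qed

text \<open>The shifted coupling operator is the old one preceded by the translation by -x and
  followed by the translation by \<open>k\<close>. The latter passes through \<open>G\<close> and is
  cancelled by the transposed coupling, which leaves the translation by \<open>x\<close>
  outside.\<close>

lemma H_r_shift:
  "H_r \<theta> \<mu> h (b + of_int x - of_int k * (1 - \<theta>)) \<psi> = translation x (H_r \<theta> \<mu> h b (translation (- x) \<psi>))"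
proof -
  let ?b = "b + of_int x - of_int k * (1 - \<theta>)"
  have coup: "coupling ?b m n = coupling b (m - k) (n - x)" for m n
    by (simp add: coupling_def algebra_simps)
  have V: "V ?b \<psi> = translation k (V b (translation (- x) \<psi>))"
  proof
    fix m
    have "V ?b \<psi> m = (\<Sum>\<^sub>\<infinity>n. (\<lambda>n. coupling b (m - k) n * \<psi> (n + x)) (n + - x))"
      by (simp add: kernel_op_def coup)
    also have "\<dots> = (\<Sum>\<^sub>\<infinity>n. coupling b (m - k) n * \<psi> (n + x))"
      by (rule infsum_reindex_bij_betw[OF bij_int_shift])
    finally show "V ?b \<psi> m = translation k (V b (translation (- x) \<psi>)) m"
      by (simp add: kernel_op_def translation_def)
  qed
  have V': "V' ?b (translation k \<phi>) = translation x (V' b \<phi>)" for \<phi>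
  proof
    fix n
    have "V' ?b (translation k \<phi>) n = (\<Sum>\<^sub>\<infinity>m. (\<lambda>m. coupling b m (n - x) * \<phi> m) (m + - k))"
      by (simp add: kernel_op_def coup translation_def)
    also have "\<dots> = (\<Sum>\<^sub>\<infinity>m. coupling b m (n - x) * \<phi> m)"
      by (rule infsum_reindex_bij_betw[OF bij_int_shift])
    finally show "V' ?b (translation k \<phi>) n = translation x (V' b \<phi>) n"
      by (simp add: kernel_op_def translation_def)
  qed
  show ?thesis
    unfolding H_r_eq V green_kernel_translation V'
    by (auto simp: laplacian_def translation_def algebra_simps)
qed

lemma H_r_covariant:
  assumes "\<psi> \<in> ell2"
  shows "H_r \<theta> \<mu> h (moire_shift \<theta> x b) \<psi> =
    translation x (H_r \<theta> \<mu> h b (adjoint_operator (translation x) \<psi>))"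
  \<comment> \<open>The integer \<open>k\<close> is the number of periods removed by the reduction
    modulo 1 - \<open>\<theta>\<close>.\<close>
  using H_r_shift[of b x "\<lfloor>(b + of_int x) / (1 - \<theta>)\<rfloor>" \<psi>] \<theta>_less
  by (simp add: adjoint_translation assms moire_shift_def rmod_eq_minus)

lemma measurable_coupling: "(\<lambda>b. coupling b m n) \<in> borel_measurable (moire_space \<theta>)"
proof -
  have "(\<lambda>b. coupling b m n) \<in> borel_measurable borel"
    unfolding coupling_def
    by (intro borel_measurable_continuous_onI continuous_on_of_real continuous_on_compose2[OF continuous_h]
        continuous_intros) auto
  then have "(\<lambda>b. coupling b m n) \<in> borel_measurable (restrict_space borel {0..<1 - \<theta>})"
    by (rule measurable_restrict_space1)
  moreover have "sets (moire_space \<theta>) = sets (restrict_space borel {0..<1 - \<theta>})"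
    by (auto simp: moire_space_def sets_restrict_space)
  ultimately show ?thesis by (simp cong: measurable_cong_sets)
qed

text \<open>Each application of \<open>G\<close> or \<open>V'\<close> is moved onto a basis vector,
  so that coordinates become inner products of vectors with measurable coordinates.\<close>

lemma measurable_matrix_H_r: "(\<lambda>b. H_r \<theta> \<mu> h b (ket x) y) \<in> borel_measurable (moire_space \<theta>)"
proof -
  have V: "(\<lambda>b. V b (ket n) m) \<in> borel_measurable (moire_space \<theta>)" for m n
    by (simp add: measurable_coupling)
  have GV: "(\<lambda>b. G (V b (ket n)) m) \<in> borel_measurable (moire_space \<theta>)" for m n
  proof -
    have "(\<lambda>b. ip (G (ket m)) (V b (ket n))) \<in> borel_measurable (moire_space \<theta>)"
      by (intro borel_measurable_ip V VG_ell2) auto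
    moreover have "G (V b (ket n)) m = ip (G (ket m)) (V b (ket n))" for b
      using ip_G[OF ket_ell2 VG_ell2(1)[OF ket_ell2], of m b n] by (simp del: kernel_op_ket)
    ultimately show ?thesis by (simp only:)
  qed
  have "(\<lambda>b. ip (V b (ket y)) (G (V b (ket x)))) \<in> borel_measurable (moire_space \<theta>)"
    by (intro borel_measurable_ip V GV VG_ell2 ket_ell2)
  moreover have "V' b (G (V b (ket x))) y = ip (V b (ket y)) (G (V b (ket x)))" for b
    using ip_V'(1)[OF ket_ell2 VG_ell2(3)[OF VG_ell2(1)[OF ket_ell2]], of y b b x] by (simp del: kernel_op_ket)
  ultimately have "(\<lambda>b. V' b (G (V b (ket x))) y) \<in> borel_measurable (moire_space \<theta>)"
    by (simp only:)
  then show ?thesis unfolding H_r_eq by (intro borel_measurable_diff borel_measurable_const)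
qed

lemma random_operator_H_r: "random_operator (moire_space \<theta>) (H_r \<theta> \<mu> h)"
proof -
  obtain C where "\<And>b \<psi>. \<psi> \<in> ell2 \<Longrightarrow> nsq (H_r \<theta> \<mu> h b \<psi>) \<le> C * nsq \<psi>" using H_r_bounded by blast
  then show ?thesis
    by (intro random_operatorI[where C=C] prob_space_moire_space \<theta>_less self_adjoint_H_r measurable_matrix_H_r)
qed

end

theorem theorem3p5:
  fixes \<theta> \<mu> :: real and h :: "real \<Rightarrow> real"
  assumes "0 < \<theta>" and "\<theta> < 1" and "\<theta> \<notin> \<rat>"
    and "\<mu> \<notin> {0..4}"
    and "\<forall>\<eta>. h (- \<eta>) = h \<eta>"
    and "smooth_function h"
    and "exponentially_decaying h"
  shows "measure_preserving_group (moire_space \<theta>) (moire_shift \<theta>)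
    \<and> represents (moire_space \<theta>) (moire_shift \<theta>) int_shift
    \<and> prob_space (moire_space \<theta>)
    \<and> ergodic_action (moire_space \<theta>) (moire_shift \<theta>)
    \<and> transformation_group ell2 translation
    \<and> (\<forall>x. unitary_operator (translation x))
    \<and> (\<forall>x. \<forall>b\<in>{0..<1 - \<theta>}. \<forall>\<psi>\<in>ell2.
         H_r \<theta> \<mu> h (moire_shift \<theta> x b) \<psi> =
         translation x (H_r \<theta> \<mu> h b (adjoint_operator (translation x) \<psi>)))
    \<and> ergodic_operator int_adjacent int_shift (moire_space \<theta>) (moire_shift \<theta>) (H_r \<theta> \<mu> h)"
proof -
  \<comment> \<open>Smoothness at order \<open>0\<close>; the continuity it gives is what makes the
    coupling measurable in \<open>b\<close>.\<close>
  have "h differentiable (at x)" for x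
    using assms(6)[unfolded smooth_function_def, rule_format, of 0] by simp
  then have "continuous_on UNIV h"
    by (intro continuous_at_imp_continuous_on ballI differentiable_imp_continuous_within)
  then interpret coupled_chain \<theta> \<mu> h
    using assms by unfold_locales auto
  have mp: "measure_preserving_group (moire_space \<theta>) (moire_shift \<theta>)"
    by (rule measure_preserving_moire_shift[OF \<theta>_less])
  have int_shift: "transformation_group UNIV int_shift"
    by (auto simp: transformation_group_def int_shift_def)
  have rep: "represents (moire_space \<theta>) (moire_shift \<theta>) int_shift"
  proof -
    \<comment> \<open>The shifts act faithfully, as evaluation at 0 shows, so assigning
      \<open>moire_shift \<theta> x\<close> to \<open>int_shift x\<close> is well defined.\<close>
    have "x = y" if "int_shift x = int_shift y" for x y
      using fun_cong[OF that, of 0] by (simp add: int_shift_def)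
    then show ?thesis
      unfolding represents_def
      using int_shift transformation_group_moire_shift[OF \<theta>_less] by blast
  qed
  have erg: "ergodic_action (moire_space \<theta>) (moire_shift \<theta>)"
    by (rule ergodic_moire_shift[OF \<theta>_less assms(3)])
  have "ergodic_operator int_adjacent int_shift (moire_space \<theta>) (moire_shift \<theta>) (H_r \<theta> \<mu> h)"
    unfolding ergodic_operator_def
  proof (intro conjI mp erg rep random_operator_H_r)
    show "simple_graph int_adjacent"
      by (auto simp: simple_graph_def int_adjacent_def symp_def irreflp_def)
    show "automorphism_group int_adjacent int_shift"
      using int_shift by (auto simp: automorphism_group_def int_adjacent_def int_shift_def)
    \<comment> \<open>The witness is x = u - v.\<close>
    show "vertex_transitive int_shift"
      unfolding vertex_transitive_def int_shift_def by (metis diff_diff_eq2 add_diff_cancel_left' )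
    \<comment> \<open>With phase zero the prescribed unitary is the plain translation.\<close>
    have U: "(\<lambda>\<psi> \<xi>. \<psi> (int_shift x \<xi>) * cis 0) = translation x" for x
      by (auto simp: translation_def int_shift_def)
    show "\<exists>phase :: int \<Rightarrow> real \<Rightarrow> int \<Rightarrow> real. \<forall>x. \<forall>\<omega>\<in>space (moire_space \<theta>).
        let U = (\<lambda>\<psi> \<xi>. \<psi> (int_shift x \<xi>) * cis (phase x \<omega> \<xi>)) in
          unitary_operator U \<and>
          (\<forall>\<psi>\<in>ell2. H_r \<theta> \<mu> h (moire_shift \<theta> x \<omega>) \<psi> = U (H_r \<theta> \<mu> h \<omega> (adjoint_operator U \<psi>)))"
      by (rule exI[of _ "\<lambda>_ _ _. 0"]) (simp only: U Let_def, intro allI ballI conjI unitary_translation H_r_covariant)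
  qed
  moreover have "transformation_group ell2 translation"
    by (auto simp: transformation_group_def translation_add)
  ultimately show ?thesis
    using mp rep erg prob_space_moire_space[OF \<theta>_less] unitary_translation H_r_covariant by blast
qed

end
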